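(* Let $M$ be a (complex) projective manifold of dimension $3$ and let $\mathcal{D}$ be a codimension one (singular) holomorphic distribution on $M$. Then there is a rational vector field $X$ on $M$ such that $\mathbb{C}(X)=\mathbb{C}(\mathcal{D})$.
   Context: If $X$ is a rational vector field on $M$, a rational first integral of $X$ is a rational function on $M$ that is constant along the integral curves of $X$; $\mathbb{C}(X)$ denotes the field of rational first integrals of $X$. If $\mathcal{D}$ is a singular holomorphic distribution on $M$, a rational function $h$ on $M$ is a rational first integral of $\mathcal{D}$ if $h\in\mathbb{C}(X)$ for every rational vector field $X$ tangent to $\mathcal{D}$; $\mathbb{C}(\mathcal{D})$ denotes the field of rational first integrals of $\mathcal{D}$. The distribution is not assumed to be integrable. *)

theory Defs
  imports "HOL-Analysis.Analysis"
begin

text \<open>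
  Points of the projective space with homogeneous coordinates indexed by a finite type are handled
  through their homogeneous coordinates: a subset of projective space is represented by its
  punctured affine cone, the set of all nonzero vectors that represent one of its points.
\<close>

section \<open>Holomorphic maps of several variables\<close>

definition pairing :: "complex^'n \<Rightarrow> complex^'n \<Rightarrow> complex" where
  "pairing a v = (\<Sum>i\<in>UNIV. a $ i * v $ i)"

definition holo_fun :: "(complex^'n) set \<Rightarrow> (complex^'n \<Rightarrow> complex) \<Rightarrow> bool" where
  "holo_fun U f \<longleftrightarrow> (\<forall>x\<in>U. \<exists>a. (f has_derivative pairing a) (at x))"

definition holo_map :: "(complex^'m) set \<Rightarrow> (complex^'m \<Rightarrow> complex^'n) \<Rightarrow> bool" where
  "holo_map U f \<longleftrightarrow> (\<forall>x\<in>U. \<exists>A. (f has_derivative (\<lambda>v. A *v v)) (at x))"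

definition holo_immersion :: "(complex^'m) set \<Rightarrow> (complex^'m \<Rightarrow> complex^'n) \<Rightarrow> bool" where
  "holo_immersion U f \<longleftrightarrow>
     (\<forall>x\<in>U. \<exists>A. (f has_derivative (\<lambda>v. A *v v)) (at x) \<and> inj (\<lambda>v. A *v v))"

text \<open>Holomorphic functions on a locally closed set: local restrictions of ambient ones.\<close>

definition holo_fun_sub :: "(complex^'n) set \<Rightarrow> (complex^'n \<Rightarrow> complex) \<Rightarrow> bool" where
  "holo_fun_sub W g \<longleftrightarrow>
     (\<forall>p\<in>W. \<exists>N G. open N \<and> p \<in> N \<and> holo_fun N G \<and> (\<forall>x\<in>N \<inter> W. g x = G x))"

definition has_velocity :: "(complex \<Rightarrow> complex^'n) \<Rightarrow> complex^'n \<Rightarrow> complex \<Rightarrow> bool" where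
  "has_velocity \<gamma> v t \<longleftrightarrow> (\<forall>i. ((\<lambda>s. \<gamma> s $ i) has_field_derivative v $ i) (at t))"

definition complex_submanifold :: "'d::finite itself \<Rightarrow> (complex^'n) set \<Rightarrow> bool" where
  "complex_submanifold T M \<longleftrightarrow>
     (\<forall>p\<in>M. \<exists>V (\<phi> :: complex^'d \<Rightarrow> complex^'n) \<psi>.
        open V \<and> holo_immersion V \<phi> \<and> homeomorphism V (\<phi> ` V) \<phi> \<psi> \<and>
        p \<in> \<phi> ` V \<and> openin (top_of_set M) (\<phi> ` V))"

definition tangent_space :: "(complex^'n) set \<Rightarrow> complex^'n \<Rightarrow> (complex^'n) set" where
  "tangent_space M p =
     {v. \<exists>\<gamma> r. r > 0 \<and> (\<forall>i. (\<lambda>t. \<gamma> t $ i) holomorphic_on ball 0 r) \<and>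
           \<gamma> ` ball 0 r \<subseteq> M \<and> \<gamma> 0 = p \<and> has_velocity \<gamma> v 0}"

section \<open>Projective manifolds\<close>

definition hom_poly :: "nat \<Rightarrow> (complex^'n \<Rightarrow> complex) set" where
  "hom_poly k = {F. \<exists>c. F = (\<lambda>x. \<Sum>\<alpha> | (\<Sum>i\<in>UNIV. \<alpha> i) = k. c \<alpha> * (\<Prod>i\<in>UNIV. x $ i ^ \<alpha> i))}"

text \<open>The exponents in the sum above form a finite set, so that the sum is the intended one.\<close>

lemma finite_exponents: "finite {\<alpha> :: 'n::finite \<Rightarrow> nat. (\<Sum>i\<in>UNIV. \<alpha> i) = k}"
proof (rule finite_subset)
  show "{\<alpha> :: 'n \<Rightarrow> nat. (\<Sum>i\<in>UNIV. \<alpha> i) = k} \<subseteq> PiE UNIV (\<lambda>_. {..k})"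
    by (auto intro!: member_le_sum)
  show "finite (PiE (UNIV :: 'n set) (\<lambda>_. {..k}))"
    by (rule finite_PiE) auto
qed

definition projective_algebraic :: "(complex^'n) set \<Rightarrow> bool" where
  "projective_algebraic M \<longleftrightarrow>
     (\<exists>S. (\<forall>F\<in>S. \<exists>k. F \<in> hom_poly k) \<and> M = {x. x \<noteq> 0 \<and> (\<forall>F\<in>S. F x = 0)})"

text \<open>
  The dimension is the cardinality of the type \<^typ>\<open>'d\<close>. The cone over a manifold of this
  dimension has one dimension more, whence the index type \<^typ>\<open>'d option\<close>. The cone is connected
  if and only if the manifold is.
\<close>

definition projective_manifold :: "'d::finite itself \<Rightarrow> (complex^'n) set \<Rightarrow> bool" where
  "projective_manifold T M \<longleftrightarrow>
     M \<noteq> {} \<and> connected M \<and> projective_algebraic M \<and> complex_submanifold TYPE('d option) M"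

section \<open>Rational functions and rational vector fields\<close>

definition ratfun_pairs ::
    "(complex^'n) set \<Rightarrow> ((complex^'n \<Rightarrow> complex) \<times> (complex^'n \<Rightarrow> complex)) set" where
  "ratfun_pairs M =
     {(P, Q). (\<exists>k. P \<in> hom_poly k \<and> Q \<in> hom_poly k) \<and> (\<exists>x\<in>M. Q x \<noteq> 0)}"

definition ratfun_rel ::
    "(complex^'n) set \<Rightarrow> ((complex^'n \<Rightarrow> complex) \<times> (complex^'n \<Rightarrow> complex)) rel" where
  "ratfun_rel M = {((P, Q), (P', Q')). (P, Q) \<in> ratfun_pairs M \<and> (P', Q') \<in> ratfun_pairs M \<and>
     (\<forall>x\<in>M. P x * Q' x = P' x * Q x)}"

definition rational_functions ::
    "(complex^'n) set \<Rightarrow> ((complex^'n \<Rightarrow> complex) \<times> (complex^'n \<Rightarrow> complex)) set set" where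
  "rational_functions M = ratfun_pairs M // ratfun_rel M"

text \<open>A rational function takes the value \<open>c\<close> at a point if it is regular there with value \<open>c\<close>.\<close>

definition takes_value ::
    "((complex^'n \<Rightarrow> complex) \<times> (complex^'n \<Rightarrow> complex)) set \<Rightarrow> complex^'n \<Rightarrow> complex \<Rightarrow> bool" where
  "takes_value h p c \<longleftrightarrow> (\<exists>(P, Q)\<in>h. Q p \<noteq> 0 \<and> c = P p / Q p)"

text \<open>
  The tangent space of projective space at the point represented by \<open>p\<close> consists of vectors in the
  ambient linear space modulo multiples of \<open>p\<close>; replacing \<open>p\<close> by a multiple \<open>c *s p\<close> replaces \<open>v\<close>
  by \<open>c *s v\<close>. So a rational vector field is given by a quotient \<open>A / B\<close> homogeneous of degree
  one, tangent to the cone, and two quotients give the same field if they differ by multiples of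
  the radial field.
\<close>

definition vfield_pairs ::
    "(complex^'n) set \<Rightarrow> ((complex^'n \<Rightarrow> complex^'n) \<times> (complex^'n \<Rightarrow> complex)) set" where
  "vfield_pairs M =
     {(A, B). (\<exists>k. (\<forall>i. (\<lambda>x. A x $ i) \<in> hom_poly (Suc k)) \<and> B \<in> hom_poly k) \<and>
        (\<exists>x\<in>M. B x \<noteq> 0) \<and>
        (\<forall>x\<in>M. B x \<noteq> 0 \<longrightarrow> inverse (B x) *s A x \<in> tangent_space M x)}"

definition vfield_rel ::
    "(complex^'n) set \<Rightarrow> ((complex^'n \<Rightarrow> complex^'n) \<times> (complex^'n \<Rightarrow> complex)) rel" where
  "vfield_rel M = {((A, B), (A', B')). (A, B) \<in> vfield_pairs M \<and> (A', B') \<in> vfield_pairs M \<and>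
     (\<forall>x\<in>M. \<exists>c. B' x *s A x - B x *s A' x = c *s x)}"

definition rational_vector_fields ::
    "(complex^'n) set \<Rightarrow> ((complex^'n \<Rightarrow> complex^'n) \<times> (complex^'n \<Rightarrow> complex)) set set" where
  "rational_vector_fields M = vfield_pairs M // vfield_rel M"

text \<open>
  Integral curves are written in homogeneous coordinates; their velocity is prescribed modulo the
  radial direction. They stay in the set where the vector field is regular.
\<close>

definition integral_curve ::
    "(complex^'n) set \<Rightarrow> ((complex^'n \<Rightarrow> complex^'n) \<times> (complex^'n \<Rightarrow> complex)) set \<Rightarrow>
     complex set \<Rightarrow> (complex \<Rightarrow> complex^'n) \<Rightarrow> bool" where
  "integral_curve M X U \<gamma> \<longleftrightarrow>
     open U \<and> connected U \<and> \<gamma> ` U \<subseteq> M \<and>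
     (\<forall>t\<in>U. \<exists>(A, B)\<in>X. B (\<gamma> t) \<noteq> 0 \<and>
        (\<exists>c. has_velocity \<gamma> (inverse (B (\<gamma> t)) *s A (\<gamma> t) + c *s \<gamma> t) t))"

definition first_integrals ::
    "(complex^'n) set \<Rightarrow> ((complex^'n \<Rightarrow> complex^'n) \<times> (complex^'n \<Rightarrow> complex)) set \<Rightarrow>
     ((complex^'n \<Rightarrow> complex) \<times> (complex^'n \<Rightarrow> complex)) set set" where
  "first_integrals M X =
     {h \<in> rational_functions M. \<forall>U \<gamma>. integral_curve M X U \<gamma> \<longrightarrow>
        (\<forall>s\<in>U. \<forall>t\<in>U. \<forall>a b. takes_value h (\<gamma> s) a \<and> takes_value h (\<gamma> t) b \<longrightarrow> a = b)}"

section \<open>Singular holomorphic distributions of codimension one\<close>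

text \<open>
  A holomorphic 1-form on an open subset of projective space is written as its pullback to the
  cone: it is invariant under homotheties, which means that its coefficients are homogeneous of
  degree minus one, and it vanishes on the radial field.
\<close>

definition local_one_form ::
    "(complex^'n) set \<Rightarrow> (complex^'n) set \<Rightarrow> (complex^'n \<Rightarrow> complex^'n) \<Rightarrow> bool" where
  "local_one_form M U \<omega> \<longleftrightarrow>
     open U \<and> 0 \<notin> U \<and> holo_map U \<omega> \<and>
     (\<forall>p\<in>U. \<forall>c. c \<noteq> 0 \<longrightarrow> c *s p \<in> U \<and> \<omega> (c *s p) = inverse c *s \<omega> p) \<and>
     (\<forall>p\<in>U \<inter> M. pairing (\<omega> p) p = 0)"

definition form_zeros ::
    "(complex^'n) set \<Rightarrow> (complex^'n) set \<Rightarrow> (complex^'n \<Rightarrow> complex^'n) \<Rightarrow> (complex^'n) set" where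
  "form_zeros M U \<omega> = {p \<in> U \<inter> M. \<forall>v\<in>tangent_space M p. pairing (\<omega> p) v = 0}"

text \<open>
  For the cone \<open>Z\<close> over an analytic subset of a manifold of dimension \<^term>\<open>CARD('d)\<close>: the subset
  has codimension at least two if and only if \<open>Z\<close>, whose dimension exceeds that of the subset by
  one, contains no piece of a manifold of dimension \<^term>\<open>CARD('d)\<close>.
\<close>

definition codim_ge_two :: "'d::finite itself \<Rightarrow> (complex^'n) set \<Rightarrow> bool" where
  "codim_ge_two T Z \<longleftrightarrow>
     \<not> (\<exists>V (\<phi> :: complex^'d \<Rightarrow> complex^'n).
          open V \<and> V \<noteq> {} \<and> holo_immersion V \<phi> \<and> inj_on \<phi> V \<and> \<phi> ` V \<subseteq> Z)"

text \<open>
  The distribution is given by local 1-forms on an open cover, which agree up to nowhere vanishing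
  holomorphic factors and have zeros in codimension at least two. No integrability is required.
\<close>

definition codim_one_distribution ::
    "'d::finite itself \<Rightarrow> (complex^'n) set \<Rightarrow>
     ((complex^'n) set \<times> (complex^'n \<Rightarrow> complex^'n)) set \<Rightarrow> bool" where
  "codim_one_distribution T M D \<longleftrightarrow>
     M \<subseteq> (\<Union>(U, \<omega>)\<in>D. U) \<and>
     (\<forall>(U, \<omega>)\<in>D. local_one_form M U \<omega> \<and> codim_ge_two TYPE('d) (form_zeros M U \<omega>)) \<and>
     (\<forall>(U, \<omega>)\<in>D. \<forall>(U', \<omega>')\<in>D. \<exists>g. holo_fun_sub (U \<inter> U' \<inter> M) g \<and>
        (\<forall>p\<in>U \<inter> U' \<inter> M. g p \<noteq> 0 \<and>
           (\<forall>v\<in>tangent_space M p. pairing (\<omega> p) v = g p * pairing (\<omega>' p) v)))"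

definition tangent_to ::
    "(complex^'n) set \<Rightarrow> ((complex^'n \<Rightarrow> complex^'n) \<times> (complex^'n \<Rightarrow> complex)) set \<Rightarrow>
     ((complex^'n) set \<times> (complex^'n \<Rightarrow> complex^'n)) set \<Rightarrow> bool" where
  "tangent_to M X D \<longleftrightarrow>
     (\<forall>(A, B)\<in>X. \<forall>(U, \<omega>)\<in>D. \<forall>p\<in>U \<inter> M.
        B p \<noteq> 0 \<longrightarrow> pairing (\<omega> p) (inverse (B p) *s A p) = 0)"

definition distribution_first_integrals ::
    "(complex^'n) set \<Rightarrow> ((complex^'n) set \<times> (complex^'n \<Rightarrow> complex^'n)) set \<Rightarrow>
     ((complex^'n \<Rightarrow> complex) \<times> (complex^'n \<Rightarrow> complex)) set set" where
  "distribution_first_integrals M D =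
     {h \<in> rational_functions M.
        \<forall>X\<in>rational_vector_fields M. tangent_to M X D \<longrightarrow> h \<in> first_integrals M X}"

end

theory Submission
  imports Defs "HOL-Complex_Analysis.Conformal_Mappings"
    "HOL-Computational_Algebra.Polynomial" "HOL-Computational_Algebra.Fraction_Field"
begin

text \<open>
  A rational vector field \<open>X\<close> acts as a derivation on the function field \<open>L\<close> of \<open>M\<close>, and its rational first
  integrals are the constants of this derivation (\<open>first_integral_iff\<close>): constancy along integral curves
  gives a vanishing derivative because there is an integral curve through each regular point, obtained by
  Picard iteration in the ambient space and contained in the cone over \<open>M\<close> because \<open>X\<close> preserves the
  ideal of the cone.  So the field \<open>K\<close> of first integrals of a distribution is the field of common
  constants of a set of derivations of \<open>L\<close>, and a derivation of \<open>L\<close> is needed whose field of constants is \<open>K\<close>.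

  Such a derivation is written down in suitable coordinates
  (\<open>single_derivation_with_common_constants\<close>).  Let \<open>z i\<close> be \<open>dim M\<close> elements of \<open>L\<close> with dual derivations
  \<open>D i\<close>.  As many of the \<open>z i\<close> as possible are exchanged for elements of \<open>K\<close>; then the \<open>D i\<close> of the
  others kill \<open>K\<close>.  Let \<open>X\<close> be the sum of \<open>\<tau> i * z i * D i\<close> over the others, with complex numbers \<open>\<tau> i\<close>
  that are linearly independent over the integers.  The monomials in these \<open>z i\<close> are eigenvectors of \<open>X\<close>
  with distinct eigenvalues, hence linearly independent over the constants of \<open>X\<close>.  If \<open>X\<close> kills \<open>h\<close>, an
  algebraic relation between \<open>h\<close> and all \<open>z i\<close> therefore splits into relations between \<open>h\<close> and those \<open>z i\<close>
  that belong to \<open>K\<close>.  So \<open>h\<close> is algebraic over \<open>K\<close>, and every derivation that kills \<open>K\<close> kills \<open>h\<close>.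

  This uses two facts on \<open>L\<close>.  First, any \<open>dim M + 1\<close> elements are algebraically dependent
  (\<open>functions_algebraically_dependent\<close>).  By Siegel's method, this follows from the compactness of \<open>M\<close>: a
  polynomial of degree \<open>N\<close> that vanishes on a grid of about \<open>N\<close> points per dimension in each of finitely
  many charts vanishes on the cone by a Schwarz lemma (\<open>grid_Schwarz\<close>), and the number of monomials exceeds
  the number of these linear conditions.  Second, there are \<open>dim M\<close> functions with dual derivations
  (\<open>dual_derivations\<close>).  These come from a maximal set of algebraically independent coordinates: the
  equations for the other coordinates have, at a general point, linearly independent differentials that cut
  out exactly the tangent space of the cone (\<open>tangent_space_from_equations\<close>).
\<close>

section \<open>Derivations of fields and their constants\<close>

definition is_subfield :: "'a::field set \<Rightarrow> bool" where
  "is_subfield L \<longleftrightarrow> 0 \<in> L \<and> 1 \<in> L \<and> (\<forall>a\<in>L. \<forall>b\<in>L. a + b \<in> L \<and> a * b \<in> L) \<and>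
     (\<forall>a\<in>L. - a \<in> L \<and> inverse a \<in> L)"

lemma is_subfieldD:
  assumes "is_subfield L"
  shows "0 \<in> L" "1 \<in> L" "\<And>a b. a \<in> L \<Longrightarrow> b \<in> L \<Longrightarrow> a + b \<in> L"
    "\<And>a b. a \<in> L \<Longrightarrow> b \<in> L \<Longrightarrow> a * b \<in> L" "\<And>a. a \<in> L \<Longrightarrow> - a \<in> L"
    "\<And>a. a \<in> L \<Longrightarrow> inverse a \<in> L" "\<And>a b. a \<in> L \<Longrightarrow> b \<in> L \<Longrightarrow> a - b \<in> L"
    "\<And>a b. a \<in> L \<Longrightarrow> b \<in> L \<Longrightarrow> a / b \<in> L"
proof -
  note d = assms[unfolded is_subfield_def]
  show "0 \<in> L" "1 \<in> L" "\<And>a b. a \<in> L \<Longrightarrow> b \<in> L \<Longrightarrow> a + b \<in> L"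
    "\<And>a b. a \<in> L \<Longrightarrow> b \<in> L \<Longrightarrow> a * b \<in> L" "\<And>a. a \<in> L \<Longrightarrow> - a \<in> L"
    "\<And>a. a \<in> L \<Longrightarrow> inverse a \<in> L"
    using d by blast+
  show "a - b \<in> L" if "a \<in> L" "b \<in> L" for a b
    using d that diff_conv_add_uminus[of a b] by metis
  show "a / b \<in> L" if "a \<in> L" "b \<in> L" for a b
    using d that divide_inverse[of a b] by metis
qed

lemma subfield_sum: "is_subfield L \<Longrightarrow> (\<And>i. i \<in> I \<Longrightarrow> f i \<in> L) \<Longrightarrow> sum f I \<in> L"
  by (induction I rule: infinite_finite_induct) (auto intro: is_subfieldD)

lemma subfield_prod: "is_subfield L \<Longrightarrow> (\<And>i. i \<in> I \<Longrightarrow> f i \<in> L) \<Longrightarrow> prod f I \<in> L"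
  by (induction I rule: infinite_finite_induct) (auto intro: is_subfieldD)

lemma subfield_power: "is_subfield L \<Longrightarrow> a \<in> L \<Longrightarrow> a ^ n \<in> L"
  by (induction n) (auto intro: is_subfieldD)

lemma subfield_of_nat: "is_subfield L \<Longrightarrow> of_nat n \<in> L"
  by (induction n) (auto intro: is_subfieldD)

definition derivation_on :: "'a::field set \<Rightarrow> ('a \<Rightarrow> 'a) \<Rightarrow> bool" where
  "derivation_on L \<delta> \<longleftrightarrow> (\<forall>a\<in>L. \<delta> a \<in> L) \<and>
     (\<forall>a\<in>L. \<forall>b\<in>L. \<delta> (a + b) = \<delta> a + \<delta> b \<and> \<delta> (a * b) = \<delta> a * b + a * \<delta> b)"

locale field_derivation =
  fixes L :: "'a::field_char_0 set" and \<delta> :: "'a \<Rightarrow> 'a"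
  assumes subfield: "is_subfield L" and derivation: "derivation_on L \<delta>"
begin

lemmas L_closed = is_subfieldD[OF subfield] subfield_sum[OF subfield] subfield_prod[OF subfield]
  subfield_power[OF subfield] subfield_of_nat[OF subfield]

lemma der_closed: "a \<in> L \<Longrightarrow> \<delta> a \<in> L"
  and der_add: "a \<in> L \<Longrightarrow> b \<in> L \<Longrightarrow> \<delta> (a + b) = \<delta> a + \<delta> b"
  and der_mult: "a \<in> L \<Longrightarrow> b \<in> L \<Longrightarrow> \<delta> (a * b) = \<delta> a * b + a * \<delta> b"
  using derivation by (auto simp: derivation_on_def)

lemma der_0: "\<delta> 0 = 0"
  using der_add[of 0 0] L_closed(1) by simp

lemma der_1: "\<delta> 1 = 0"
  using der_mult[of 1 1] L_closed(2) by simp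

lemma der_sum: "(\<And>i. i \<in> I \<Longrightarrow> f i \<in> L) \<Longrightarrow> \<delta> (sum f I) = (\<Sum>i\<in>I. \<delta> (f i))"
  by (induction I rule: infinite_finite_induct) (auto simp: der_0 der_add L_closed)

lemma der_of_nat: "\<delta> (of_nat n) = 0"
  by (induction n) (auto simp: der_0 der_1 der_add L_closed)

lemma der_const_mult: "a \<in> L \<Longrightarrow> \<delta> a = 0 \<Longrightarrow> b \<in> L \<Longrightarrow> \<delta> (a * b) = a * \<delta> b"
  by (simp add: der_mult)

lemma der_const_power: "a \<in> L \<Longrightarrow> \<delta> a = 0 \<Longrightarrow> \<delta> (a ^ n) = 0"
  by (induction n) (auto simp: der_1 der_mult L_closed)

lemma der_const_prod: "(\<And>i. i \<in> I \<Longrightarrow> f i \<in> L \<and> \<delta> (f i) = 0) \<Longrightarrow> \<delta> (prod f I) = 0"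
  by (induction I rule: infinite_finite_induct) (auto simp: der_1 der_mult L_closed)

lemma der_poly:
  assumes "h \<in> L" "\<And>i. coeff p i \<in> L \<and> \<delta> (coeff p i) = 0"
  shows "poly p h \<in> L \<and> \<delta> (poly p h) = poly (pderiv p) h * \<delta> h"
  using assms(2)
proof (induction p)
  case 0
  then show ?case by (simp add: der_0 L_closed)
next
  case (pCons a p)
  have 1: "a \<in> L" "\<delta> a = 0" using pCons.prems[of 0] by simp_all
  have "coeff p i \<in> L \<and> \<delta> (coeff p i) = 0" for i using pCons.prems[of "Suc i"] by simp
  then have 2: "poly p h \<in> L" "\<delta> (poly p h) = poly (pderiv p) h * \<delta> h" using pCons.IH by auto
  show ?case using 1 2 assms(1)
    by (simp add: L_closed der_add der_mult pderiv_pCons algebra_simps)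
qed

text \<open>
  If the formal derivative of \<open>p\<close> vanishes at \<open>h\<close> too, it takes the place of \<open>p\<close>; otherwise
  differentiating \<open>poly p h = 0\<close> along \<open>\<delta>\<close> gives \<open>\<delta> h = 0\<close>.
\<close>

lemma algebraic_over_constants_is_constant:
  assumes "h \<in> L" "p \<noteq> 0" "poly p h = 0" "\<And>i. coeff p i \<in> L \<and> \<delta> (coeff p i) = 0"
  shows "\<delta> h = 0"
  using assms(2-)
proof (induction "degree p" arbitrary: p rule: less_induct)
  case less
  have eq: "poly (pderiv p) h * \<delta> h = 0"
    using der_poly[OF assms(1), of p] less.prems der_0 by simp
  have "degree p \<noteq> 0"
  proof
    assume "degree p = 0"
    then obtain a where "p = [:a:]" by (rule degree_eq_zeroE)
    then show False using less.prems by simp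
  qed
  then have nz: "pderiv p \<noteq> 0" and dg: "degree (pderiv p) < degree p"
    by (auto simp: pderiv_eq_0_iff degree_pderiv)
  have c: "coeff (pderiv p) i \<in> L \<and> \<delta> (coeff (pderiv p) i) = 0" for i
    unfolding coeff_pderiv using less.prems(3)[of "Suc i"] der_of_nat[of "Suc i"] L_closed(12)[of "Suc i"]
    by (auto simp: L_closed der_mult simp del: of_nat_Suc)
  show ?case
  proof (cases "poly (pderiv p) h = 0")
    case True
    then show ?thesis using less.hyps[OF dg nz True] c by blast
  next
    case False
    then show ?thesis using eq by simp
  qed
qed

lemma der_monomial:
  assumes "\<And>i. i \<in> I \<Longrightarrow> z i \<in> L \<and> \<delta> (z i) = w i * z i \<and> w i \<in> L"
  shows "(\<Prod>i\<in>I. z i ^ \<alpha> i) \<in> L"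
    and "\<delta> (\<Prod>i\<in>I. z i ^ \<alpha> i) = (\<Sum>i\<in>I. of_nat (\<alpha> i) * w i) * (\<Prod>i\<in>I. z i ^ \<alpha> i)"
proof -
  have pw: "\<delta> (a ^ n) = of_nat n * v * a ^ n" if "a \<in> L" "\<delta> a = v * a" for a v n
    using that by (induction n) (auto simp: der_1 der_mult L_closed algebra_simps)
  have "(\<Prod>i\<in>I. z i ^ \<alpha> i) \<in> L \<and>
     \<delta> (\<Prod>i\<in>I. z i ^ \<alpha> i) = (\<Sum>i\<in>I. of_nat (\<alpha> i) * w i) * (\<Prod>i\<in>I. z i ^ \<alpha> i)"
    using assms
  proof (induction I rule: infinite_finite_induct)
    case (insert j I)
    then have "z j \<in> L" "\<delta> (z j) = w j * z j" by auto
    moreover have "(\<Prod>i\<in>I. z i ^ \<alpha> i) \<in> L"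
      "\<delta> (\<Prod>i\<in>I. z i ^ \<alpha> i) = (\<Sum>i\<in>I. of_nat (\<alpha> i) * w i) * (\<Prod>i\<in>I. z i ^ \<alpha> i)"
      using insert by auto
    ultimately show ?case using insert.hyps pw[of "z j" "w j" "\<alpha> j"]
      by (simp add: der_mult L_closed algebra_simps)
  qed (auto simp: der_1 L_closed)
  then show "(\<Prod>i\<in>I. z i ^ \<alpha> i) \<in> L"
    and "\<delta> (\<Prod>i\<in>I. z i ^ \<alpha> i) = (\<Sum>i\<in>I. of_nat (\<alpha> i) * w i) * (\<Prod>i\<in>I. z i ^ \<alpha> i)" by auto
qed

text \<open>
  The usual argument for distinct eigenvalues: applying \<open>\<delta>\<close> to a relation and subtracting a multiple of
  it removes one term.  It works over all constants of \<open>\<delta>\<close>, since these commute with \<open>\<delta>\<close>.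
\<close>

lemma eigenvectors_independent:
  assumes "finite A" "inj_on \<mu> A"
    and "\<And>a. a \<in> A \<Longrightarrow> u a \<in> L \<and> u a \<noteq> 0 \<and> \<delta> (u a) = \<mu> a * u a \<and> \<mu> a \<in> L \<and> \<delta> (\<mu> a) = 0"
    and "\<And>a. a \<in> A \<Longrightarrow> b a \<in> L \<and> \<delta> (b a) = 0"
    and "(\<Sum>a\<in>A. b a * u a) = 0" "a \<in> A"
  shows "b a = 0"
  using assms
proof (induction A arbitrary: b a rule: finite_induct)
  case (insert e A)
  have eL: "\<mu> e \<in> L" "\<delta> (\<mu> e) = 0" "u e \<noteq> 0" using insert.prems(2) by auto
  have "0 = \<delta> (\<Sum>a\<in>insert e A. b a * u a)" using insert.prems(4) by (simp add: der_0)
  also have "\<dots> = (\<Sum>a\<in>insert e A. \<delta> (b a * u a))"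
    using insert.prems by (intro der_sum) (auto simp: L_closed)
  also have "\<dots> = (\<Sum>a\<in>insert e A. b a * (\<mu> a * u a))"
    using insert.prems(2,3) by (intro sum.cong) (auto simp: der_const_mult)
  finally have "(\<Sum>a\<in>insert e A. b a * (\<mu> a * u a)) - \<mu> e * (\<Sum>a\<in>insert e A. b a * u a) = 0"
    using insert.prems(4) by simp
  then have s: "(\<Sum>a\<in>A. (b a * (\<mu> a - \<mu> e)) * u a) = 0"
    using insert.hyps by (simp add: sum_distrib_left sum_subtractf algebra_simps)
  have z: "b a = 0" if "a \<in> A" for a
  proof -
    have "b a * (\<mu> a - \<mu> e) = 0"
    proof (rule insert.IH[OF _ _ _ s that])
      show "inj_on \<mu> A" using insert.prems(1) by simp
      show "b a * (\<mu> a - \<mu> e) \<in> L \<and> \<delta> (b a * (\<mu> a - \<mu> e)) = 0" if "a \<in> A" for a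
      proof -
        have "b a \<in> L" "\<delta> (b a) = 0" "\<mu> a \<in> L" "\<delta> (\<mu> a) = 0" using insert.prems that by auto
        moreover from this have "\<delta> (\<mu> a - \<mu> e + \<mu> e) = \<delta> (\<mu> a - \<mu> e) + \<delta> (\<mu> e)"
          by (intro der_add) (auto simp: L_closed eL)
        ultimately show ?thesis using eL by (simp add: der_const_mult L_closed)
      qed
    qed (use insert.prems in auto)
    moreover have "\<mu> a \<noteq> \<mu> e" using insert.prems(1) insert.hyps that by (auto simp: inj_on_def)
    ultimately show ?thesis by simp
  qed
  have "b e * u e = 0" using insert.prems(4) insert.hyps z by simp
  then have "b e = 0" using eL by simp
  with z insert.prems(5) show ?case by auto
qed simp

end

text \<open>
  In coordinates \<open>z\<close> dual to the derivations \<open>\<partial>\<close>, as many of them as possible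
  taken from the field \<open>K\<close> of common constants, the derivations \<open>\<partial> i\<close> of the remaining coordinates
  kill \<open>K\<close>.  The Euler-like field \<open>\<Sum>i. \<tau> i * z i * \<partial> i\<close> over the remaining coordinates has the
  monomials as eigenvectors, with distinct eigenvalues if the \<open>\<tau> i\<close> are independent over the
  integers.  An algebraic relation between a constant \<open>h\<close> of it and the \<open>z i\<close> therefore splits into
  relations between \<open>h\<close> and those \<open>z i\<close> that belong to \<open>K\<close>, so that \<open>h\<close> is algebraic over \<open>K\<close>.
\<close>

theorem single_derivation_with_common_constants:
  fixes L C :: "'a::field_char_0 set" and V W :: "('a \<Rightarrow> 'a) set" and d :: nat
  assumes L: "is_subfield L" and C: "C \<subseteq> L"
    and V: "\<And>Y. Y \<in> V \<Longrightarrow> derivation_on L Y \<and> (\<forall>c\<in>C. Y c = 0)"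
    and V_comb: "\<And>Y Z a b. Y \<in> V \<Longrightarrow> Z \<in> V \<Longrightarrow> a \<in> L \<Longrightarrow> b \<in> L \<Longrightarrow> (\<lambda>x. a * Y x + b * Z x) \<in> V"
    and V_ne: "V \<noteq> {}"
    and dep: "\<And>f :: nat \<Rightarrow> 'a. \<forall>i\<le>d. f i \<in> L \<Longrightarrow>
        \<exists>A c. finite A \<and> (\<exists>\<alpha>\<in>A. c \<alpha> \<noteq> 0) \<and> (\<forall>\<alpha>\<in>A. c \<alpha> \<in> C) \<and>
          (\<forall>\<alpha>\<in>A. \<forall>\<beta>\<in>A. (\<forall>i\<le>d. \<alpha> i = \<beta> i) \<longrightarrow> \<alpha> = \<beta>) \<and>
          (\<Sum>\<alpha>\<in>A. c \<alpha> * (\<Prod>i\<le>d. f i ^ \<alpha> i)) = 0"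
    and dual: "\<And>i. i < d \<Longrightarrow> z i \<in> L \<and> D i \<in> V"
      "\<And>i j. i < d \<Longrightarrow> j < d \<Longrightarrow> D i (z j) = (if i = j then 1 else 0)"
    and lam: "\<And>i :: nat. \<tau> i \<in> C"
      "\<And>\<alpha> \<beta> :: nat \<Rightarrow> nat. (\<Sum>i<d. of_nat (\<alpha> i) * \<tau> i) = (\<Sum>i<d. of_nat (\<beta> i) * \<tau> i) \<Longrightarrow> \<forall>i<d. \<alpha> i = \<beta> i"
    and W: "W \<subseteq> V"
  shows "\<exists>X\<in>V. {a \<in> L. X a = 0} = {a \<in> L. \<forall>Y\<in>W. Y a = 0}"
proof -
  define K where "K = {a \<in> L. \<forall>Y\<in>W. Y a = 0}"
  define dl where "dl = (\<lambda>(z, D). (\<forall>i<d. z i \<in> L \<and> D i \<in> V) \<and>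
     (\<forall>i<d. \<forall>j<d. D i (z j) = (if i = j then 1 else (0 :: 'a))))"
  define m where "m = (\<lambda>(z :: nat \<Rightarrow> 'a, D :: nat \<Rightarrow> 'a \<Rightarrow> 'a). card {i. i < d \<and> z i \<in> K})"
  have fd: "field_derivation L Y" if "Y \<in> V" for Y
    using L V[OF that] by (simp add: field_derivation_def)
  note Lc = is_subfieldD[OF L] subfield_sum[OF L] subfield_prod[OF L] subfield_power[OF L]
    subfield_of_nat[OF L]
  have "\<exists>s. dl s \<and> (\<forall>s'. dl s' \<longrightarrow> m s' \<le> m s)"
  proof (rule ex_has_greatest_nat)
    show "dl (z, D)" using dual by (simp add: dl_def)
    show "\<forall>s. dl s \<longrightarrow> m s < Suc d"
    proof (intro allI impI)
      fix s assume "dl s" show "m s < Suc d"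
        using card_mono[of "{..<d}" "{i. i < d \<and> fst s i \<in> K}"]
        by (cases s) (simp add: m_def subset_iff less_Suc_eq_le)
    qed
  qed
  then obtain z D where zD: "dl (z, D)" and mx: "\<And>z' D'. dl (z', D') \<Longrightarrow> m (z', D') \<le> m (z, D)"
    by auto
  have zL: "z i \<in> L" and DV: "D i \<in> V" if "i < d" for i using zD that by (auto simp: dl_def)
  have Dz: "D i (z j) = (if i = j then 1 else 0)" if "i < d" "j < d" for i j
    using zD that by (auto simp: dl_def)
  define S where "S = {i. i < d \<and> z i \<in> K}"
  define T where "T = {..<d} - S"
  have ST: "S \<subseteq> {..<d}" "T \<subseteq> {..<d}" "S \<inter> T = {}" "S \<union> T = {..<d}" "finite S" "finite T"
    by (auto simp: S_def T_def)
  \<comment> \<open>Otherwise \<open>k\<close> could be exchanged for \<open>z i\<close>, which gives one more coordinate in \<open>K\<close>.\<close>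
  have DK: "D i k = 0" if i: "i \<in> T" and k: "k \<in> K" for i k
  proof (rule ccontr)
    assume nz: "D i k \<noteq> 0"
    have id: "i < d" using i ST by auto
    have kL: "k \<in> L" using k by (simp add: K_def)
    interpret i: field_derivation L "D i" using fd DV id by blast
    define z' where "z' = z(i := k)"
    define E where "E = (\<lambda>x. inverse (D i k) * D i x + 0 * D i x)"
    define D' where "D' = (\<lambda>j. if j = i then E else (\<lambda>x. 1 * D j x + (- D j k) * E x))"
    have EV: "E \<in> V" unfolding E_def using DV[OF id] kL
      by (intro V_comb) (auto intro!: Lc(6) i.der_closed Lc(1))
    have "dl (z', D')"
    proof -
      have "D' j \<in> V" if "j < d" for j
      proof (cases "j = i")
        case False
        interpret j: field_derivation L "D j" using fd DV that by blast
        have "(\<lambda>x. 1 * D j x + (- D j k) * E x) \<in> V"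
          using DV[OF that] EV kL by (intro V_comb) (auto intro: Lc j.der_closed)
        then show ?thesis using False by (simp add: D'_def)
      qed (simp add: D'_def EV)
      moreover have "z' j \<in> L" if "j < d" for j using that zL kL by (auto simp: z'_def)
      moreover have "D' j (z' l) = (if j = l then 1 else 0)" if "j < d" "l < d" for j l
        using that nz Dz id by (auto simp: D'_def z'_def E_def)
      ultimately show ?thesis by (auto simp: dl_def)
    qed
    then have "m (z', D') \<le> m (z, D)" by (rule mx)
    moreover have "{j. j < d \<and> z' j \<in> K} = insert i S"
      using i id k by (auto simp: z'_def S_def T_def)
    moreover have "i \<notin> S" using i by (simp add: T_def)
    ultimately show False using ST by (simp add: m_def S_def[symmetric])
  qed
  define XR where "XR = (\<lambda>R x. \<Sum>i\<in>R. (\<tau> i * z i) * D i x)"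
  have XV: "XR R \<in> V" if "R \<subseteq> {..<d}" for R
  proof -
    have "finite R" using that finite_subset by blast
    then show ?thesis using that
    proof (induction R rule: finite_induct)
      case empty
      obtain Y where "Y \<in> V" using V_ne by blast
      then have "(\<lambda>x. 0 * Y x + 0 * Y x) \<in> V" using Lc(1) V_comb by blast
      then show ?case by (simp add: XR_def)
    next
      case (insert i R)
      have "(\<lambda>x. (\<tau> i * z i) * D i x + 1 * XR R x) \<in> V"
        using insert DV zL lam(1) C by (intro V_comb) (auto intro!: Lc)
      also have "(\<lambda>x. (\<tau> i * z i) * D i x + 1 * XR R x) = XR (insert i R)"
        using insert.hyps by (auto simp: XR_def)
      finally show ?case .
    qed
  qed
  have Xz: "XR R (z i) = (if i \<in> R then \<tau> i else 0) * z i" if R: "R \<subseteq> {..<d}" and "i < d" for R i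
  proof -
    have "finite R" using R finite_subset by blast
    moreover have "XR R (z i) = (\<Sum>j\<in>R. if j = i then \<tau> i * z i else 0)"
      unfolding XR_def using that Dz by (intro sum.cong) auto
    ultimately show ?thesis by simp
  qed
  have z0: "z i \<noteq> 0" if "i < d" for i
  proof
    assume "z i = 0"
    then have "D i (z i) = 0" using field_derivation.der_0[OF fd[OF DV[OF that]]] by simp
    then show False using Dz[OF that that] by simp
  qed
  have wt: "\<forall>i\<in>R. \<alpha> i = \<beta> i"
    if "R \<subseteq> {..<d}" "(\<Sum>i\<in>R. of_nat (\<alpha> i) * \<tau> i) = (\<Sum>i\<in>R. of_nat (\<beta> i) * \<tau> i)" for R and \<alpha> \<beta> :: "nat \<Rightarrow> nat"
  proof -
    have e: "(\<Sum>i<d. of_nat (if i \<in> R then \<gamma> i else 0) * \<tau> i) = (\<Sum>i\<in>R. of_nat (\<gamma> i) * \<tau> i)" for \<gamma> :: "nat \<Rightarrow> nat"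
      using that(1) by (intro sum.mono_neutral_cong_right) auto
    have "\<forall>i<d. (if i \<in> R then \<alpha> i else 0) = (if i \<in> R then \<beta> i else 0)"
      by (rule lam(2)) (simp only: e that(2))
    then show ?thesis using that(1) by (metis lessThan_iff subsetD)
  qed
  have indep: "\<forall>a\<in>A. b a = 0"
    if R: "R \<subseteq> {..<d}" and A: "finite A"
      and inj: "\<And>\<alpha> \<beta>. \<alpha> \<in> A \<Longrightarrow> \<beta> \<in> A \<Longrightarrow> \<forall>i\<in>R. \<alpha> i = \<beta> i \<Longrightarrow> \<alpha> = \<beta>"
      and b: "\<And>\<alpha>. \<alpha> \<in> A \<Longrightarrow> b \<alpha> \<in> L \<and> XR R (b \<alpha>) = 0"
      and s: "(\<Sum>\<alpha>\<in>A. b \<alpha> * (\<Prod>i\<in>R. z i ^ \<alpha> i)) = 0" for R and A :: "(nat \<Rightarrow> nat) set" and b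
  proof
    fix a assume a: "a \<in> A"
    interpret X: field_derivation L "XR R" using fd XV R by blast
    have XC: "XR R c = 0" if "c \<in> C" for c using V[OF XV[OF R]] that by blast
    have fR: "finite R" using R finite_subset by blast
    have zz: "z i \<in> L \<and> XR R (z i) = \<tau> i * z i \<and> \<tau> i \<in> L" if "i \<in> R" for i
      using that R zL Xz[OF R, of i] lam(1) C by auto
    show "b a = 0"
    proof (rule X.eigenvectors_independent[OF A _ _ b s a, where \<mu> = "\<lambda>\<alpha>. \<Sum>i\<in>R. of_nat (\<alpha> i) * \<tau> i"])
      show "inj_on (\<lambda>\<alpha>. \<Sum>i\<in>R. of_nat (\<alpha> i) * \<tau> i) A"
        using inj wt[OF R] by (intro inj_onI) blast
      fix \<alpha>
      have "(\<Prod>i\<in>R. z i ^ \<alpha> i) \<noteq> 0" using z0 R fR by auto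
      moreover have "(\<Sum>i\<in>R. of_nat (\<alpha> i) * \<tau> i) \<in> L" using zz by (intro Lc) auto
      moreover have "XR R (\<Sum>i\<in>R. of_nat (\<alpha> i) * \<tau> i) = 0"
        using zz XC lam(1) by (subst X.der_sum) (auto intro!: Lc sum.neutral simp: X.der_mult X.der_of_nat Lc(12))
      ultimately show "(\<Prod>i\<in>R. z i ^ \<alpha> i) \<in> L \<and> (\<Prod>i\<in>R. z i ^ \<alpha> i) \<noteq> 0 \<and>
         XR R (\<Prod>i\<in>R. z i ^ \<alpha> i) = (\<Sum>i\<in>R. of_nat (\<alpha> i) * \<tau> i) * (\<Prod>i\<in>R. z i ^ \<alpha> i) \<and>
         (\<Sum>i\<in>R. of_nat (\<alpha> i) * \<tau> i) \<in> L \<and> XR R (\<Sum>i\<in>R. of_nat (\<alpha> i) * \<tau> i) = 0"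
        using X.der_monomial[of R z \<tau> \<alpha>, OF zz] by (intro conjI) assumption+
    qed
  qed
  have "a \<in> K" if aL: "a \<in> L" and Xa: "XR T a = 0" for a
  proof -
    define f where "f = (\<lambda>i. if i < d then z i else a)"
    have "\<forall>i\<le>d. f i \<in> L" using zL aL by (auto simp: f_def)
    from dep[OF this] obtain A c where A1: "finite A" "\<exists>\<alpha>\<in>A. c \<alpha> \<noteq> 0"
      and A2: "\<forall>\<alpha>\<in>A. c \<alpha> \<in> C"
      and A5: "\<forall>\<alpha>\<in>A. \<forall>\<beta>\<in>A. (\<forall>i\<le>d. \<alpha> i = \<beta> i) \<longrightarrow> \<alpha> = \<beta>"
      and A3: "(\<Sum>\<alpha>\<in>A. c \<alpha> * (\<Prod>i\<le>d. f i ^ \<alpha> i)) = 0"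
      by (elim exE conjE)
    have A4: "c \<alpha> \<in> C" if "\<alpha> \<in> A" for \<alpha> using A2 that by blast
    note A = A1 A4 A5 A3
    have pr: "(\<Prod>i\<le>d. f i ^ \<alpha> i) = (\<Prod>i\<in>S. z i ^ \<alpha> i) * (\<Prod>i\<in>T. z i ^ \<alpha> i) * a ^ \<alpha> d" for \<alpha>
    proof -
      have "(\<Prod>i\<le>d. f i ^ \<alpha> i) = (\<Prod>i<d. f i ^ \<alpha> i) * f d ^ \<alpha> d"
        by (simp add: lessThan_Suc_atMost[symmetric] mult.commute)
      also have "(\<Prod>i<d. f i ^ \<alpha> i) = (\<Prod>i\<in>S \<union> T. z i ^ \<alpha> i)"
        unfolding ST(4) by (intro prod.cong) (auto simp: f_def)
      also have "\<dots> = (\<Prod>i\<in>S. z i ^ \<alpha> i) * (\<Prod>i\<in>T. z i ^ \<alpha> i)"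
        using ST by (intro prod.union_disjoint) auto
      finally show ?thesis by (simp add: f_def)
    qed
    define \<kappa> where "\<kappa> = (\<lambda>(\<alpha> :: nat \<Rightarrow> nat) i. if i \<in> T then \<alpha> i else 0)"
    define b where "b = (\<lambda>\<beta>. \<Sum>\<alpha> | \<alpha> \<in> A \<and> \<kappa> \<alpha> = \<beta>. c \<alpha> * (\<Prod>i\<in>S. z i ^ \<alpha> i) * a ^ \<alpha> d)"
    interpret X: field_derivation L "XR T" using fd XV ST(2) by blast
    have XC: "XR T c = 0" if "c \<in> C" for c using V[OF XV[OF ST(2)]] that by blast
    have zS: "z i \<in> L \<and> XR T (z i) = 0" if "i \<in> S" for i
    proof -
      have "i < d" "i \<notin> T" using that ST by auto
      then show ?thesis using Xz[OF ST(2), of i] zL[of i] by simp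
    qed
    have tL: "c \<alpha> * (\<Prod>i\<in>S. z i ^ \<alpha> i) \<in> L" if "\<alpha> \<in> A" for \<alpha>
      using A(3)[OF that] C zS by (intro Lc) auto
    have tX: "XR T (c \<alpha> * (\<Prod>i\<in>S. z i ^ \<alpha> i)) = 0" if "\<alpha> \<in> A" for \<alpha>
      using A(3)[OF that] C zS XC
      by (subst X.der_mult) (auto intro!: Lc X.der_const_prod simp: X.der_const_power)
    have "\<forall>\<beta>\<in>\<kappa> ` A. b \<beta> = 0"
    proof (rule indep[OF ST(2)])
      show "finite (\<kappa> ` A)" using A by simp
      show "\<alpha> = \<beta>" if "\<alpha> \<in> \<kappa> ` A" "\<beta> \<in> \<kappa> ` A" "\<forall>i\<in>T. \<alpha> i = \<beta> i" for \<alpha> \<beta>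
      proof -
        have "\<alpha> i = 0 \<and> \<beta> i = 0" if "i \<notin> T" for i
          using \<open>\<alpha> \<in> \<kappa> ` A\<close> \<open>\<beta> \<in> \<kappa> ` A\<close> that by (auto simp: \<kappa>_def)
        then show ?thesis using that(3) by (intro ext) metis
      qed
      show "b \<beta> \<in> L \<and> XR T (b \<beta>) = 0" if "\<beta> \<in> \<kappa> ` A" for \<beta>
      proof
        show "b \<beta> \<in> L" unfolding b_def using aL by (intro Lc(9) Lc(4)[OF tL] Lc(11)) auto
        show "XR T (b \<beta>) = 0" unfolding b_def using tX aL Xa
          by (subst X.der_sum)
            (auto intro!: Lc(4)[OF tL] sum.neutral simp: Lc(11) X.der_mult[OF tL] X.der_const_power)
      qed
      have "(\<Sum>\<beta>\<in>\<kappa> ` A. b \<beta> * (\<Prod>i\<in>T. z i ^ \<beta> i)) =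
        (\<Sum>\<beta>\<in>\<kappa> ` A. \<Sum>\<alpha> | \<alpha> \<in> A \<and> \<kappa> \<alpha> = \<beta>. c \<alpha> * (\<Prod>i\<le>d. f i ^ \<alpha> i))"
        unfolding b_def sum_distrib_right
      proof (intro sum.cong refl)
        fix \<beta> \<alpha> assume "\<alpha> \<in> {\<alpha> \<in> A. \<kappa> \<alpha> = \<beta>}"
        then have "(\<Prod>i\<in>T. z i ^ \<beta> i) = (\<Prod>i\<in>T. z i ^ \<alpha> i)"
          by (intro prod.cong) (auto simp: \<kappa>_def)
        then show "c \<alpha> * (\<Prod>i\<in>S. z i ^ \<alpha> i) * a ^ \<alpha> d * (\<Prod>i\<in>T. z i ^ \<beta> i) = c \<alpha> * (\<Prod>i\<le>d. f i ^ \<alpha> i)"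
          by (simp add: pr mult_ac)
      qed
      also have "\<dots> = (\<Sum>\<alpha>\<in>A. c \<alpha> * (\<Prod>i\<le>d. f i ^ \<alpha> i))"
        using A(1) by (intro sum.group) auto
      finally show "(\<Sum>\<beta>\<in>\<kappa> ` A. b \<beta> * (\<Prod>i\<in>T. z i ^ \<beta> i)) = 0" using A(5) by simp
    qed
    moreover obtain \<alpha>0 where a0: "\<alpha>0 \<in> A" "c \<alpha>0 \<noteq> 0" using A(2) by blast
    ultimately have b0: "b (\<kappa> \<alpha>0) = 0" by blast
    \<comment> \<open>One of the partial relations, as a polynomial equation for \<open>a\<close> over the coordinates in \<open>K\<close>.\<close>
    define A0 where "A0 = {\<alpha> \<in> A. \<kappa> \<alpha> = \<kappa> \<alpha>0}"
    define p where "p = (\<Sum>\<alpha>\<in>A0. monom (c \<alpha> * (\<Prod>i\<in>S. z i ^ \<alpha> i)) (\<alpha> d))"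
    have fA0: "finite A0" using A(1) by (simp add: A0_def)
    have cp: "coeff p j = (\<Sum>\<alpha> | \<alpha> \<in> A0 \<and> \<alpha> d = j. c \<alpha> * (\<Prod>i\<in>S. z i ^ \<alpha> i))" for j
      unfolding p_def coeff_sum coeff_monom using fA0
      by (simp add: sum.inter_filter)
    have ph: "poly p a = 0"
      using b0 unfolding p_def b_def A0_def by (simp add: poly_sum poly_monom)
    have p0: "p \<noteq> 0"
    proof
      assume "p = 0"
      then have 0: "(\<Sum>\<alpha> | \<alpha> \<in> A0 \<and> \<alpha> d = \<alpha>0 d. c \<alpha> * (\<Prod>i\<in>S. z i ^ \<alpha> i)) = 0"
        using cp[of "\<alpha>0 d"] by simp
      have "\<forall>\<alpha>\<in>{\<alpha>. \<alpha> \<in> A0 \<and> \<alpha> d = \<alpha>0 d}. c \<alpha> = 0"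
      proof (rule indep[OF ST(1) _ _ _ 0])
        show "finite {\<alpha>. \<alpha> \<in> A0 \<and> \<alpha> d = \<alpha>0 d}" using fA0 by simp
        show "c \<alpha> \<in> L \<and> XR S (c \<alpha>) = 0" if "\<alpha> \<in> {\<alpha>. \<alpha> \<in> A0 \<and> \<alpha> d = \<alpha>0 d}" for \<alpha>
          using that A(3) C V[OF XV[OF ST(1)]] by (auto simp: A0_def)
        fix \<alpha> \<beta> assume ab: "\<alpha> \<in> {\<alpha>. \<alpha> \<in> A0 \<and> \<alpha> d = \<alpha>0 d}" "\<beta> \<in> {\<alpha>. \<alpha> \<in> A0 \<and> \<alpha> d = \<alpha>0 d}"
          "\<forall>i\<in>S. \<alpha> i = \<beta> i"
        have "\<alpha> i = \<beta> i" if "i \<le> d" for i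
        proof -
          have "\<kappa> \<alpha> i = \<kappa> \<beta> i" using ab by (simp add: A0_def)
          then have T: "\<alpha> i = \<beta> i" if "i \<in> T" using that by (simp add: \<kappa>_def)
          have "i = d \<or> i \<in> S \<or> i \<in> T" using that ST(4) by (metis UnE le_neq_implies_less lessThan_iff)
          then show "\<alpha> i = \<beta> i" using ab T by (elim disjE) (auto simp: A0_def)
        qed
        then show "\<alpha> = \<beta>" using A(4) ab by (simp add: A0_def)
      qed
      then show False using a0 by (auto simp: A0_def)
    qed
    show "a \<in> K" unfolding K_def
    proof (intro CollectI conjI ballI aL)
      fix Y assume Y: "Y \<in> W"
      then have YV: "Y \<in> V" using W by blast
      interpret Y: field_derivation L Y using fd[OF YV] .
      have YC: "Y c = 0" if "c \<in> C" for c using V[OF YV] that by blast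
      have zY: "z i \<in> L \<and> Y (z i) = 0" if "i \<in> S" for i using that Y by (auto simp: S_def K_def)
      show "Y a = 0"
      proof (rule Y.algebraic_over_constants_is_constant[OF aL p0 ph])
        fix j
        have "Y (c \<alpha> * (\<Prod>i\<in>S. z i ^ \<alpha> i)) = 0" if "\<alpha> \<in> A" for \<alpha>
          using A(3)[OF that] C zY YC
          by (subst Y.der_mult) (auto intro!: Lc Y.der_const_prod simp: Y.der_const_power)
        then show "coeff p j \<in> L \<and> Y (coeff p j) = 0"
          unfolding cp using tL by (subst Y.der_sum) (auto intro!: Lc(9) sum.neutral simp: A0_def)
      qed
    qed
  qed
  moreover have "XR T a = 0" if "a \<in> K" for a
    using DK that by (simp add: XR_def)
  moreover have "K \<subseteq> L" by (auto simp: K_def)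
  ultimately have "{a \<in> L. XR T a = 0} = K" by blast
  then show ?thesis using XV[OF ST(2)] unfolding K_def by blast
qed

section \<open>Derivatives along curves\<close>

lemma pairing_add [simp]: "pairing a (v + w) = pairing a v + pairing a w"
  and pairing_add_left: "pairing (a + b) v = pairing a v + pairing b v"
  and pairing_diff_left: "pairing (a - b) v = pairing a v - pairing b v"
  and pairing_smult [simp]: "pairing a (c *s v) = c * pairing a v"
  and pairing_smult_left: "pairing (c *s a) v = c * pairing a v"
  and pairing_0 [simp]: "pairing a 0 = 0"
  and pairing_0_left [simp]: "pairing 0 v = 0"
  by (simp_all add: pairing_def sum.distrib sum_subtractf sum_distrib_left algebra_simps)

lemma pairing_axis [simp]: "pairing a (axis i c) = a $ i * c"
proof -
  have "pairing a (axis i c) = (\<Sum>j\<in>UNIV. if j = i then a $ i * c else 0)"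
    unfolding pairing_def by (intro sum.cong) (auto simp: axis_def)
  then show ?thesis by simp
qed

lemma pairing_matrix: "pairing a (A *v v) = pairing (a v* A) v"
proof -
  have "pairing a (A *v v) = (\<Sum>i\<in>UNIV. \<Sum>j\<in>UNIV. a $ i * (A $ i $ j * v $ j))"
    by (simp add: pairing_def matrix_vector_mult_def sum_distrib_left)
  also have "\<dots> = (\<Sum>j\<in>UNIV. \<Sum>i\<in>UNIV. a $ i * (A $ i $ j * v $ j))" by (rule sum.swap)
  also have "\<dots> = pairing (a v* A) v"
    by (simp add: pairing_def vector_matrix_mult_def sum_distrib_left sum_distrib_right mult_ac)
  finally show ?thesis .
qed

lemma bounded_linear_axis: "bounded_linear (axis i :: complex \<Rightarrow> complex^'n)"
  unfolding linear_conv_bounded_linear[symmetric]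
  by (rule linearI) (auto simp: axis_def vec_eq_iff)

lemma vec_sum_axis: "(x :: complex^'n) = (\<Sum>i\<in>UNIV. axis i (x $ i))"
  by (simp add: vec_eq_iff axis_def)

lemma has_derivative_vec:
  fixes f :: "'a::real_normed_vector \<Rightarrow> complex^'n"
  assumes "\<And>i. ((\<lambda>x. f x $ i) has_derivative (\<lambda>h. f' h $ i)) F"
  shows "(f has_derivative f') F"
proof -
  have "((\<lambda>x. \<Sum>i\<in>UNIV. axis i (f x $ i)) has_derivative (\<lambda>h. \<Sum>i\<in>UNIV. axis i (f' h $ i))) F"
    by (intro has_derivative_sum bounded_linear.has_derivative[OF bounded_linear_axis] assms)
  then show ?thesis by (simp add: vec_sum_axis[symmetric])
qed

lemma has_derivative_vec_nth:
  "(f has_derivative f') F \<Longrightarrow> ((\<lambda>x. f x $ i) has_derivative (\<lambda>h. f' h $ i)) F"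
  by (rule bounded_linear.has_derivative[OF bounded_linear_vec_nth])

lemma has_velocity_iff: "has_velocity \<gamma> v t \<longleftrightarrow> (\<gamma> has_derivative (\<lambda>h. h *s v)) (at t)"
proof
  assume "has_velocity \<gamma> v t"
  then show "(\<gamma> has_derivative (\<lambda>h. h *s v)) (at t)"
    by (intro has_derivative_vec) (auto simp: has_velocity_def has_field_derivative_def mult.commute[of _ "v $ _"])
next
  assume d: "(\<gamma> has_derivative (\<lambda>h. h *s v)) (at t)"
  have "((\<lambda>s. \<gamma> s $ i) has_derivative (\<lambda>h. h * v $ i)) (at t)" for i
    using has_derivative_vec_nth[OF d, of i] by simp
  then show "has_velocity \<gamma> v t"
    by (simp add: has_velocity_def has_field_derivative_def mult.commute[of _ "v $ _"])
qed

lemma has_field_derivative_along_curve: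
  assumes "(f has_derivative pairing a) (at (\<gamma> t))" "has_velocity \<gamma> v t"
  shows "((\<lambda>s. f (\<gamma> s)) has_field_derivative pairing a v) (at t)"
proof -
  have "((\<lambda>s. f (\<gamma> s)) has_derivative (\<lambda>h. pairing a (h *s v))) (at t)"
    using has_derivative_compose[OF assms(2)[unfolded has_velocity_iff] assms(1)] by simp
  then show ?thesis by (simp add: has_field_derivative_def mult.commute[of _ "pairing a v"])
qed

lemma has_derivative_pairing_compose:
  assumes "(f has_derivative pairing a) (at (\<phi> z))" "(\<phi> has_derivative (\<lambda>v. A *v v)) (at z)"
  shows "((\<lambda>z. f (\<phi> z)) has_derivative pairing (a v* A)) (at z)"
proof -
  have "((\<lambda>z. f (\<phi> z)) has_derivative (\<lambda>v. pairing a (A *v v))) (at z)"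
    using has_derivative_compose[OF assms(2,1)] .
  then show ?thesis by (simp add: pairing_matrix)
qed

lemma has_velocity_line: "has_velocity (\<lambda>t. p + t *s v) v t"
  unfolding has_velocity_def by (auto intro!: derivative_eq_intros)

lemma has_velocity_compose:
  assumes "(\<phi> has_derivative (\<lambda>v. A *v v)) (at (\<gamma> t))" "has_velocity \<gamma> v t"
  shows "has_velocity (\<lambda>s. \<phi> (\<gamma> s)) (A *v v) t"
proof -
  have "((\<lambda>s. \<phi> (\<gamma> s)) has_derivative (\<lambda>h. A *v (h *s v))) (at t)"
    using has_derivative_compose[OF assms(2)[unfolded has_velocity_iff] assms(1)] by simp
  then show ?thesis by (simp add: has_velocity_iff vector_scalar_commute)
qed

lemma holo_fun_mult:
  assumes "(f has_derivative pairing a) (at x)" "(g has_derivative pairing b) (at x)"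
  shows "((\<lambda>x. f x * g x) has_derivative pairing (f x *s b + g x *s a)) (at x)"
  by (rule has_derivative_eq_rhs[OF has_derivative_mult[OF assms]])
    (simp add: fun_eq_iff pairing_add_left pairing_smult_left)

section \<open>Homogeneous polynomials\<close>

abbreviation monomial :: "('n \<Rightarrow> nat) \<Rightarrow> complex^'n \<Rightarrow> complex" where
  "monomial \<alpha> x \<equiv> \<Prod>i\<in>UNIV. x $ i ^ \<alpha> i"

lemma hom_poly_iff:
  "F \<in> hom_poly k \<longleftrightarrow> (\<exists>c. F = (\<lambda>x. \<Sum>\<alpha> | sum \<alpha> UNIV = k. c \<alpha> * monomial \<alpha> x))"
  by (simp add: hom_poly_def)

lemma hom_poly_add: "P \<in> hom_poly k \<Longrightarrow> Q \<in> hom_poly k \<Longrightarrow> (\<lambda>x. P x + Q x) \<in> hom_poly k"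
proof -
  assume "P \<in> hom_poly k" "Q \<in> hom_poly k"
  then obtain c d where "P = (\<lambda>x. \<Sum>\<alpha> | sum \<alpha> UNIV = k. c \<alpha> * monomial \<alpha> x)"
    "Q = (\<lambda>x. \<Sum>\<alpha> | sum \<alpha> UNIV = k. d \<alpha> * monomial \<alpha> x)" unfolding hom_poly_iff by blast
  then show ?thesis unfolding hom_poly_iff
    by (intro exI[of _ "\<lambda>\<alpha>. c \<alpha> + d \<alpha>"]) (simp add: sum.distrib algebra_simps)
qed

lemma hom_poly_scale: "P \<in> hom_poly k \<Longrightarrow> (\<lambda>x. a * P x) \<in> hom_poly k"
proof -
  assume "P \<in> hom_poly k"
  then obtain c where "P = (\<lambda>x. \<Sum>\<alpha> | sum \<alpha> UNIV = k. c \<alpha> * monomial \<alpha> x)"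
    unfolding hom_poly_iff by blast
  then show ?thesis unfolding hom_poly_iff
    by (intro exI[of _ "\<lambda>\<alpha>. a * c \<alpha>"]) (simp add: sum_distrib_left mult_ac)
qed

lemma hom_poly_0: "(\<lambda>_. 0) \<in> hom_poly k"
  unfolding hom_poly_iff by (intro exI[of _ "\<lambda>_. 0"]) simp

lemma hom_poly_sum: "(\<And>i. i \<in> I \<Longrightarrow> P i \<in> hom_poly k) \<Longrightarrow> (\<lambda>x. \<Sum>i\<in>I. P i x) \<in> hom_poly k"
  by (induction I rule: infinite_finite_induct) (auto simp: hom_poly_0 hom_poly_add)

lemma hom_poly_diff: "P \<in> hom_poly k \<Longrightarrow> Q \<in> hom_poly k \<Longrightarrow> (\<lambda>x. P x - Q x) \<in> hom_poly k"
  using hom_poly_add[OF _ hom_poly_scale[of Q k "-1"], of P] by simp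

lemma hom_poly_monomial: "sum \<alpha> UNIV = k \<Longrightarrow> monomial \<alpha> \<in> hom_poly k"
  unfolding hom_poly_iff
  by (intro exI[of _ "\<lambda>\<beta>. if \<beta> = \<alpha> then 1 else 0"])
    (simp add: if_distrib[of "\<lambda>c. c * _"] finite_exponents cong: if_cong)

lemma hom_poly_induct [consumes 1, case_names monomial add]:
  assumes "F \<in> hom_poly k"
    and mono: "\<And>c \<alpha>. sum \<alpha> UNIV = k \<Longrightarrow> T (\<lambda>x. c * monomial \<alpha> x)"
    and add: "\<And>P Q. P \<in> hom_poly k \<Longrightarrow> Q \<in> hom_poly k \<Longrightarrow> T P \<Longrightarrow> T Q \<Longrightarrow> T (\<lambda>x. P x + Q x)"
  shows "T F"
proof -
  obtain c where F: "F = (\<lambda>x. \<Sum>\<alpha> | sum \<alpha> UNIV = k. c \<alpha> * monomial \<alpha> x)"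
    using assms(1) unfolding hom_poly_iff by blast
  have ne: "{\<alpha> :: 'a \<Rightarrow> nat. sum \<alpha> UNIV = k} \<noteq> {}"
  proof -
    obtain j :: 'a where True by simp
    have "sum (\<lambda>i. if i = j then k else 0) UNIV = k" by simp
    then show ?thesis by blast
  qed
  have "T (\<lambda>x. \<Sum>\<alpha>\<in>A. c \<alpha> * monomial \<alpha> x)"
    if "finite A" "A \<noteq> {}" "A \<subseteq> {\<alpha>. sum \<alpha> UNIV = k}" for A
    using that
  proof (induction A rule: finite_ne_induct)
    case (singleton \<alpha>)
    then show ?case using mono by simp
  next
    case (insert \<alpha> A)
    have "T (\<lambda>x. c \<alpha> * monomial \<alpha> x + (\<Sum>\<alpha>\<in>A. c \<alpha> * monomial \<alpha> x))"
      using insert by (intro add mono hom_poly_sum hom_poly_scale hom_poly_monomial) auto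
    then show ?case using insert.hyps by simp
  qed
  then show ?thesis unfolding F using finite_exponents ne by blast
qed

lemma hom_poly_mult:
  assumes "P \<in> hom_poly j" "Q \<in> hom_poly k"
  shows "(\<lambda>x. P x * Q x) \<in> hom_poly (j + k)"
  using assms(1)
proof (induction rule: hom_poly_induct)
  case (monomial c \<alpha>)
  show ?case using assms(2)
  proof (induction rule: hom_poly_induct)
    case (monomial d \<beta>)
    have "(\<lambda>x. (c * d) * monomial (\<lambda>i. \<alpha> i + \<beta> i) x) \<in> hom_poly (j + k)"
      using monomial \<open>sum \<alpha> UNIV = j\<close>
      by (intro hom_poly_scale hom_poly_monomial) (simp add: sum.distrib)
    then show ?case by (simp add: power_add prod.distrib mult_ac)
  next
    case (add P Q)
    then show ?case by (auto simp: distrib_left dest: hom_poly_add)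
  qed
next
  case (add P Q')
  then show ?case by (auto simp: distrib_right dest: hom_poly_add)
qed

lemma hom_poly_const: "(\<lambda>_. c) \<in> hom_poly 0"
  using hom_poly_scale[OF hom_poly_monomial[of "\<lambda>_. 0" 0], of c] by simp

lemma hom_poly_coord: "(\<lambda>x :: complex^'n. x $ i) \<in> hom_poly 1"
proof -
  have "monomial (\<lambda>j. if j = i then 1 else 0) \<in> hom_poly 1"
    by (rule hom_poly_monomial) simp
  moreover have "monomial (\<lambda>j. if j = i then 1 else 0) x = x $ i" for x :: "complex^'n"
    by (simp add: if_distrib[of "power _"] prod.delta cong: if_cong)
  ultimately show ?thesis by simp
qed

lemma hom_poly_power: "P \<in> hom_poly j \<Longrightarrow> (\<lambda>x. P x ^ n) \<in> hom_poly (n * j)"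
proof (induction n)
  case (Suc n)
  then show ?case using hom_poly_mult[of P j "\<lambda>x. P x ^ n" "n * j"] by simp
qed (simp add: hom_poly_const)

lemma hom_poly_prod:
  "(\<And>i. i \<in> I \<Longrightarrow> P i \<in> hom_poly (d i)) \<Longrightarrow> (\<lambda>x. \<Prod>i\<in>I. P i x) \<in> hom_poly (sum d I)"
  by (induction I rule: infinite_finite_induct) (auto simp: hom_poly_const hom_poly_mult)

lemma hom_poly_homogeneous: "P \<in> hom_poly k \<Longrightarrow> P (c *s x) = c ^ k * P x"
proof (induction rule: hom_poly_induct)
  case (monomial d \<alpha>)
  then show ?case by (simp add: power_mult_distrib prod.distrib power_sum[symmetric])
qed (simp add: distrib_left)

text \<open>
  The degree is lowered by differentiation; the truncated difference \<open>0 - 1 = 0\<close> does no harm because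
  the derivative of a constant vanishes.
\<close>

definition is_gradient :: "nat \<Rightarrow> (complex^'n \<Rightarrow> complex) \<Rightarrow> (complex^'n \<Rightarrow> complex^'n) \<Rightarrow> bool" where
  "is_gradient k P G \<longleftrightarrow> (\<forall>x. (P has_derivative pairing (G x)) (at x)) \<and>
     (\<forall>i. (\<lambda>x. G x $ i) \<in> hom_poly (k - 1)) \<and> (k = 0 \<longrightarrow> G = (\<lambda>_. 0))"

lemma is_gradientD:
  assumes "is_gradient k P G"
  shows "(P has_derivative pairing (G x)) (at x)" "(\<lambda>x. G x $ i) \<in> hom_poly (k - 1)"
    "k = 0 \<Longrightarrow> G = (\<lambda>_. 0)"
  using assms by (auto simp: is_gradient_def)

lemma monomial_gradient: "sum \<alpha> UNIV = k \<Longrightarrow> \<exists>G. is_gradient k (monomial \<alpha> :: complex^'n \<Rightarrow> complex) G"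
proof (induction k arbitrary: \<alpha>)
  case 0
  then have "\<alpha> = (\<lambda>_. 0)" by auto
  moreover have "pairing (0 :: complex^'n) = (\<lambda>_. 0)" by (simp add: fun_eq_iff)
  ultimately have "is_gradient 0 (monomial \<alpha> :: complex^'n \<Rightarrow> complex) (\<lambda>_. 0)"
    by (simp add: is_gradient_def hom_poly_0)
  then show ?case by blast
next
  case (Suc k)
  then obtain i where i: "\<alpha> i > 0" by (metis gr0I sum.neutral nat.distinct(1))
  define \<beta> where "\<beta> = \<alpha>(i := \<alpha> i - 1)"
  have ab: "\<alpha> = (\<lambda>j. \<beta> j + (if j = i then 1 else 0))" using i by (auto simp: \<beta>_def)
  have sb: "sum \<beta> UNIV = k" using Suc.prems unfolding ab by (simp add: sum.distrib)
  from Suc.IH[OF this] obtain G :: "complex^'n \<Rightarrow> complex^'n" where "is_gradient k (monomial \<beta>) G" ..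
  note G = is_gradientD[OF this]
  have mon: "monomial \<alpha> = (\<lambda>x :: complex^'n. x $ i * monomial \<beta> x)"
    unfolding ab by (rule ext)
      (simp add: power_add prod.distrib if_distrib[of "power _"] prod.delta cong: if_cong)
  have lin: "((\<lambda>x. x $ i) has_derivative pairing (axis i 1)) (at x)" for x :: "complex^'n"
  proof -
    have "((\<lambda>x. x $ i) has_derivative (\<lambda>h. h $ i)) (at x)"
      by (rule bounded_linear_imp_has_derivative) (rule bounded_linear_vec_nth)
    moreover have "(\<lambda>h. h $ i) = pairing (axis i 1 :: complex^'n)"
      by (rule ext) (simp add: pairing_def axis_def if_distrib[of "\<lambda>c. c * _"] cong: if_cong)
    ultimately show ?thesis by simp
  qed
  define H where "H = (\<lambda>x. x $ i *s G x + monomial \<beta> x *s axis i 1)"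
  have "(monomial \<alpha> has_derivative pairing (H x)) (at x)" for x
    unfolding mon H_def by (rule holo_fun_mult[OF lin G(1)])
  moreover have "(\<lambda>x. H x $ j) \<in> hom_poly (Suc k - 1)" for j
  proof -
    have "(\<lambda>x. x $ i * G x $ j) \<in> hom_poly k"
    proof (cases k)
      case 0
      then show ?thesis using G(3) by (simp add: hom_poly_0)
    next
      case (Suc l)
      then show ?thesis using hom_poly_mult[OF hom_poly_coord[of i] G(2)[of j]] by simp
    qed
    moreover have "(\<lambda>x :: complex^'n. (axis i 1 $ j) * monomial \<beta> x) \<in> hom_poly k"
      using sb by (intro hom_poly_scale hom_poly_monomial)
    ultimately have "(\<lambda>x. x $ i * G x $ j + (axis i 1 $ j) * monomial \<beta> x) \<in> hom_poly k"
      by (rule hom_poly_add)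
    then show ?thesis by (simp add: H_def mult.commute[of "axis i 1 $ j"])
  qed
  ultimately have "is_gradient (Suc k) (monomial \<alpha>) H" by (simp add: is_gradient_def)
  then show ?case by blast
qed

lemma hom_poly_gradient:
  assumes "P \<in> hom_poly k"
  obtains G where "is_gradient k P G"
proof -
  have "\<exists>G. is_gradient k P G" using assms
  proof (induction rule: hom_poly_induct)
    case (monomial c \<alpha>)
    from monomial_gradient[OF this] obtain G where "is_gradient k (monomial \<alpha>) G" ..
    note G = is_gradientD[OF this]
    have "((\<lambda>x. c * monomial \<alpha> x) has_derivative pairing (c *s G x)) (at x)" for x
      using has_derivative_mult_right[OF G(1), of c] by (simp add: pairing_smult_left[abs_def])
    then have "is_gradient k (\<lambda>x. c * monomial \<alpha> x) (\<lambda>x. c *s G x)"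
      using G(2,3) by (simp add: is_gradient_def hom_poly_scale)
    then show ?case by blast
  next
    case (add P Q)
    then obtain G H where "is_gradient k P G" "is_gradient k Q H" by blast
    note G = is_gradientD[OF this(1)] and H = is_gradientD[OF this(2)]
    have "((\<lambda>x. P x + Q x) has_derivative pairing (G x + H x)) (at x)" for x
      using has_derivative_add[OF G(1) H(1)] by (simp add: pairing_add_left[abs_def])
    then have "is_gradient k (\<lambda>x. P x + Q x) (\<lambda>x. G x + H x)"
      using G(2,3) H(2,3) by (simp add: is_gradient_def hom_poly_add)
    then show ?case by blast
  qed
  then show thesis using that by blast
qed

lemma hom_poly_holo: "P \<in> hom_poly k \<Longrightarrow> holo_fun U P"
  unfolding holo_fun_def by (metis hom_poly_gradient is_gradientD(1))

lemma holo_fun_continuous: "holo_fun U f \<Longrightarrow> x \<in> U \<Longrightarrow> isCont f x"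
  unfolding holo_fun_def using has_derivative_continuous by blast

definition lie_derivative :: "(complex^'n \<Rightarrow> complex^'n) \<Rightarrow> (complex^'n \<Rightarrow> complex) \<Rightarrow> complex^'n \<Rightarrow> complex" where
  "lie_derivative A P x = frechet_derivative P (at x) (A x)"

lemma lie_eq: "(P has_derivative pairing a) (at x) \<Longrightarrow> lie_derivative A P x = pairing a (A x)"
  unfolding lie_derivative_def using frechet_derivative_at by metis

lemma hom_poly_has_derivative:
  assumes "P \<in> hom_poly k"
  obtains a where "(P has_derivative pairing a) (at x)" "\<And>A. lie_derivative A P x = pairing a (A x)"
proof -
  obtain G where "is_gradient k P G" using hom_poly_gradient[OF assms] .
  then have "(P has_derivative pairing (G x)) (at x)" by (rule is_gradientD)
  with lie_eq[OF this] that show thesis by blast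
qed

lemma lie_hom_poly:
  assumes P: "P \<in> hom_poly k" and A: "\<And>i. (\<lambda>x. A x $ i) \<in> hom_poly (Suc l)"
  shows "lie_derivative A P \<in> hom_poly (l + k)"
proof -
  obtain G where "is_gradient k P G" using hom_poly_gradient[OF P] .
  note G = is_gradientD[OF this]
  have e: "lie_derivative A P = (\<lambda>x. \<Sum>i\<in>UNIV. G x $ i * A x $ i)"
    using lie_eq[OF G(1)] by (auto simp: pairing_def)
  show ?thesis
  proof (cases k)
    case 0
    then show ?thesis unfolding e using G(3) by (simp add: hom_poly_0)
  next
    case (Suc m)
    have "(\<lambda>x. G x $ i * A x $ i) \<in> hom_poly (l + k)" for i
      using hom_poly_mult[OF G(2)[of i] A[of i]] Suc by (simp add: add.commute)
    then show ?thesis unfolding e by (intro hom_poly_sum)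
  qed
qed

lemma lie_mult:
  assumes "P \<in> hom_poly j" "Q \<in> hom_poly k"
  shows "lie_derivative A (\<lambda>x. P x * Q x) x = P x * lie_derivative A Q x + Q x * lie_derivative A P x"
proof -
  obtain a b where ab: "(P has_derivative pairing a) (at x)" "(Q has_derivative pairing b) (at x)"
    using assms hom_poly_has_derivative by metis
  show ?thesis
    by (simp add: lie_eq[OF ab(1)] lie_eq[OF ab(2)] lie_eq[OF holo_fun_mult[OF ab]]
        pairing_add_left pairing_smult_left)
qed

lemma lie_add:
  assumes "P \<in> hom_poly k" "Q \<in> hom_poly k"
  shows "lie_derivative A (\<lambda>x. P x + Q x) x = lie_derivative A P x + lie_derivative A Q x"
proof -
  obtain a b where ab: "(P has_derivative pairing a) (at x)" "(Q has_derivative pairing b) (at x)"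
    using assms hom_poly_has_derivative by metis
  have "((\<lambda>x. P x + Q x) has_derivative pairing (a + b)) (at x)"
    using has_derivative_add[OF ab] by (simp add: pairing_add_left[abs_def])
  then show ?thesis by (simp add: lie_eq[OF ab(1)] lie_eq[OF ab(2)] lie_eq pairing_add_left)
qed

lemma lie_scale:
  assumes "P \<in> hom_poly k"
  shows "lie_derivative A (\<lambda>x. c * P x) x = c * lie_derivative A P x"
proof -
  obtain a where a: "(P has_derivative pairing a) (at x)"
    using assms hom_poly_has_derivative by metis
  have "((\<lambda>x. c * P x) has_derivative pairing (c *s a)) (at x)"
    using has_derivative_mult_right[OF a, of c] by (simp add: pairing_smult_left[abs_def])
  then show ?thesis by (simp add: lie_eq[OF a] lie_eq pairing_smult_left)
qed

lemma lie_field_add: "P \<in> hom_poly k \<Longrightarrow> lie_derivative (\<lambda>x. A x + B x) P x = lie_derivative A P x + lie_derivative B P x"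
  and lie_field_smult: "P \<in> hom_poly k \<Longrightarrow> lie_derivative (\<lambda>x. f x *s A x) P x = f x * lie_derivative A P x"
  by (rule hom_poly_has_derivative[of P k x], assumption, simp)+

lemma euler_relation:
  assumes P: "P \<in> hom_poly k"
  shows "lie_derivative (\<lambda>x. x) P x = of_nat k * P x"
proof -
  obtain a where a: "(P has_derivative pairing a) (at (1 *s x))" "lie_derivative (\<lambda>x. x) P x = pairing a x"
    using hom_poly_has_derivative[OF P, of "1 *s x" thesis] by simp
  have "has_velocity (\<lambda>t. 0 + t *s x) x 1" by (rule has_velocity_line)
  then have "((\<lambda>s. P (s *s x)) has_field_derivative pairing a x) (at 1)"
    by (intro has_field_derivative_along_curve[where \<gamma> = "\<lambda>s. s *s x"] a) simp
  moreover have "((\<lambda>s. P (s *s x)) has_field_derivative of_nat k * P x) (at 1)"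
    unfolding hom_poly_homogeneous[OF P] by (auto intro!: derivative_eq_intros)
  ultimately show ?thesis using a(2) DERIV_unique by metis
qed

section \<open>A Schwarz lemma on grids\<close>

lemma roots_of_unity_sum:
  fixes i j m :: nat
  assumes "i < m" "j < m"
  shows "(\<Sum>k<m. cis (2 * pi * k / m) ^ j * cis (- (2 * pi * k / m)) ^ i) = (if i = j then of_nat m else 0)"
proof -
  define w where "w = cis (2 * pi * (real j - real i) / m)"
  have m: "m > 0" using assms by simp
  have "cis (2 * pi * k / m) ^ j * cis (- (2 * pi * k / m)) ^ i = w ^ k" for k :: nat
  proof -
    have "real j * (2 * pi * real k / real m) + real i * - (2 * pi * real k / real m)
       = real k * (2 * pi * (real j - real i) / real m)" using m by (simp add: field_simps)
    then show ?thesis unfolding w_def Complex.DeMoivre cis_mult by simp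
  qed
  then have e: "(\<Sum>k<m. cis (2 * pi * k / m) ^ j * cis (- (2 * pi * k / m)) ^ i) = (\<Sum>k<m. w ^ k)"
    by simp
  show ?thesis
  proof (cases "i = j")
    case True
    then show ?thesis unfolding e by (simp add: w_def)
  next
    case False
    have "w \<noteq> 1"
    proof
      assume "w = 1"
      then have "cos (2 * pi * (real j - real i) / m) = 1" by (metis cis.sel(1) one_complex.sel(1) w_def)
      then obtain n :: int where "2 * pi * (real j - real i) / m = of_int n * 2 * pi"
        unfolding cos_one_2pi_int by blast
      then have "(2 * pi) * (real j - real i) = (2 * pi) * (of_int n * real m)"
        using m by (simp add: field_simps)
      then have "real j - real i = of_int n * real m" by simp
      then have "real_of_int (int j - int i) = of_int (n * int m)" by simp
      then have n: "int j - int i = n * int m" by (simp only: of_int_eq_iff)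
      then have "\<bar>n\<bar> * int m < int m" using assms by (simp add: abs_mult[of n "int m", simplified, symmetric])
      then have "n = 0" using m by (simp add: mult_less_cancel_right2)
      then show False using n False by simp
    qed
    moreover have "w ^ m = 1"
    proof -
      have "real m * (2 * pi * (real j - real i) / m) = 2 * pi * of_int (int j - int i)" using m by simp
      then have "w ^ m = cis (2 * pi * of_int (int j - int i))" unfolding w_def Complex.DeMoivre
        by (rule arg_cong)
      also have "\<dots> = 1" by (rule cis_multiple_2pi) (rule Ints_of_int)
      finally show ?thesis .
    qed
    ultimately show ?thesis unfolding e using False by (simp add: geometric_sum)
  qed
qed

text \<open>
  The coefficients of a polynomial of degree less than \<open>m\<close> are averages of its values at \<open>m\<close> equally
  spaced points of a circle.
\<close>

lemma coefficient_bound_by_roots_of_unity: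
  fixes a :: "nat \<Rightarrow> complex"
  assumes i: "i < m" and q: "q > 0"
    and b: "\<And>k :: nat. k < m \<Longrightarrow> norm (\<Sum>j<m. a j * (of_real q * cis (2 * pi * k / m)) ^ j) \<le> \<delta>"
  shows "norm (a i) * q ^ i \<le> \<delta>"
proof -
  define P where "P k = (\<Sum>j<m. a j * (of_real q * cis (2 * pi * k / m)) ^ j)" for k :: nat
  have "(\<Sum>k<m. P k * cis (- (2 * pi * k / m)) ^ i)
    = (\<Sum>k<m. \<Sum>j<m. a j * of_real q ^ j * (cis (2 * pi * k / m) ^ j * cis (- (2 * pi * k / m)) ^ i))"
    unfolding P_def sum_distrib_right by (intro sum.cong refl) (simp add: power_mult_distrib mult_ac)
  also have "\<dots> = (\<Sum>j<m. a j * of_real q ^ j * (\<Sum>k<m. cis (2 * pi * k / m) ^ j * cis (- (2 * pi * k / m)) ^ i))"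
    unfolding sum_distrib_left by (rule sum.swap)
  also have "\<dots> = (\<Sum>j<m. if i = j then a j * of_real q ^ j * of_nat m else 0)"
    by (intro sum.cong refl) (subst roots_of_unity_sum[OF i], simp_all)
  also have "\<dots> = a i * of_real q ^ i * of_nat m" using i by simp
  finally have "norm (a i * of_real q ^ i * of_nat m) = norm (\<Sum>k<m. P k * cis (- (2 * pi * k / m)) ^ i)"
    by simp
  also have "\<dots> \<le> (\<Sum>k<m. norm (P k * cis (- (2 * pi * k / m)) ^ i))" by (rule norm_sum)
  also have "\<dots> = (\<Sum>k<m. norm (P k))" by (simp add: norm_mult norm_power)
  also have "\<dots> \<le> (\<Sum>k<m. \<delta>)" using b by (intro sum_mono) (simp add: P_def)
  finally have "(norm (a i) * q ^ i) * m \<le> \<delta> * m" using q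
    by (simp add: norm_mult norm_power mult.commute[of \<delta>])
  then show ?thesis using i by simp
qed

definition circle_nodes :: "nat \<Rightarrow> complex set" where
  "circle_nodes m = (\<lambda>k. (1 / 8) * cis (2 * pi * real k / real m)) ` {..<m}"

lemma circle_nodes: "finite (circle_nodes m)" "card (circle_nodes m) \<le> m"
  "z \<in> circle_nodes m \<Longrightarrow> norm z = 1 / 8"
  "z \<in> circle_nodes m \<Longrightarrow> norm z \<le> 1 / 8"
  unfolding circle_nodes_def using card_image_le[of "{..<m}"] by (auto simp: norm_mult)

text \<open>
  The Taylor polynomial of degree less than \<open>m\<close> is controlled through its coefficients by its values at
  the nodes, and by Cauchy's estimates the rest of the Taylor series is of size \<open>(1 / 8) ^ m\<close> on the disc
  that contains the nodes.
\<close>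

lemma bound_from_values_at_nodes:
  assumes cont: "continuous_on (cball 0 1) f" and holo: "f holomorphic_on ball 0 1"
    and bd: "\<And>z. norm z \<le> 1 \<Longrightarrow> norm (f z) \<le> B"
    and nodes: "\<And>z. z \<in> circle_nodes m \<Longrightarrow> norm (f z) \<le> \<delta>"
    and z: "norm z \<le> 1 / 8"
  shows "norm (f z) \<le> real m * \<delta> + 2 * (real m + 1) * B * (1 / 8) ^ m"
proof -
  define a where "a n = (deriv ^^ n) f 0 / fact n" for n
  have B: "B \<ge> 0" using order_trans[OF norm_ge_zero bd[of 0]] by simp
  have a: "norm (a n) \<le> B" for n
    using Cauchy_inequality[OF holo cont, of B n] bd by (simp add: a_def norm_divide field_simps)
  define \<rho> where "\<rho> = 2 * B * (1 / 8) ^ m"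
  define p where "p z = (\<Sum>j<m. a j * z ^ j)" for z
  have tail: "norm (f w - p w) \<le> \<rho>" if w: "norm w \<le> 1 / 8" for w
  proof -
    have s: "(\<lambda>n. a n * w ^ n) sums f w"
      using holomorphic_power_series[OF holo, of w] w by (simp add: a_def)
    then have "f w = (\<Sum>n. a (n + m) * w ^ (n + m)) + p w"
      using suminf_split_initial_segment[OF sums_summable[OF s], of m] sums_unique[OF s]
      by (simp add: p_def)
    moreover have "norm (\<Sum>n. a (n + m) * w ^ (n + m)) \<le> (\<Sum>n. B * (1 / 8) ^ m * (1 / 8) ^ n)"
    proof (rule norm_suminf_le)
      show "norm (a (n + m) * w ^ (n + m)) \<le> B * (1 / 8) ^ m * (1 / 8) ^ n" for n
      proof -
        have "norm (a (n + m)) * norm w ^ (n + m) \<le> B * (1 / 8) ^ (n + m)"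
          using a w B by (intro mult_mono power_mono) auto
        then show ?thesis by (simp add: norm_mult norm_power power_add mult_ac)
      qed
      show "summable (\<lambda>n. B * (1 / 8) ^ m * (1 / 8 :: real) ^ n)"
        by (intro summable_mult summable_geometric) simp
    qed
    moreover have "(\<Sum>n. B * (1 / 8) ^ m * (1 / 8 :: real) ^ n) = B * (1 / 8) ^ m * (8 / 7)"
      by (subst suminf_mult) (auto simp: suminf_geometric summable_geometric)
    moreover have "B * (1 / 8) ^ m * (8 / 7) \<le> \<rho>" using B by (simp add: \<rho>_def)
    ultimately show ?thesis by simp
  qed
  have c: "norm (a i) * (1 / 8) ^ i \<le> \<delta> + \<rho>" if i: "i < m" for i
  proof (rule coefficient_bound_by_roots_of_unity[OF i, where a = a])
    fix k assume k: "k < m"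
    define w where "w = (1 / 8) * cis (2 * pi * real k / real m)"
    have w: "w \<in> circle_nodes m" using k by (auto simp: circle_nodes_def w_def)
    then have "norm (p w) \<le> norm (f w) + norm (f w - p w)" by (metis norm_triangle_sub norm_minus_commute add.commute)
    also have "\<dots> \<le> \<delta> + \<rho>" using nodes[OF w] tail circle_nodes(3)[OF w] by (intro add_mono) auto
    finally show "norm (\<Sum>j<m. a j * (of_real (1 / 8) * cis (2 * pi * k / m)) ^ j) \<le> \<delta> + \<rho>"
      by (simp add: p_def w_def)
  qed simp
  have "norm (p z) \<le> (\<Sum>j<m. norm (a j * z ^ j))" unfolding p_def by (rule norm_sum)
  also have "\<dots> \<le> (\<Sum>j<m. \<delta> + \<rho>)"
  proof (rule sum_mono)
    fix j assume "j \<in> {..<m}"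
    have "norm (a j * z ^ j) \<le> norm (a j) * (1 / 8) ^ j"
      using z by (auto simp: norm_mult norm_power intro!: mult_left_mono power_mono)
    also have "\<dots> \<le> \<delta> + \<rho>" using c \<open>j \<in> {..<m}\<close> by simp
    finally show "norm (a j * z ^ j) \<le> \<delta> + \<rho>" .
  qed
  finally have "norm (p z) \<le> m * (\<delta> + \<rho>)" by simp
  moreover have "norm (f z) \<le> norm (p z) + norm (f z - p z)" by (metis norm_triangle_sub add.commute)
  ultimately show ?thesis using tail[OF z] by (simp add: \<rho>_def algebra_simps)
qed

definition polydisc :: "real \<Rightarrow> (complex^'m) set" where
  "polydisc r = {w. \<forall>i. norm (w $ i) \<le> r}"

definition open_polydisc :: "(complex^'m) set" where
  "open_polydisc = {w. \<forall>i. norm (w $ i) < 1 / 8}"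

lemma open_polydisc:
  "open (open_polydisc :: (complex^'m) set)" "convex (open_polydisc :: (complex^'m) set)"
  "open_polydisc \<subseteq> (polydisc (1 / 8) :: (complex^'m) set)"
  "open_polydisc \<subseteq> (polydisc 1 :: (complex^'m) set)" "0 \<in> (open_polydisc :: (complex^'m) set)"
proof -
  have e: "(open_polydisc :: (complex^'m) set) = (\<Inter>i. (\<lambda>w. w $ i) -` ball 0 (1 / 8))"
    by (auto simp: open_polydisc_def)
  show "open (open_polydisc :: (complex^'m) set)"
    unfolding e by (intro open_INT ballI open_vimage_vec_nth) auto
  show "convex (open_polydisc :: (complex^'m) set)"
    unfolding e
    by (intro convex_INT convex_linear_vimage convex_ball bounded_linear.linear[OF bounded_linear_vec_nth])
  show 8: "open_polydisc \<subseteq> (polydisc (1 / 8) :: (complex^'m) set)"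
    by (auto simp: open_polydisc_def polydisc_def intro: less_imp_le)
  have "norm z \<le> 1" if "norm z \<le> 1 / 8" for z :: complex using that by simp
  then show "open_polydisc \<subseteq> (polydisc 1 :: (complex^'m) set)" using 8 unfolding polydisc_def by blast
  show "0 \<in> (open_polydisc :: (complex^'m) set)" by (simp add: open_polydisc_def)
qed

definition grid :: "nat \<Rightarrow> (complex^'m) set" where
  "grid m = {w. \<forall>i. w $ i \<in> circle_nodes m}"

lemma grid: "finite (grid m :: (complex^'m) set)" "card (grid m :: (complex^'m) set) \<le> m ^ CARD('m)"
  "grid m \<subseteq> (polydisc (1 / 8) :: (complex^'m) set)"
proof -
  have e: "grid m = (vec_lambda :: _ \<Rightarrow> complex^'m) ` PiE UNIV (\<lambda>_. circle_nodes m)"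
  proof (intro subset_antisym subsetI)
    fix w :: "complex^'m"
    assume "w \<in> grid m"
    then have "vec_nth w \<in> PiE UNIV (\<lambda>_. circle_nodes m)" by (auto simp: grid_def)
    then show "w \<in> vec_lambda ` PiE UNIV (\<lambda>_. circle_nodes m)" by (metis image_eqI vec_nth_inverse)
  qed (auto simp: grid_def)
  have f: "finite (PiE (UNIV :: 'm set) (\<lambda>_. circle_nodes m))"
    using circle_nodes by (intro finite_PiE) auto
  show "finite (grid m :: (complex^'m) set)" unfolding e using f by simp
  have "card (grid m :: (complex^'m) set) \<le> card (PiE (UNIV :: 'm set) (\<lambda>_. circle_nodes m))"
    unfolding e using f by (rule card_image_le)
  also have "\<dots> = card (circle_nodes m) ^ CARD('m)" by (simp add: card_PiE)
  also have "\<dots> \<le> m ^ CARD('m)" by (intro power_mono circle_nodes) simp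
  finally show "card (grid m :: (complex^'m) set) \<le> m ^ CARD('m)" .
  show "grid m \<subseteq> (polydisc (1 / 8) :: (complex^'m) set)"
    unfolding grid_def polydisc_def using circle_nodes(4) by blast
qed

text \<open>
  Passing from the nodes to the disc in one coordinate after the other enlarges the bound at each step by a
  factor of order \<open>m\<close> only, so that the exponentially small factor known from one variable survives.
\<close>

lemma grid_Schwarz:
  fixes f :: "complex^'m \<Rightarrow> complex"
  assumes holo: "holo_fun (polydisc 1) f"
    and bd: "\<And>w. w \<in> polydisc 1 \<Longrightarrow> norm (f w) \<le> B"
    and 0: "\<And>w. w \<in> grid m \<Longrightarrow> f w = 0"
    and w: "w \<in> polydisc (1 / 8)"
  shows "norm (f w) \<le> 2 * B * (1 / 8) ^ m * (real m + 1) ^ (CARD('m) + 1)"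
proof -
  have "B \<ge> 0" using order_trans[OF norm_ge_zero bd[of 0]] by (simp add: polydisc_def)
  define \<beta> where "\<beta> = 2 * (real m + 1) * B * (1 / 8) ^ m"
  have \<beta>: "\<beta> \<ge> 0" using \<open>B \<ge> 0\<close> by (simp add: \<beta>_def)
  have "\<forall>w. (\<forall>i\<in>J. norm (w $ i) \<le> 1 / 8) \<and> (\<forall>i\<in>-J. w $ i \<in> circle_nodes m) \<longrightarrow>
     norm (f w) \<le> \<beta> * (real m + 1) ^ card J" if "finite J" for J :: "'m set"
    using that
  proof (induction J rule: finite_induct)
    case empty
    then show ?case using 0 \<beta> by (simp add: grid_def)
  next
    case (insert j J)
    show ?case
    proof (intro allI impI, elim conjE)
      fix w :: "complex^'m"
      assume w1: "\<forall>i\<in>insert j J. norm (w $ i) \<le> 1 / 8"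
        and w2: "\<forall>i\<in>-insert j J. w $ i \<in> circle_nodes m"
      define s where "s t = (\<chi> i. if i = j then t else w $ i)" for t
      have w8: "norm (w $ i) \<le> 1 / 8" for i
        using w1 w2 circle_nodes(4)[of "w $ i" m] by blast
      have sP: "s t \<in> polydisc 1" if "norm t \<le> 1" for t
      proof -
        have "norm (s t $ i) \<le> 1" for i using that w8[of i] by (cases "i = j") (auto simp: s_def)
        then show ?thesis by (simp add: polydisc_def)
      qed
      have vel: "has_velocity s (axis j 1) t" for t
        unfolding has_velocity_def s_def by (auto simp: axis_def)
      have df: "(\<lambda>t. f (s t)) field_differentiable (at t)" if t: "norm t \<le> 1" for t
      proof -
        obtain a where "(f has_derivative pairing a) (at (s t))"
          using holo sP[OF t] by (auto simp: holo_fun_def)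
        from has_field_derivative_along_curve[OF this vel] show ?thesis
          by (auto simp: field_differentiable_def)
      qed
      have "norm (f (s (w $ j))) \<le> real m * (\<beta> * (real m + 1) ^ card J) + 2 * (real m + 1) * B * (1 / 8) ^ m"
      proof (rule bound_from_values_at_nodes[where f = "\<lambda>t. f (s t)"])
        show "continuous_on (cball 0 1) (\<lambda>t. f (s t))"
          using df by (intro continuous_at_imp_continuous_on)
            (auto intro: field_differentiable_imp_continuous_at)
        show "(\<lambda>t. f (s t)) holomorphic_on ball 0 1"
          unfolding holomorphic_on_def using df by (auto intro: field_differentiable_at_within)
        show "norm (f (s z)) \<le> B" if "norm z \<le> 1" for z using bd sP that by blast
        show "norm (f (s z)) \<le> \<beta> * (real m + 1) ^ card J" if "z \<in> circle_nodes m" for z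
        proof -
          have "(\<forall>i\<in>J. norm (s z $ i) \<le> 1 / 8) \<and> (\<forall>i\<in>-J. s z $ i \<in> circle_nodes m)"
            using w8 w2 that insert.hyps by (auto simp: s_def)
          then show ?thesis using insert.IH by blast
        qed
        show "norm (w $ j) \<le> 1 / 8" by (rule w8)
      qed
      also have "s (w $ j) = w" by (simp add: s_def vec_eq_iff)
      also have "real m * (\<beta> * (real m + 1) ^ card J) + 2 * (real m + 1) * B * (1 / 8) ^ m
         = real m * (\<beta> * (real m + 1) ^ card J) + \<beta> * 1" by (simp add: \<beta>_def)
      also have "\<dots> \<le> real m * (\<beta> * (real m + 1) ^ card J) + \<beta> * (real m + 1) ^ card J"
        using \<beta> by (intro add_left_mono mult_left_mono) (auto intro!: one_le_power)
      also have "\<dots> = \<beta> * (real m + 1) ^ card (insert j J)" using insert.hyps by (simp add: algebra_simps)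
      finally show "norm (f w) \<le> \<beta> * (real m + 1) ^ card (insert j J)" by simp
    qed
  qed
  from this[of UNIV] have "norm (f w) \<le> \<beta> * (real m + 1) ^ CARD('m)"
    using w by (simp add: polydisc_def)
  then show ?thesis by (simp add: \<beta>_def algebra_simps)
qed

section \<open>The identity theorem\<close>

lemma holo_fun_line:
  assumes "holo_fun U f"
  shows "(\<lambda>t. f (w + t *s v)) holomorphic_on {t. w + t *s v \<in> U}"
  unfolding holomorphic_on_def
proof
  fix t assume "t \<in> {t. w + t *s v \<in> U}"
  then obtain a where "(f has_derivative pairing a) (at (w + t *s v))"
    using assms by (auto simp: holo_fun_def)
  from has_field_derivative_along_curve[OF this has_velocity_line]
  show "(\<lambda>t. f (w + t *s v)) field_differentiable at t within {t. w + t *s v \<in> U}"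
    by (auto simp: field_differentiable_def intro: DERIV_subset)
qed

lemma isCont_line: "isCont (\<lambda>t :: complex. w + t *s v) t"
  using has_velocity_line[of w v t] unfolding has_velocity_iff by (rule has_derivative_continuous)

text \<open>
  Restriction to the complex line through both points reduces this to functions of one variable.
\<close>

lemma holo_fun_zero_on_convex:
  assumes f: "holo_fun U f" and U: "open U" "convex U" and w: "w \<in> U" "w' \<in> U"
    and N: "open N" "w \<in> N" "\<And>x. x \<in> N \<Longrightarrow> f x = 0"
  shows "f w' = 0"
proof -
  define l where "l t = w + t *s (w' - w)" for t
  have op: "open (l -` Y)" if "open Y" for Y
    using that unfolding l_def by (intro continuous_open_vimage isCont_line) 
  have "convex (l -` U)"
  proof (rule convexI)
    fix s t :: complex and u v :: real
    assume a: "s \<in> l -` U" "t \<in> l -` U" "0 \<le> u" "0 \<le> v" "u + v = 1"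
    have "l (u *\<^sub>R s + v *\<^sub>R t) = u *\<^sub>R l s + v *\<^sub>R l t"
    proof -
      have v: "v = 1 - u" using a(5) by simp
      show ?thesis
        by (simp add: l_def vec_eq_iff v scaleR_conv_of_real[where 'a = complex] algebra_simps)
    qed
    then show "u *\<^sub>R s + v *\<^sub>R t \<in> l -` U" using a U(2) by (simp add: convexD)
  qed
  then have con: "connected (l -` U)" by (rule convex_connected)
  have l: "l 0 = w" "l 1 = w'" by (simp_all add: l_def)
  have "f (l 1) = 0"
  proof (rule analytic_continuation_open[where f = "\<lambda>t. f (l t)" and g = "\<lambda>_. 0"
        and s = "l -` (U \<inter> N)" and s' = "l -` U"])
    show "open (l -` (U \<inter> N))" "open (l -` U)" using U N by (auto intro: op)
    show "l -` (U \<inter> N) \<noteq> {}" using w N l by auto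
    show "(\<lambda>t. f (l t)) holomorphic_on l -` U"
      using holo_fun_line[OF f, of w "w' - w"] by (simp add: l_def vimage_def)
  qed (use con w l N in auto)
  then show ?thesis by (simp add: l)
qed

lemma underdetermined_system:
  fixes a :: "'i \<Rightarrow> 'x \<Rightarrow> complex"
  assumes "finite E" "finite A" "card E < card A"
  shows "\<exists>c. (\<exists>\<alpha>\<in>A. c \<alpha> \<noteq> 0) \<and> (\<forall>x\<in>E. (\<Sum>\<alpha>\<in>A. c \<alpha> * a \<alpha> x) = 0)"
  using assms
proof (induction E arbitrary: A a rule: finite_induct)
  case empty
  then obtain \<alpha> where "\<alpha> \<in> A" by fastforce
  then show ?case by (intro exI[of _ "\<lambda>_. 1"]) auto
next
  case (insert x E)
  show ?case
  proof (cases "\<forall>\<alpha>\<in>A. a \<alpha> x = 0")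
    case True
    have "card E < card A" using insert by simp
    from insert.IH[OF insert.prems(1) this, of a] obtain c where
      "\<exists>\<alpha>\<in>A. c \<alpha> \<noteq> 0" "\<forall>x\<in>E. (\<Sum>\<alpha>\<in>A. c \<alpha> * a \<alpha> x) = 0" by blast
    then show ?thesis using True by (intro exI[of _ c]) simp
  next
    case False
    then obtain \<beta> where \<beta>: "\<beta> \<in> A" "a \<beta> x \<noteq> 0" by blast
    have "card E < card (A - {\<beta>})" using insert \<beta> by simp
    from insert.IH[OF _ this, of "\<lambda>\<alpha> y. a \<alpha> y - a \<alpha> x / a \<beta> x * a \<beta> y"] insert.prems(1)
    obtain c where c: "\<exists>\<alpha>\<in>A-{\<beta>}. c \<alpha> \<noteq> 0"
      "\<forall>y\<in>E. (\<Sum>\<alpha>\<in>A-{\<beta>}. c \<alpha> * (a \<alpha> y - a \<alpha> x / a \<beta> x * a \<beta> y)) = 0" by blast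
    define b where "b = - (\<Sum>\<alpha>\<in>A-{\<beta>}. c \<alpha> * (a \<alpha> x / a \<beta> x))"
    define c' where "c' = c(\<beta> := b)"
    have s: "(\<Sum>\<alpha>\<in>A. c' \<alpha> * a \<alpha> y) = b * a \<beta> y + (\<Sum>\<alpha>\<in>A-{\<beta>}. c \<alpha> * a \<alpha> y)" for y
    proof -
      have "(\<Sum>\<alpha>\<in>A. c' \<alpha> * a \<alpha> y) = c' \<beta> * a \<beta> y + (\<Sum>\<alpha>\<in>A-{\<beta>}. c' \<alpha> * a \<alpha> y)"
        using \<beta> insert.prems by (intro sum.remove) auto
      also have "(\<Sum>\<alpha>\<in>A-{\<beta>}. c' \<alpha> * a \<alpha> y) = (\<Sum>\<alpha>\<in>A-{\<beta>}. c \<alpha> * a \<alpha> y)"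
        by (intro sum.cong) (auto simp: c'_def)
      finally show ?thesis by (simp add: c'_def)
    qed
    have "(\<Sum>\<alpha>\<in>A. c' \<alpha> * a \<alpha> y) = (\<Sum>\<alpha>\<in>A-{\<beta>}. c \<alpha> * (a \<alpha> y - a \<alpha> x / a \<beta> x * a \<beta> y))" for y
      unfolding s b_def by (simp add: sum_distrib_right sum_subtractf right_diff_distrib mult.assoc)
    moreover have "(\<Sum>\<alpha>\<in>A-{\<beta>}. c \<alpha> * (a \<alpha> x - a \<alpha> x / a \<beta> x * a \<beta> x)) = 0"
      using \<beta> by simp
    ultimately have "\<forall>y\<in>insert x E. (\<Sum>\<alpha>\<in>A. c' \<alpha> * a \<alpha> y) = 0" using c(2) by simp
    moreover have "\<exists>\<alpha>\<in>A. c' \<alpha> \<noteq> 0" using c(1) by (auto simp: c'_def)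
    ultimately show ?thesis by blast
  qed
qed

section \<open>Projective manifolds\<close>

locale projective_cone =
  fixes M :: "(complex^'n) set" and dimension :: "'d::finite itself"
  assumes projective_manifold: "projective_manifold TYPE('d) M"
begin

lemma M_equations:
  obtains S where "\<And>F. F \<in> S \<Longrightarrow> \<exists>k. F \<in> hom_poly k" "M = {x. x \<noteq> 0 \<and> (\<forall>F\<in>S. F x = 0)}"
  using projective_manifold unfolding projective_manifold_def projective_algebraic_def by blast

lemma M_nonempty: "M \<noteq> {}" and M_connected: "connected M"
  using projective_manifold unfolding projective_manifold_def by auto

lemma M_nonzero: "x \<in> M \<Longrightarrow> x \<noteq> 0"
  using M_equations by blast

lemma M_cone: "x \<in> M \<Longrightarrow> c \<noteq> 0 \<Longrightarrow> c *s x \<in> M"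
proof -
  assume a: "x \<in> M" "c \<noteq> 0"
  obtain S where S: "\<And>F. F \<in> S \<Longrightarrow> \<exists>k. F \<in> hom_poly k" "M = {x. x \<noteq> 0 \<and> (\<forall>F\<in>S. F x = 0)}"
    using M_equations by blast
  have "F (c *s x) = 0" if "F \<in> S" for F
    using S(1)[OF that] hom_poly_homogeneous a(1) that unfolding S(2) by fastforce
  then show ?thesis using a unfolding S(2) by auto
qed

lemma compact_unit_vectors: "compact {x \<in> M. norm x = 1}"
proof -
  obtain S where S: "\<And>F. F \<in> S \<Longrightarrow> \<exists>k. F \<in> hom_poly k" "M = {x. x \<noteq> 0 \<and> (\<forall>F\<in>S. F x = 0)}"
    using M_equations by blast
  have "{x \<in> M. norm x = 1} = sphere 0 1 \<inter> (\<Inter>F\<in>S. {x. F x = 0})" unfolding S(2) by auto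
  moreover have "closed {x. F x = 0}" if F: "F \<in> S" for F
  proof -
    obtain k where "F \<in> hom_poly k" using S(1)[OF F] by blast
    then have "continuous_on UNIV F" using holo_fun_continuous[OF hom_poly_holo[of F k UNIV]]
      by (simp add: continuous_at_imp_continuous_on)
    then show ?thesis by (intro closed_Collect_eq continuous_on_const)
  qed
  ultimately show ?thesis by (auto intro!: compact_Int_closed closed_INT)
qed

text \<open>
  Charts are scaled such that the Schwarz lemma on the unit polydisc applies to them; the open polydisc on
  which that lemma gives small values still covers a neighbourhood of the point.
\<close>

lemma chart:
  assumes p: "p \<in> M" and N: "open N" "p \<in> N"
  obtains \<Phi> :: "complex^'d option \<Rightarrow> complex^'n"
  where "holo_immersion (polydisc 1) \<Phi>" "\<Phi> ` polydisc 1 \<subseteq> M \<inter> N" "\<Phi> 0 = p"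
    "openin (top_of_set M) (\<Phi> ` open_polydisc)"
proof -
  from projective_manifold p obtain V and \<phi> :: "complex^'d option \<Rightarrow> complex^'n" and \<psi>
    where V: "open V" "holo_immersion V \<phi>" "homeomorphism V (\<phi> ` V) \<phi> \<psi>"
      "p \<in> \<phi> ` V" "openin (top_of_set M) (\<phi> ` V)"
    unfolding projective_manifold_def complex_submanifold_def by blast
  obtain z where z: "z \<in> V" "\<phi> z = p" using V(4) by blast
  have "open (V \<inter> \<phi> -` N)"
    using continuous_on_open_vimage[OF V(1), of \<phi>] V(3) N(1) by (simp add: homeomorphism_def Int_commute)
  then obtain \<epsilon> where \<epsilon>: "\<epsilon> > 0" "ball z \<epsilon> \<subseteq> V \<inter> \<phi> -` N"
    using z N by (metis IntI openE vimageI2)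
  define r where "r = \<epsilon> / (real CARD('d option) + 1)"
  have r: "r > 0" using \<epsilon> by (simp add: r_def add_pos_nonneg)
  define g where "g w = z + of_real r *s w" for w :: "complex^'d option"
  define h where "h y = inverse (of_real r) *s (y - z)" for y :: "complex^'d option"
  have hg: "h (g w) = w" "g (h w) = w" for w using r by (auto simp: g_def h_def vec_eq_iff)
  define \<Phi> where "\<Phi> w = \<phi> (g w)" for w
  have gV: "g w \<in> V \<inter> \<phi> -` N" if "w \<in> polydisc 1" for w
  proof -
    have "norm (of_real r *s w) \<le> (\<Sum>i\<in>UNIV. norm ((of_real r *s w) $ i))"
      unfolding norm_vec_def by (rule L2_set_le_sum) simp
    also have "\<dots> \<le> (\<Sum>i\<in>(UNIV :: 'd option set). r)"
      using that r by (intro sum_mono) (auto simp: norm_mult polydisc_def intro!: mult_left_le)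
    also have "\<dots> < \<epsilon>" using \<epsilon>(1) by (simp add: r_def field_simps)
    finally have "g w \<in> ball z \<epsilon>" by (simp add: g_def dist_norm)
    then show ?thesis using \<epsilon>(2) by blast
  qed
  have "\<exists>A. (\<Phi> has_derivative (\<lambda>v. A *v v)) (at w) \<and> inj (\<lambda>v. A *v v)" if w: "w \<in> polydisc 1" for w
  proof -
    obtain A where A: "(\<phi> has_derivative (\<lambda>v. A *v v)) (at (g w))" "inj (\<lambda>v. A *v v)"
      using V(2) gV[OF w] by (auto simp: holo_immersion_def)
    define A' where "A' = (\<chi> i j. of_real r * A $ i $ j)"
    have A': "A' *v v = A *v (of_real r *s v)" for v
      by (simp add: A'_def vec_eq_iff matrix_vector_mult_def mult_ac)
    have "(g has_derivative (\<lambda>v. of_real r *s v)) (at w)"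
      unfolding g_def by (rule has_derivative_vec)
        (auto intro!: derivative_eq_intros bounded_linear_imp_has_derivative bounded_linear_vec_nth)
    from has_derivative_compose[OF this A(1)] have "(\<Phi> has_derivative (\<lambda>v. A' *v v)) (at w)"
      by (simp add: A' \<Phi>_def[abs_def])
    moreover have "inj (\<lambda>v. A' *v v)"
    proof (rule injI)
      fix v v' assume "A' *v v = A' *v v'"
      then have "of_real r *s v = of_real r *s v'" using A(2) unfolding A' by (auto dest: injD)
      then show "v = v'" using r by (simp add: vec_eq_iff)
    qed
    ultimately show ?thesis by blast
  qed
  then have 1: "holo_immersion (polydisc 1) \<Phi>" by (simp add: holo_immersion_def)
  have "\<phi> ` V \<subseteq> M" using V(5) openin_imp_subset by blast
  then have 2: "\<Phi> ` polydisc 1 \<subseteq> M \<inter> N" using gV by (auto simp: \<Phi>_def)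
  have 3: "\<Phi> 0 = p" using z by (simp add: \<Phi>_def g_def)
  define Q where "Q = (open_polydisc :: (complex^'d option) set)"
  have Q1: "Q \<subseteq> polydisc 1" unfolding Q_def by (rule open_polydisc)
  have "open Q" unfolding Q_def by (rule open_polydisc)
  moreover have "continuous_on (\<phi> ` V) (\<lambda>y. h (\<psi> y))"
  proof -
    have "continuous_on (\<phi> ` V) \<psi>" using V(3) by (simp add: homeomorphism_def)
    then show ?thesis unfolding h_def vector_scalar_mult_def by (intro continuous_intros)
  qed
  ultimately have "openin (top_of_set (\<phi> ` V)) (\<phi> ` V \<inter> (\<lambda>y. h (\<psi> y)) -` Q)"
    by (rule continuous_openin_preimage_gen[rotated])
  moreover have "\<phi> ` V \<inter> (\<lambda>y. h (\<psi> y)) -` Q = \<Phi> ` Q"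
  proof (intro subset_antisym subsetI)
    fix y assume "y \<in> \<phi> ` V \<inter> (\<lambda>y. h (\<psi> y)) -` Q"
    then obtain v where v: "v \<in> V" "y = \<phi> v" "h (\<psi> y) \<in> Q" by blast
    then have "\<psi> y = v" using V(3) by (simp add: homeomorphism_def)
    then have "y = \<Phi> (h v)" using v hg by (simp add: \<Phi>_def)
    then show "y \<in> \<Phi> ` Q" using v \<open>\<psi> y = v\<close> by simp
  next
    fix y assume "y \<in> \<Phi> ` Q"
    then obtain w where w: "w \<in> Q" "y = \<phi> (g w)" by (auto simp: \<Phi>_def)
    then have "g w \<in> V" using gV Q1 by blast
    moreover from this have "\<psi> y = g w" using V(3) w by (simp add: homeomorphism_def)
    ultimately show "y \<in> \<phi> ` V \<inter> (\<lambda>y. h (\<psi> y)) -` Q" using w hg by simp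
  qed
  ultimately have "openin (top_of_set M) (\<Phi> ` Q)" using V(5) openin_trans by metis
  with that[OF 1 2 3] show thesis by (simp add: Q_def)
qed

lemma immersion_holo:
  assumes "holo_immersion U \<Phi>" "holo_fun UNIV f"
  shows "holo_fun U (\<lambda>w. f (\<Phi> w))"
  unfolding holo_fun_def
proof
  fix w assume "w \<in> U"
  then obtain A where A: "(\<Phi> has_derivative (\<lambda>v. A *v v)) (at w)"
    using assms(1) by (auto simp: holo_immersion_def)
  obtain a where "(f has_derivative pairing a) (at (\<Phi> w))"
    using assms(2) by (auto simp: holo_fun_def)
  from has_derivative_pairing_compose[OF this A]
  show "\<exists>a. ((\<lambda>w. f (\<Phi> w)) has_derivative pairing a) (at w)" by blast
qed

text \<open>
  The points near which the function vanishes on the cone form an open set, which is closed because the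
  identity theorem holds on the polydisc of each chart; the cone is connected.
\<close>

lemma identity_theorem:
  assumes f: "holo_fun UNIV f" and G: "openin (top_of_set M) G" "G \<noteq> {}" "\<And>x. x \<in> G \<Longrightarrow> f x = 0"
    and y: "y \<in> M"
  shows "f y = 0"
proof -
  define Z where "Z x \<longleftrightarrow> (\<exists>G. openin (top_of_set M) G \<and> x \<in> G \<and> (\<forall>y\<in>G. f y = 0))" for x
  obtain x where x: "x \<in> G" using G(2) by blast
  have "Z y"
  proof (rule connected_induction_simple[OF M_connected, of x y Z])
    show "x \<in> M" using x G(1) openin_imp_subset by blast
    show "Z x" using x G by (auto simp: Z_def)
    fix a assume a: "a \<in> M"
    obtain \<Phi> :: "complex^'d option \<Rightarrow> complex^'n" where \<Phi>: "holo_immersion (polydisc 1) \<Phi>"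
      "\<Phi> ` polydisc 1 \<subseteq> M \<inter> UNIV" "\<Phi> 0 = a"
      "openin (top_of_set M) (\<Phi> ` open_polydisc)"
      using chart[OF a open_UNIV UNIV_I] .
    define Q where "Q = (open_polydisc :: (complex^'d option) set)"
    have Q: "open Q" "convex Q" and Q1: "Q \<subseteq> polydisc 1"
      unfolding Q_def by (rule open_polydisc)+
    show "\<exists>T. openin (top_of_set M) T \<and> a \<in> T \<and> (\<forall>x\<in>T. \<forall>y\<in>T. Z x \<longrightarrow> Z y)"
    proof (intro exI[of _ "\<Phi> ` Q"] conjI ballI impI)
      show "openin (top_of_set M) (\<Phi> ` Q)" using \<Phi>(4) by (simp add: Q_def)
      have "0 \<in> Q" unfolding Q_def by (rule open_polydisc)
      then show "a \<in> \<Phi> ` Q" using \<Phi>(3) by blast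
      fix x y assume "x \<in> \<Phi> ` Q" "y \<in> \<Phi> ` Q" "Z x"
      then obtain w where w: "w \<in> Q" "\<Phi> w = x" by blast
      obtain G where G: "openin (top_of_set M) G" "x \<in> G" "\<forall>y\<in>G. f y = 0"
        using \<open>Z x\<close> by (auto simp: Z_def)
      then obtain B where B: "open B" "G = M \<inter> B" by (auto simp: openin_open)
      have holo: "holo_fun Q (\<lambda>w. f (\<Phi> w))"
        using immersion_holo[OF \<Phi>(1) f] Q1 by (auto simp: holo_fun_def)
      have "continuous_on Q \<Phi>"
        using \<Phi>(1) Q1 unfolding holo_immersion_def
        by (meson continuous_at_imp_continuous_on has_derivative_continuous subsetD)
      then have N: "open (Q \<inter> \<Phi> -` B)" using Q(1) B(1) by (simp add: continuous_on_open_vimage Int_commute)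
      have "f (\<Phi> w') = 0" if "w' \<in> Q" for w'
      proof (rule holo_fun_zero_on_convex[OF holo Q w(1) that N])
        show "w \<in> Q \<inter> \<Phi> -` B" using w G B by auto
        show "f (\<Phi> v) = 0" if "v \<in> Q \<inter> \<Phi> -` B" for v
          using that G(3) B(2) \<Phi>(2) Q1 by blast
      qed
      then have "\<forall>y\<in>\<Phi> ` Q. f y = 0" by blast
      with \<open>y \<in> \<Phi> ` Q\<close> \<Phi>(4) show "Z y" unfolding Z_def Q_def by blast
    qed
  qed (use y in auto)
  then show ?thesis by (auto simp: Z_def)
qed

lemma zero_divisor:
  assumes P: "holo_fun UNIV P" and Q: "holo_fun UNIV Q" and "\<And>x. x \<in> M \<Longrightarrow> P x * Q x = 0"
    and p: "p \<in> M" "P p \<noteq> 0" and y: "y \<in> M"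
  shows "Q y = 0"
proof (rule identity_theorem[OF Q _ _ _ y])
  have "continuous_on UNIV P"
    using holo_fun_continuous[OF P] by (simp add: continuous_at_imp_continuous_on)
  then have "open (P -` (-{0}))" using continuous_on_open_vimage[OF open_UNIV, of P] by auto
  then show "openin (top_of_set M) (M \<inter> P -` (-{0}))" by (auto simp: openin_open)
  show "M \<inter> P -` (-{0}) \<noteq> {}" using p by auto
qed (use assms(3) in auto)

end

section \<open>Algebraic dependence of forms\<close>

context projective_cone
begin

text \<open>
  Finitely many charts cover the compact set of unit vectors of the cone.  The function attains its maximum
  there, at a point covered by one of them.  If the function vanishes on the grids of all charts, the
  Schwarz lemma bounds this maximum by a fraction of the maximum on the ball of radius \<open>2\<close>, which in turn
  exceeds the first one at most by the factor \<open>Suc N * 2 ^ N\<close>, because on complex lines through the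
  origin the function is a polynomial of degree at most \<open>N\<close>.
\<close>

lemma small_on_grid_imp_zero:
  obtains s :: nat where
    "\<And>m. \<exists>E. finite E \<and> card E \<le> s * m ^ CARD('d option) \<and>
      (\<forall>f g N. holo_fun UNIV f \<longrightarrow> (\<forall>x\<in>M. \<forall>t. f (t *s x) = (\<Sum>n<Suc N. g x n * t ^ n)) \<longrightarrow>
        (\<forall>x\<in>E. f x = 0) \<longrightarrow>
        real (Suc N) * 2 ^ N * (2 * (1 / 8) ^ m * (real m + 1) ^ (CARD('d option) + 1)) < 1 \<longrightarrow>
        (\<forall>x\<in>M. f x = 0))"
proof -
  define S where "S = {x \<in> M. norm x = 1}"
  define Q where "Q = (open_polydisc :: (complex^'d option) set)"
  have Q8: "Q \<subseteq> polydisc (1 / 8)" unfolding Q_def by (rule open_polydisc)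
  have "\<exists>\<Phi> B. holo_immersion (polydisc 1) \<Phi> \<and> \<Phi> ` polydisc 1 \<subseteq> M \<inter> ball 0 2 \<and>
     p \<in> \<Phi> ` Q \<and> open B \<and> \<Phi> ` Q = M \<inter> B" if p: "p \<in> S" for p
  proof -
    have pM: "p \<in> M" "p \<in> ball 0 2" using p by (auto simp: S_def)
    obtain \<Phi> :: "complex^'d option \<Rightarrow> complex^'n" where \<Phi>: "holo_immersion (polydisc 1) \<Phi>"
      "\<Phi> ` polydisc 1 \<subseteq> M \<inter> ball 0 2" "\<Phi> 0 = p"
      "openin (top_of_set M) (\<Phi> ` Q)"
      using chart[OF pM(1) open_ball pM(2)] unfolding Q_def .
    moreover have "0 \<in> Q" unfolding Q_def by (rule open_polydisc)
    ultimately show ?thesis unfolding openin_open by blast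
  qed
  then obtain \<Phi> B where \<Phi>: "\<And>p. p \<in> S \<Longrightarrow> holo_immersion (polydisc 1) (\<Phi> p)"
      "\<And>p. p \<in> S \<Longrightarrow> \<Phi> p ` polydisc 1 \<subseteq> M \<inter> ball 0 2" "\<And>p. p \<in> S \<Longrightarrow> p \<in> \<Phi> p ` Q"
      "\<And>p. p \<in> S \<Longrightarrow> open (B p)" "\<And>p. p \<in> S \<Longrightarrow> \<Phi> p ` Q = M \<inter> B p" by metis
  have comp: "compact S" unfolding S_def by (rule compact_unit_vectors)
  obtain S' where S': "S' \<subseteq> S" "finite S'" "S \<subseteq> (\<Union>p\<in>S'. B p)"
  proof (rule compactE_image[OF comp, of S B])
    show "S \<subseteq> (\<Union>p\<in>S. B p)" using \<Phi>(3,5) by blast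
  qed (use \<Phi>(4) in auto)
  have Sne: "S \<noteq> {}"
  proof -
    obtain x where x: "x \<in> M" using M_nonempty by blast
    then have "inverse (of_real (norm x)) *s x \<in> M" using M_cone M_nonzero by simp
    moreover have "norm (inverse (of_real (norm x)) *s x) = 1"
    proof -
      have "inverse (of_real (norm x)) *s x = inverse (norm x) *\<^sub>R x"
        by (simp add: vec_eq_iff scaleR_conv_of_real[where 'a = complex])
      then show ?thesis using M_nonzero[OF x] by simp
    qed
    ultimately show ?thesis by (auto simp: S_def)
  qed
  have "\<exists>E. finite E \<and> card E \<le> card S' * m ^ CARD('d option) \<and>
      (\<forall>f g N. holo_fun UNIV f \<longrightarrow> (\<forall>x\<in>M. \<forall>t. f (t *s x) = (\<Sum>n<Suc N. g x n * t ^ n)) \<longrightarrow>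
        (\<forall>x\<in>E. f x = 0) \<longrightarrow>
        real (Suc N) * 2 ^ N * (2 * (1 / 8) ^ m * (real m + 1) ^ (CARD('d option) + 1)) < 1 \<longrightarrow>
        (\<forall>x\<in>M. f x = 0))" for m
  proof (intro exI[of _ "\<Union>p\<in>S'. \<Phi> p ` grid m"] conjI allI impI)
    show "finite (\<Union>p\<in>S'. \<Phi> p ` grid m)" using S'(2) grid(1) by blast
    have "card (\<Union>p\<in>S'. \<Phi> p ` grid m) \<le> (\<Sum>p\<in>S'. card (\<Phi> p ` grid m))"
      by (rule card_UN_le[OF S'(2)])
    also have "\<dots> \<le> (\<Sum>p\<in>S'. m ^ CARD('d option))"
      by (intro sum_mono order_trans[OF card_image_le[OF grid(1)] grid(2)])
    finally show "card (\<Union>p\<in>S'. \<Phi> p ` grid m) \<le> card S' * m ^ CARD('d option)" by simp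
    fix f :: "complex^'n \<Rightarrow> complex" and g N
    assume f: "holo_fun UNIV f" and g: "\<forall>x\<in>M. \<forall>t. f (t *s x) = (\<Sum>n<Suc N. g x n * t ^ n)"
      and E: "\<forall>x\<in>\<Union>p\<in>S'. \<Phi> p ` grid m. f x = 0"
      and small: "real (Suc N) * 2 ^ N * (2 * (1 / 8) ^ m * (real m + 1) ^ (CARD('d option) + 1)) < 1"
    have "continuous_on S (\<lambda>x. norm (f x))"
      using holo_fun_continuous[OF f] by (intro continuous_on_norm continuous_at_imp_continuous_on) auto
    from continuous_attains_sup[OF comp Sne this] obtain x0
      where x0: "x0 \<in> S" "\<And>x. x \<in> S \<Longrightarrow> norm (f x) \<le> norm (f x0)" by blast
    define \<mu> where "\<mu> = norm (f x0)"
    have coeff: "norm (g x n) \<le> \<mu>" if x: "x \<in> S" and n: "n < Suc N" for x n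
    proof -
      have "norm (g x n) * 1 ^ n \<le> \<mu>"
      proof (rule coefficient_bound_by_roots_of_unity[OF n, where a = "g x"])
        fix k :: nat
        let ?t = "of_real 1 * cis (2 * pi * real k / real (Suc N))"
        have "norm (?t *s x) = 1"
        proof -
          have "norm ((?t *s x) $ i) = norm (x $ i)" for i by (simp add: norm_mult)
          then have "norm (?t *s x) = norm x" unfolding norm_vec_def by simp
          then show ?thesis using x by (simp add: S_def)
        qed
        moreover have "?t *s x \<in> M" using x by (intro M_cone) (auto simp: S_def)
        ultimately have "norm (f (?t *s x)) \<le> \<mu>" using x0(2) by (simp add: S_def \<mu>_def)
        then show "norm (\<Sum>j<Suc N. g x j * ?t ^ j) \<le> \<mu>" using g x by (simp add: S_def)
      qed simp
      then show ?thesis by simp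
    qed
    have unit: "\<exists>x\<in>S. y = of_real (norm y) *s x" if y: "y \<in> M" for y
    proof
      have "norm y \<noteq> 0" using M_nonzero[OF y] by simp
      then show "y = of_real (norm y) *s (inverse (norm y) *\<^sub>R y)"
        by (simp add: vec_eq_iff scaleR_conv_of_real[where 'a = complex])
      have e: "inverse (norm y) *\<^sub>R y = of_real (inverse (norm y)) *s y"
        by (simp add: vec_eq_iff scaleR_conv_of_real[where 'a = complex])
      have "inverse (norm y) *\<^sub>R y \<in> M"
        unfolding e using \<open>norm y \<noteq> 0\<close> by (intro M_cone[OF y]) simp
      then show "inverse (norm y) *\<^sub>R y \<in> S"
        using \<open>norm y \<noteq> 0\<close> by (simp add: S_def)
    qed
    have bd: "norm (f y) \<le> real (Suc N) * 2 ^ N * \<mu>" if y: "y \<in> M" "norm y \<le> 2" for y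
    proof -
      obtain x where x: "x \<in> S" "y = of_real (norm y) *s x" using unit[OF y(1)] by blast
      have "f y = f (of_real (norm y) *s x)" using x(2) by (rule arg_cong)
      also have "\<dots> = (\<Sum>n<Suc N. g x n * of_real (norm y) ^ n)" using g x(1) by (simp only: S_def mem_Collect_eq)
      also have "norm \<dots> \<le> (\<Sum>n<Suc N. norm (g x n * of_real (norm y) ^ n))" by (rule norm_sum)
      also have "\<dots> \<le> (\<Sum>n<Suc N. \<mu> * 2 ^ N)"
      proof (rule sum_mono)
        fix n assume n: "n \<in> {..<Suc N}"
        have "norm y ^ n \<le> 2 ^ n" using y by (intro power_mono) auto
        also have "\<dots> \<le> (2 :: real) ^ N" using n by (intro power_increasing) auto
        finally have "norm y ^ n \<le> 2 ^ N" .
        then show "norm (g x n * of_real (norm y) ^ n) \<le> \<mu> * 2 ^ N"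
          using coeff[OF x(1)] n by (auto simp: norm_mult norm_power \<mu>_def intro!: mult_mono)
      qed
      finally show ?thesis by (simp add: mult_ac)
    qed
    have "\<mu> = 0"
    proof (rule ccontr)
      assume "\<mu> \<noteq> 0"
      then have "\<mu> > 0" by (simp add: \<mu>_def)
      obtain p where p: "p \<in> S'" "x0 \<in> B p" using S'(3) x0(1) by blast
      then have pS: "p \<in> S" using S'(1) by blast
      have "x0 \<in> \<Phi> p ` Q" using p x0(1) \<Phi>(5)[OF pS] by (auto simp: S_def)
      then obtain w where w: "w \<in> Q" "x0 = \<Phi> p w" by blast
      have "norm (f (\<Phi> p w)) \<le> 2 * (real (Suc N) * 2 ^ N * \<mu>) * (1 / 8) ^ m * (real m + 1) ^ (CARD('d option) + 1)"
      proof (rule grid_Schwarz)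
        show "holo_fun (polydisc 1) (\<lambda>w. f (\<Phi> p w))" by (rule immersion_holo[OF \<Phi>(1)[OF pS] f])
        show "norm (f (\<Phi> p w)) \<le> real (Suc N) * 2 ^ N * \<mu>" if "w \<in> polydisc 1" for w
        proof (rule bd)
          have "\<Phi> p w \<in> M \<inter> ball 0 2" using \<Phi>(2)[OF pS] that by blast
          then show "\<Phi> p w \<in> M" "norm (\<Phi> p w) \<le> 2" by auto
        qed
        show "f (\<Phi> p w) = 0" if "w \<in> grid m" for w using E p that by blast
        show "w \<in> polydisc (1 / 8)" using w Q8 by blast
      qed
      then have "\<mu> \<le> (real (Suc N) * 2 ^ N * (2 * (1 / 8) ^ m * (real m + 1) ^ (CARD('d option) + 1))) * \<mu>"
        using w(2) by (simp add: \<mu>_def mult_ac)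
      also have "\<dots> < 1 * \<mu>" using small \<open>\<mu> > 0\<close> by (rule mult_strict_right_mono)
      finally show False by simp
    qed
    show "\<forall>x\<in>M. f x = 0"
    proof
      fix y assume y: "y \<in> M"
      obtain x where x: "x \<in> S" "y = of_real (norm y) *s x" using unit[OF y] by blast
      have "f y = f (of_real (norm y) *s x)" using x(2) by (rule arg_cong)
      also have "\<dots> = (\<Sum>n<Suc N. g x n * of_real (norm y) ^ n)" using g x(1) by (simp only: S_def mem_Collect_eq)
      also have "\<dots> = 0" using coeff[OF x(1)] \<open>\<mu> = 0\<close> by (intro sum.neutral) auto
      finally show "f y = 0" .
    qed
  qed
  then show thesis by (rule that)
qed

end

lemma holo_fun_sum: "(\<And>i. i \<in> I \<Longrightarrow> holo_fun U (f i)) \<Longrightarrow> holo_fun U (\<lambda>x. \<Sum>i\<in>I. f i x)"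
proof (induction I rule: infinite_finite_induct)
  case (insert i I)
  have "\<exists>a. ((\<lambda>x. f i x + (\<Sum>i\<in>I. f i x)) has_derivative pairing a) (at x)" if x: "x \<in> U" for x
  proof -
    have "holo_fun U (f i)" "holo_fun U (\<lambda>x. \<Sum>i\<in>I. f i x)" using insert by auto
    with x obtain a b where "(f i has_derivative pairing a) (at x)"
      "((\<lambda>x. \<Sum>i\<in>I. f i x) has_derivative pairing b) (at x)" unfolding holo_fun_def by blast
    from has_derivative_add[OF this] show ?thesis
      by (intro exI[of _ "a + b"]) (simp add: pairing_add_left[abs_def])
  qed
  then show ?case using insert.hyps by (simp add: holo_fun_def)
qed (use hom_poly_holo[OF hom_poly_0[of 0]] in auto)

definition exponents :: "'i set \<Rightarrow> nat \<Rightarrow> ('i \<Rightarrow> nat) set" where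
  "exponents J N = {\<alpha>. (\<forall>i. i \<notin> J \<longrightarrow> \<alpha> i = 0) \<and> sum \<alpha> J = N}"

lemma finite_exponents_on:
  assumes "finite J"
  shows "finite (exponents J N)"
proof (rule finite_subset)
  show "exponents J N \<subseteq> (\<lambda>\<beta> i. if i \<in> J then \<beta> i else 0) ` PiE J (\<lambda>_. {..N})"
  proof
    fix \<alpha> assume a: "\<alpha> \<in> exponents J N"
    then have "restrict \<alpha> J \<in> PiE J (\<lambda>_. {..N})"
      using assms by (auto simp: exponents_def intro!: member_le_sum)
    moreover have "\<alpha> = (\<lambda>i. if i \<in> J then restrict \<alpha> J i else 0)" using a by (auto simp: exponents_def)
    ultimately show "\<alpha> \<in> (\<lambda>\<beta> i. if i \<in> J then \<beta> i else 0) ` PiE J (\<lambda>_. {..N})" by blast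
  qed
qed (use assms in \<open>simp add: finite_PiE\<close>)

context projective_cone
begin

text \<open>
  Siegel's argument: \<open>D + 1\<close> forms of the same degree, with \<open>D\<close> the dimension of the cone, have about
  \<open>k ^ (D + 1)\<close> monomials of degree up to \<open>k\<close>, whereas a number of linear conditions of order
  \<open>k ^ D\<close> forces a combination of them to vanish on the cone.
\<close>

theorem forms_algebraically_dependent:
  fixes P :: "'i \<Rightarrow> complex^'n \<Rightarrow> complex"
  assumes J: "finite J" "card J = CARD('d option) + 1" and P: "\<And>i. i \<in> J \<Longrightarrow> P i \<in> hom_poly e" and e: "e > 0"
  shows "\<exists>N c. (\<exists>\<alpha>\<in>exponents J N. c \<alpha> \<noteq> 0) \<and>
    (\<forall>x\<in>M. (\<Sum>\<alpha>\<in>exponents J N. c \<alpha> * (\<Prod>i\<in>J. P i x ^ \<alpha> i)) = 0)"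
proof -
  obtain s where s: "\<And>m. \<exists>E. finite E \<and> card E \<le> s * m ^ CARD('d option) \<and>
      (\<forall>f g N. holo_fun UNIV f \<longrightarrow> (\<forall>x\<in>M. \<forall>t. f (t *s x) = (\<Sum>n<Suc N. g x n * t ^ n)) \<longrightarrow>
        (\<forall>x\<in>E. f x = 0) \<longrightarrow>
        real (Suc N) * 2 ^ N * (2 * (1 / 8) ^ m * (real m + 1) ^ (CARD('d option) + 1)) < 1 \<longrightarrow>
        (\<forall>x\<in>M. f x = 0))" using small_on_grid_imp_zero by blast
  define D where "D = CARD('d option)"
  \<comment> \<open>Monomials with exponents below \<open>k\<close> have degree at most \<open>b * k\<close>, which is also the number of nodes per coordinate.\<close>
  define b where "b = e * (D + 1)"
  have b: "b > 0" using e by (simp add: b_def)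
  have growth: "\<forall>\<^sub>F m in sequentially. 2 * (real m + 1) ^ (D + 2) * (1 / 4) ^ m < 1"
  proof -
    have "((\<lambda>x :: real. x ^ (D + 2) / exp x) \<longlongrightarrow> 0) at_top" by (rule tendsto_power_div_exp_0)
    moreover have "filterlim (\<lambda>m. real m + 1) at_top sequentially"
      using filterlim_compose[OF filterlim_real_sequentially filterlim_Suc] by (simp add: add.commute)
    ultimately have "((\<lambda>m. (real m + 1) ^ (D + 2) / exp (real m + 1)) \<longlongrightarrow> 0) sequentially"
      by (rule filterlim_compose)
    then have "\<forall>\<^sub>F m in sequentially. (real m + 1) ^ (D + 2) / exp (real m + 1) < 1 / 6"
      by (rule order_tendstoD) simp
    then show ?thesis
    proof eventually_elim
      case (elim m)
      have e3: "exp 1 \<le> (3 :: real)" by (rule exp_le)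
      have "exp (real m + 1) = exp 1 * exp 1 ^ m" by (simp add: exp_add exp_of_nat_mult[symmetric])
      also have "\<dots> \<le> 3 * 4 ^ m" using e3 by (intro mult_mono power_mono) auto
      finally have "(real m + 1) ^ (D + 2) / (3 * 4 ^ m) \<le> (real m + 1) ^ (D + 2) / exp (real m + 1)"
        by (intro divide_left_mono) auto
      with elim have "(real m + 1) ^ (D + 2) / (3 * 4 ^ m) < 1 / 6" by linarith
      then show ?case by (simp add: field_simps power_divide)
    qed
  qed
  have "filterlim (\<lambda>k. b * k) at_top sequentially"
    using b by (intro filterlim_subseq) (auto simp: strict_mono_def)
  from eventually_compose_filterlim[OF growth this]
  have "\<forall>\<^sub>F k in sequentially. 2 * (real (b * k) + 1) ^ (D + 2) * (1 / 4) ^ (b * k) < 1" .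
  moreover have "\<forall>\<^sub>F k in sequentially. k > s * b ^ D" by (rule eventually_gt_at_top)
  ultimately have "\<forall>\<^sub>F k in sequentially. 2 * (real (b * k) + 1) ^ (D + 2) * (1 / 4) ^ (b * k) < 1 \<and> k > s * b ^ D"
    by (rule eventually_conj)
  from eventually_happens'[OF sequentially_bot this] obtain k where k1: "2 * (real (b * k) + 1) ^ (D + 2) * (1 / 4) ^ (b * k) < 1"
    and k2: "k > s * b ^ D" by blast
  define m where "m = b * k"
  obtain E where E: "finite E" "card E \<le> s * m ^ D"
    "\<And>f g N. holo_fun UNIV f \<Longrightarrow> (\<forall>x\<in>M. \<forall>t. f (t *s x) = (\<Sum>n<Suc N. g x n * t ^ n)) \<Longrightarrow>
        (\<forall>x\<in>E. f x = 0) \<Longrightarrow>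
        real (Suc N) * 2 ^ N * (2 * (1 / 8) ^ m * (real m + 1) ^ (CARD('d option) + 1)) < 1 \<Longrightarrow>
        (\<forall>x\<in>M. f x = 0)" using s[of m] unfolding D_def by blast
  define A where "A = {\<alpha> :: 'i \<Rightarrow> nat. (\<forall>i. i \<notin> J \<longrightarrow> \<alpha> i = 0) \<and> (\<forall>i\<in>J. \<alpha> i < k)}"
  define mon where "mon \<alpha> x = (\<Prod>i\<in>J. P i x ^ \<alpha> i)" for \<alpha> :: "'i \<Rightarrow> nat" and x
  have bij: "bij_betw (\<lambda>\<beta> i. if i \<in> J then \<beta> i else 0) (PiE J (\<lambda>_. {..<k})) A"
  proof (rule bij_betw_byWitness[where f' = "\<lambda>\<alpha>. restrict \<alpha> J"])
    show "\<forall>\<beta>\<in>PiE J (\<lambda>_. {..<k}). restrict (\<lambda>i. if i \<in> J then \<beta> i else 0) J = \<beta>"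
      by (auto simp: PiE_def extensional_def restrict_def fun_eq_iff)
    show "\<forall>\<alpha>\<in>A. (\<lambda>i. if i \<in> J then restrict \<alpha> J i else 0) = \<alpha>"
      by (auto simp: A_def fun_eq_iff)
    show "(\<lambda>\<beta> i. if i \<in> J then \<beta> i else 0) ` PiE J (\<lambda>_. {..<k}) \<subseteq> A"
      by (auto simp: A_def PiE_def Pi_def)
    show "(\<lambda>\<alpha>. restrict \<alpha> J) ` A \<subseteq> PiE J (\<lambda>_. {..<k})" by (auto simp: A_def)
  qed
  have finA: "finite A" using bij_betw_finite[OF bij] J(1) by (simp add: finite_PiE)
  have "card A = k ^ (D + 1)" using bij_betw_same_card[OF bij] J by (simp add: card_PiE D_def)
  moreover have "s * m ^ D < k ^ (D + 1)"
  proof -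
    have "s * m ^ D = (s * b ^ D) * k ^ D" by (simp add: m_def power_mult_distrib)
    also have "\<dots> < k * k ^ D" using k2 by (intro mult_strict_right_mono) auto
    finally show ?thesis by simp
  qed
  ultimately have "card E < card A" using E(2) by simp
  from underdetermined_system[OF E(1) finA this, of mon] obtain c where
    c: "\<exists>\<alpha>\<in>A. c \<alpha> \<noteq> 0" "\<forall>x\<in>E. (\<Sum>\<alpha>\<in>A. c \<alpha> * mon \<alpha> x) = 0" by blast
  define f where "f x = (\<Sum>\<alpha>\<in>A. c \<alpha> * mon \<alpha> x)" for x
  define g where "g x n = (\<Sum>\<alpha> | \<alpha> \<in> A \<and> e * sum \<alpha> J = n. c \<alpha> * mon \<alpha> x)" for x n
  have monh: "mon \<alpha> \<in> hom_poly (e * sum \<alpha> J)" for \<alpha>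
  proof -
    have "mon \<alpha> \<in> hom_poly (\<Sum>i\<in>J. \<alpha> i * e)"
      unfolding mon_def[abs_def] by (intro hom_poly_prod hom_poly_power P)
    then show ?thesis by (simp add: sum_distrib_left mult.commute[of e])
  qed
  have deg: "e * sum \<alpha> J < Suc m" if "\<alpha> \<in> A" for \<alpha>
  proof -
    have "sum \<alpha> J \<le> (\<Sum>i\<in>J. k)" using that by (intro sum_mono) (auto simp: A_def intro: less_imp_le)
    then have "e * sum \<alpha> J \<le> e * ((D + 1) * k)" using J by (intro mult_le_mono2) (simp add: D_def)
    then show ?thesis unfolding m_def b_def by (simp only: mult.assoc less_Suc_eq_le)
  qed
  have fg: "f (t *s x) = (\<Sum>n<Suc m. g x n * t ^ n)" for t x
  proof -
    have "(\<Sum>n<Suc m. g x n * t ^ n) = (\<Sum>n<Suc m. \<Sum>\<alpha> | \<alpha> \<in> A \<and> e * sum \<alpha> J = n. c \<alpha> * mon \<alpha> (t *s x))"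
      unfolding g_def sum_distrib_right
      by (intro sum.cong refl) (auto simp: hom_poly_homogeneous[OF monh])
    also have "\<dots> = f (t *s x)" unfolding f_def
      using finA deg by (intro sum.group) auto
    finally show ?thesis by simp
  qed
  have f0: "\<forall>x\<in>M. f x = 0"
  proof (rule E(3))
    show "holo_fun UNIV f" unfolding f_def[abs_def]
      by (intro holo_fun_sum hom_poly_holo[OF hom_poly_scale[OF monh]])
    show "\<forall>x\<in>M. \<forall>t. f (t *s x) = (\<Sum>n<Suc m. g x n * t ^ n)" using fg by blast
    show "\<forall>x\<in>E. f x = 0" using c(2) by (simp add: f_def)
    have "real (Suc m) * 2 ^ m * (2 * (1 / 8) ^ m * (real m + 1) ^ (D + 1)) =
      2 * (real m + 1) ^ (D + 2) * (2 ^ m * (1 / 8) ^ m)" by (simp add: algebra_simps)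
    also have "2 ^ m * (1 / 8) ^ m = (1 / 4 :: real) ^ m" by (simp flip: power_mult_distrib)
    also have "2 * (real m + 1) ^ (D + 2) * (1 / 4) ^ m < 1" using k1 by (simp add: m_def)
    finally show "real (Suc m) * 2 ^ m * (2 * (1 / 8) ^ m * (real m + 1) ^ (CARD('d option) + 1)) < 1"
      by (simp add: D_def)
  qed
  have g0: "g x n = 0" if x: "x \<in> M" and n: "n < Suc m" for x n
  proof -
    have "norm (g x n) * 1 ^ n \<le> 0"
    proof (rule coefficient_bound_by_roots_of_unity[OF n, where a = "g x"])
      fix k :: nat
      let ?t = "of_real 1 * cis (2 * pi * real k / real (Suc m))"
      have "?t *s x \<in> M" using x by (intro M_cone) auto
      then have "f (?t *s x) = 0" using f0 by blast
      then show "norm (\<Sum>j<Suc m. g x j * ?t ^ j) \<le> 0" using fg by simp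
    qed simp
    then show ?thesis by simp
  qed
  obtain \<alpha>0 where a0: "\<alpha>0 \<in> A" "c \<alpha>0 \<noteq> 0" using c(1) by blast
  define N where "N = sum \<alpha>0 J"
  define c' where "c' \<alpha> = (if \<alpha> \<in> A then c \<alpha> else 0)" for \<alpha>
  have "\<alpha>0 \<in> exponents J N" using a0(1) by (auto simp: exponents_def A_def N_def)
  then have "\<exists>\<alpha>\<in>exponents J N. c' \<alpha> \<noteq> 0" using a0 by (auto simp: c'_def)
  moreover have "(\<Sum>\<alpha>\<in>exponents J N. c' \<alpha> * (\<Prod>i\<in>J. P i x ^ \<alpha> i)) = 0" if x: "x \<in> M" for x
  proof -
    have "(\<Sum>\<alpha>\<in>exponents J N. c' \<alpha> * (\<Prod>i\<in>J. P i x ^ \<alpha> i)) = g x (e * N)"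
      unfolding g_def mon_def c'_def using e
      by (intro sum.mono_neutral_cong_right finite_exponents_on J) (auto simp: exponents_def A_def)
    also have "\<dots> = 0" using x deg[OF a0(1)] by (intro g0) (auto simp: N_def)
    finally show ?thesis .
  qed
  ultimately show ?thesis by blast
qed

end

section \<open>Integral curves\<close>

lemma primitive_on_ball:
  assumes "g holomorphic_on ball (0 :: complex) r" "r > 0"
  shows "\<exists>G. (\<forall>t\<in>ball 0 r. (G has_field_derivative g t) (at t)) \<and> G 0 = 0"
proof -
  obtain G where G: "\<And>t. t \<in> ball 0 r \<Longrightarrow> (G has_field_derivative g t) (at t within ball 0 r)"
    using holomorphic_convex_primitive'[OF convex_ball open_ball assms(1)] by blast
  have "((\<lambda>t. G t - G 0) has_field_derivative g t) (at t)" if "t \<in> ball 0 r" for t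
    using G[OF that] that by (auto intro!: derivative_eq_intros simp: at_within_open[OF _ open_ball])
  then show ?thesis by (intro exI[of _ "\<lambda>t. G t - G 0"]) auto
qed

lemma norm_le_CARD_mult:
  fixes x :: "complex^'n" and c :: real
  assumes "\<And>i. norm (x $ i) \<le> c"
  shows "norm x \<le> CARD('n) * c"
proof -
  have "norm x \<le> (\<Sum>i\<in>UNIV. norm (x $ i))" unfolding norm_vec_def by (rule L2_set_le_sum) simp
  also have "\<dots> \<le> (\<Sum>i\<in>(UNIV :: 'n set). c)" using assms by (intro sum_mono)
  finally show ?thesis by simp
qed

text \<open>Picard iteration on a disc so small that the integral operator contracts by one half.\<close>

theorem holomorphic_integral_curve:
  fixes v :: "complex^'n \<Rightarrow> complex^'n"
  assumes R: "R > 0"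
    and holo: "\<And>x i. x \<in> cball p R \<Longrightarrow> \<exists>a. ((\<lambda>x. v x $ i) has_derivative pairing a) (at x)"
    and Lip: "\<And>x y i. x \<in> cball p R \<Longrightarrow> y \<in> cball p R \<Longrightarrow> norm (v x $ i - v y $ i) \<le> K * norm (x - y)"
    and bd: "norm (v p) \<le> K"
  obtains r \<gamma> where "r > 0" "\<gamma> 0 = p"
    "\<And>t. t \<in> ball 0 r \<Longrightarrow> \<gamma> t \<in> cball p R \<and> has_velocity \<gamma> (v (\<gamma> t)) t"
proof -
  have K: "K \<ge> 0" using bd norm_ge_zero order_trans by blast
  define n where "n = real CARD('n)"
  have n: "n > 0" by (simp add: n_def)
  \<comment> \<open>By this choice the iterates stay in the ball of radius \<open>R\<close>, and consecutive differences are halved.\<close>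
  define r where "r = min 1 R / (2 * n * (K + 1))"
  have r: "r > 0" using R n K by (simp add: r_def)
  have rK: "n * (K * r) \<le> min 1 R / 2"
  proof -
    have "n * (K * r) = (min 1 R / 2) * (K / (K + 1))" using n by (simp add: r_def)
    also have "\<dots> \<le> (min 1 R / 2) * 1" using R K by (intro mult_left_mono) auto
    finally show ?thesis by simp
  qed
  define prim where "prim g = (SOME G. (\<forall>t\<in>ball 0 r. (G has_field_derivative g t) (at t)) \<and> G 0 = (0 :: complex))"
    for g :: "complex \<Rightarrow> complex"
  have prim: "(\<forall>t\<in>ball 0 r. (prim g has_field_derivative g t) (at t)) \<and> prim g 0 = 0"
    if "g holomorphic_on ball 0 r" for g
    unfolding prim_def by (rule someI_ex[OF primitive_on_ball[OF that r]])
  define \<gamma> where "\<gamma> = rec_nat (\<lambda>_. p) (\<lambda>_ \<gamma> t. \<chi> i. p $ i + prim (\<lambda>s. v (\<gamma> s) $ i) t)"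
  have \<gamma>0: "\<gamma> 0 = (\<lambda>_. p)" and \<gamma>S: "\<gamma> (Suc k) = (\<lambda>t. \<chi> i. p $ i + prim (\<lambda>s. v (\<gamma> k s) $ i) t)" for k
    by (simp_all add: \<gamma>_def)
  define good where "good k \<longleftrightarrow> (\<forall>t\<in>ball 0 r. (\<exists>w. has_velocity (\<gamma> k) w t) \<and>
    norm (\<gamma> k t - p) \<le> R * (1 - (1 / 2) ^ k))" for k
  have good_cball: "\<gamma> k t \<in> cball p R" if "good k" "t \<in> ball 0 r" for k t
  proof -
    have "norm (\<gamma> k t - p) \<le> R * (1 - (1 / 2) ^ k)" using that by (simp add: good_def)
    also have "\<dots> \<le> R * 1" using R by (intro mult_left_mono) auto
    finally show ?thesis by (simp add: dist_norm norm_minus_commute)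
  qed
  have holo_v: "(\<lambda>s. v (\<gamma> k s) $ i) holomorphic_on ball 0 r" if gk: "good k" for k i
    unfolding holomorphic_on_def
  proof
    fix t :: complex assume t: "t \<in> ball 0 r"
    obtain w where w: "has_velocity (\<gamma> k) w t" using gk t unfolding good_def by blast
    obtain a where "((\<lambda>x. v x $ i) has_derivative pairing a) (at (\<gamma> k t))"
      using holo good_cball[OF gk t] by blast
    from has_field_derivative_along_curve[OF this w]
    show "(\<lambda>s. v (\<gamma> k s) $ i) field_differentiable at t within ball 0 r"
      by (auto simp: field_differentiable_def intro: DERIV_subset)
  qed
  have vel: "has_velocity (\<gamma> (Suc k)) (v (\<gamma> k t)) t" if "good k" "t \<in> ball 0 r" for k t
    unfolding has_velocity_def
  proof
    fix i
    have "(prim (\<lambda>s. v (\<gamma> k s) $ i) has_field_derivative v (\<gamma> k t) $ i) (at t)"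
      using prim[OF holo_v[OF that(1)]] that(2) by blast
    then show "((\<lambda>s. \<gamma> (Suc k) s $ i) has_field_derivative v (\<gamma> k t) $ i) (at t)"
      unfolding \<gamma>S by (auto intro!: derivative_eq_intros)
  qed
  have start: "\<gamma> (Suc k) 0 = p" if "good k" for k
    unfolding \<gamma>S using prim[OF holo_v[OF that]] by (simp add: vec_eq_iff)
  have bound: "norm (f t $ i) \<le> c * r"
    if "\<And>t. t \<in> ball 0 r \<Longrightarrow> has_velocity f (f' t) t" "f 0 = 0" "\<And>t. t \<in> ball 0 r \<Longrightarrow> norm (f' t $ i) \<le> c"
      "t \<in> ball 0 r" "c \<ge> 0" for f f' :: "complex \<Rightarrow> complex^'n" and c i t
  proof -
    have "norm (f t $ i - f 0 $ i) \<le> c * norm (t - 0)"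
    proof (rule field_differentiable_bound[OF convex_ball[of 0 r]])
      show "((\<lambda>t. f t $ i) has_field_derivative f' z $ i) (at z within ball 0 r)" if "z \<in> ball 0 r" for z
        using \<open>\<And>t. t \<in> ball 0 r \<Longrightarrow> has_velocity f (f' t) t\<close>[OF that]
        by (auto simp: has_velocity_def intro: DERIV_subset)
    qed (use that r in auto)
    also have "\<dots> \<le> c * r" using that by (intro mult_left_mono) auto
    finally show ?thesis using that(2) by simp
  qed
  have step: "good k \<and> (\<forall>t\<in>ball 0 r. norm (\<gamma> (Suc k) t - \<gamma> k t) \<le> R * (1 / 2) ^ Suc k)" for k
  proof (induction k)
    case 0
    have g0: "good 0"
      unfolding good_def \<gamma>0 by (auto simp: has_velocity_def intro!: exI[of _ 0])
    have "norm (\<gamma> (Suc 0) t - p) \<le> R * (1 / 2)" if t: "t \<in> ball 0 r" for t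
    proof -
      have "norm ((\<gamma> (Suc 0) t - p) $ i) \<le> K * r" for i
      proof (rule bound[where f' = "\<lambda>t. v p" and f = "\<lambda>t. \<gamma> (Suc 0) t - p"])
        show "has_velocity (\<lambda>t. \<gamma> (Suc 0) t - p) (v p) t" if "t \<in> ball 0 r" for t
          using vel[OF g0 that] unfolding has_velocity_def \<gamma>0 by (auto intro!: derivative_eq_intros)
        show "norm (v p $ i) \<le> K" using bd Finite_Cartesian_Product.norm_nth_le order_trans by blast
      qed (use start[OF g0] t K in auto)
      then have "norm (\<gamma> (Suc 0) t - p) \<le> n * (K * r)" unfolding n_def by (rule norm_le_CARD_mult)
      also have "\<dots> \<le> R * (1 / 2)" using rK by simp
      finally show ?thesis .
    qed
    then show ?case using g0 by (simp add: \<gamma>0)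
  next
    case (Suc k)
    then have gk: "good k" and dk: "\<And>t. t \<in> ball 0 r \<Longrightarrow> norm (\<gamma> (Suc k) t - \<gamma> k t) \<le> R * (1 / 2) ^ Suc k" by auto
    have gS: "good (Suc k)"
      unfolding good_def
    proof (intro ballI conjI)
      fix t :: complex assume t: "t \<in> ball 0 r"
      show "\<exists>w. has_velocity (\<gamma> (Suc k)) w t" using vel[OF gk t] by blast
      have "norm (\<gamma> (Suc k) t - p) \<le> norm (\<gamma> (Suc k) t - \<gamma> k t) + norm (\<gamma> k t - p)"
        using norm_triangle_ineq[of "\<gamma> (Suc k) t - \<gamma> k t" "\<gamma> k t - p"] by simp
      also have "\<dots> \<le> R * (1 / 2) ^ Suc k + R * (1 - (1 / 2) ^ k)"
        using dk[OF t] gk t by (intro add_mono) (auto simp: good_def)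
      also have "\<dots> = R * (1 - (1 / 2) ^ Suc k)" by (simp add: algebra_simps)
      finally show "norm (\<gamma> (Suc k) t - p) \<le> R * (1 - (1 / 2) ^ Suc k)" .
    qed
    have "norm (\<gamma> (Suc (Suc k)) t - \<gamma> (Suc k) t) \<le> R * (1 / 2) ^ Suc (Suc k)" if t: "t \<in> ball 0 r" for t
    proof -
      define c where "c = K * (R * (1 / 2) ^ Suc k)"
      have "norm ((\<gamma> (Suc (Suc k)) t - \<gamma> (Suc k) t) $ i) \<le> c * r" for i
      proof (rule bound[where f' = "\<lambda>t. v (\<gamma> (Suc k) t) - v (\<gamma> k t)"
            and f = "\<lambda>t. \<gamma> (Suc (Suc k)) t - \<gamma> (Suc k) t"])
        show "has_velocity (\<lambda>t. \<gamma> (Suc (Suc k)) t - \<gamma> (Suc k) t) (v (\<gamma> (Suc k) t) - v (\<gamma> k t)) t"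
          if "t \<in> ball 0 r" for t
          using vel[OF gS that] vel[OF gk that] unfolding has_velocity_def
          by (auto intro!: derivative_eq_intros)
        show "norm ((v (\<gamma> (Suc k) t) - v (\<gamma> k t)) $ i) \<le> c" if t: "t \<in> ball 0 r" for t
        proof -
          have "norm (v (\<gamma> (Suc k) t) $ i - v (\<gamma> k t) $ i) \<le> K * norm (\<gamma> (Suc k) t - \<gamma> k t)"
            using Lip good_cball[OF gS t] good_cball[OF gk t] by blast
          also have "\<dots> \<le> c" unfolding c_def using dk[OF t] K by (rule mult_left_mono)
          finally show ?thesis by simp
        qed
        show "c \<ge> 0" using K R by (simp add: c_def)
      qed (use start[OF gS] start[OF gk] t in auto)
      then have "norm (\<gamma> (Suc (Suc k)) t - \<gamma> (Suc k) t) \<le> n * (c * r)" unfolding n_def by (rule norm_le_CARD_mult)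
      also have "\<dots> = (n * (K * r)) * (R * (1 / 2) ^ Suc k)" by (simp add: c_def mult_ac)
      also have "\<dots> \<le> (1 / 2) * (R * (1 / 2) ^ Suc k)" using rK R by (intro mult_right_mono) auto
      also have "\<dots> = R * (1 / 2) ^ Suc (Suc k)" by simp
      finally show ?thesis .
    qed
    with gS show ?case by blast
  qed
  define \<delta> where "\<delta> t = p + (\<Sum>k. \<gamma> (Suc k) t - \<gamma> k t)" for t
  have ul: "uniform_limit (ball 0 r) \<gamma> \<delta> sequentially"
  proof -
    have e: "(\<Sum>k<m. \<gamma> (Suc k) t - \<gamma> k t) = \<gamma> m t - \<gamma> 0 t" for m t
      using sum_lessThan_telescope[of "\<lambda>k. \<gamma> k t" m] .
    have "uniform_limit (ball 0 r) (\<lambda>m t. \<Sum>k<m. \<gamma> (Suc k) t - \<gamma> k t) (\<lambda>t. \<Sum>k. \<gamma> (Suc k) t - \<gamma> k t) sequentially"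
    proof (rule Weierstrass_m_test[where M = "\<lambda>k. R * (1 / 2) ^ Suc k"])
      show "summable (\<lambda>k. R * (1 / 2) ^ Suc k)"
        by (intro summable_mult) (subst summable_Suc_iff, rule summable_geometric, simp)
    qed (use step in blast)
    then have "uniform_limit (ball 0 r) (\<lambda>m t. \<gamma> m t - \<gamma> 0 t) (\<lambda>t. \<Sum>k. \<gamma> (Suc k) t - \<gamma> k t) sequentially"
      by (simp only: e)
    then have "uniform_limit (ball 0 r) (\<lambda>m t. p + (\<gamma> m t - \<gamma> 0 t))
        (\<lambda>t. p + (\<Sum>k. \<gamma> (Suc k) t - \<gamma> k t)) sequentially"
      by (intro uniform_limit_add uniform_limit_const)
    then show ?thesis by (simp add: \<delta>_def[abs_def] \<gamma>0)
  qed
  have lim: "(\<lambda>k. \<gamma> k t) \<longlonglongrightarrow> \<delta> t" if "t \<in> ball 0 r" for t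
    using tendsto_uniform_limitI[OF ul that] .
  have \<delta>cball: "\<delta> t \<in> cball p R" if t: "t \<in> ball 0 r" for t
    by (rule closed_sequentially[OF closed_cball _ lim[OF t]]) (use good_cball step t in blast)
  show thesis
  proof (rule that[OF r, of \<delta>])
    have "\<gamma> k 0 = p" for k using start step by (cases k) (auto simp: \<gamma>0)
    then show "\<delta> 0 = p" by (simp add: \<delta>_def)
    fix t :: complex assume t: "t \<in> ball 0 r"
    have "((\<lambda>s. \<delta> s $ i) has_field_derivative v (\<delta> t) $ i) (at t)" for i
    proof -
      have uli: "uniform_limit (ball 0 r) (\<lambda>k s. \<gamma> (Suc k) s $ i) (\<lambda>s. \<delta> s $ i) sequentially"
        using bounded_linear.uniform_limit[OF bounded_linear_vec_nth ul, of i]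
        by (rule filterlim_compose[OF _ filterlim_Suc])
      have "\<exists>g'. \<forall>x\<in>ball 0 r. ((\<lambda>s. \<delta> s $ i) has_field_derivative g' x) (at x) \<and>
          ((\<lambda>k. v (\<gamma> k x) $ i) \<longlongrightarrow> g' x) sequentially"
      proof (rule has_complex_derivative_uniform_sequence[OF open_ball, where f = "\<lambda>k s. \<gamma> (Suc k) s $ i"])
        show "((\<lambda>s. \<gamma> (Suc k) s $ i) has_field_derivative v (\<gamma> k x) $ i) (at x)" if "x \<in> ball 0 r" for k x
          using vel[of k x] step that by (simp add: has_velocity_def)
        show "\<exists>d>0. cball x d \<subseteq> ball 0 r \<and>
          uniform_limit (cball x d) (\<lambda>k s. \<gamma> (Suc k) s $ i) (\<lambda>s. \<delta> s $ i) sequentially"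
          if x: "x \<in> ball 0 r" for x
        proof -
          obtain d where "d > 0" "cball x d \<subseteq> ball 0 r"
            by (meson open_ball open_contains_cball x)
          then show ?thesis using uniform_limit_on_subset[OF uli] by blast
        qed
      qed
      then obtain D where D: "((\<lambda>s. \<delta> s $ i) has_field_derivative D) (at t)"
        "(\<lambda>k. v (\<gamma> k t) $ i) \<longlonglongrightarrow> D" using t by blast
      have "isCont (\<lambda>x. v x $ i) (\<delta> t)" using holo[OF \<delta>cball[OF t]] has_derivative_continuous by blast
      then have "(\<lambda>k. v (\<gamma> k t) $ i) \<longlonglongrightarrow> v (\<delta> t) $ i"
        using lim[OF t] by (rule isCont_tendsto_compose)
      then show ?thesis using D LIMSEQ_unique by blast
    qed
    then show "\<delta> t \<in> cball p R \<and> has_velocity \<delta> (v (\<delta> t)) t"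
      using \<delta>cball[OF t] by (simp add: has_velocity_def)
  qed
qed

text \<open>
  The derivative is continuous, hence bounded on a compact ball; this gives the Lipschitz bound for the
  Picard iteration.
\<close>

lemma norm_pairing_le: "norm (pairing a v) \<le> (\<Sum>i\<in>UNIV. norm (a $ i)) * norm v"
proof -
  have "norm (pairing a v) \<le> (\<Sum>i\<in>UNIV. norm (a $ i * v $ i))"
    unfolding pairing_def by (rule norm_sum)
  also have "\<dots> \<le> (\<Sum>i\<in>UNIV. norm (a $ i) * norm v)"
    by (intro sum_mono) (simp add: norm_mult mult_left_mono Finite_Cartesian_Product.norm_nth_le)
  finally show ?thesis by (simp add: sum_distrib_right)
qed

lemma rational_Lipschitz:
  assumes P: "P \<in> hom_poly j" and Q: "Q \<in> hom_poly k" and nz: "\<And>x. x \<in> cball p R \<Longrightarrow> Q x \<noteq> 0"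
  shows "\<exists>K. \<forall>x\<in>cball p R. (\<exists>a. ((\<lambda>x. P x / Q x) has_derivative pairing a) (at x)) \<and>
    (\<forall>y\<in>cball p R. norm (P x / Q x - P y / Q y) \<le> K * norm (x - y))"
proof -
  obtain G H where "is_gradient j P G" "is_gradient k Q H" using hom_poly_gradient P Q by metis
  note G = is_gradientD[OF this(1)] and H = is_gradientD[OF this(2)]
  define E where "E x = inverse (Q x) *s G x + (- (P x) * inverse (Q x) ^ 2) *s H x" for x
  have Ei: "E x $ i = inverse (Q x) * G x $ i + (- (P x) * inverse (Q x) ^ 2) * H x $ i" for x i
    by (simp add: E_def)
  have dE: "((\<lambda>x. P x / Q x) has_derivative pairing (E x)) (at x)" if "x \<in> cball p R" for x
    by (rule has_derivative_eq_rhs[OF has_derivative_divide[OF G(1) H(1) nz[OF that]]])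
      (auto simp: fun_eq_iff E_def pairing_add_left pairing_diff_left pairing_smult_left field_simps power2_eq_square)
  have cont: "continuous_on (cball p R) F" if "F \<in> hom_poly l" for F :: "complex^'a \<Rightarrow> complex" and l
    using holo_fun_continuous[OF hom_poly_holo[OF that, of UNIV]]
    by (simp add: continuous_at_imp_continuous_on)
  have "continuous_on (cball p R) (\<lambda>x. \<Sum>i\<in>UNIV. norm (E x $ i))"
    unfolding Ei
    by (intro continuous_on_sum continuous_on_norm continuous_on_add continuous_on_mult
        continuous_on_minus continuous_on_power continuous_on_inverse
        cont[OF P] cont[OF Q] cont[OF G(2)] cont[OF H(2)]) (use nz in auto)
  then obtain K where K: "\<And>x. x \<in> cball p R \<Longrightarrow> (\<Sum>i\<in>UNIV. norm (E x $ i)) \<le> K"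
  proof -
    assume a: "continuous_on (cball p R) (\<lambda>x. \<Sum>i\<in>UNIV. norm (E x $ i))"
      and t: "\<And>K. (\<And>x. x \<in> cball p R \<Longrightarrow> (\<Sum>i\<in>UNIV. norm (E x $ i)) \<le> K) \<Longrightarrow> thesis"
    have "bounded ((\<lambda>x. \<Sum>i\<in>UNIV. norm (E x $ i)) ` cball p R)"
      by (intro compact_imp_bounded compact_continuous_image a compact_cball)
    then obtain K where "\<forall>x\<in>cball p R. norm (\<Sum>i\<in>UNIV. norm (E x $ i)) \<le> K"
      unfolding bounded_iff by auto
    then show thesis by (intro t[of K]) fastforce
  qed
  have "norm (P x / Q x - P y / Q y) \<le> K * norm (x - y)" if "x \<in> cball p R" "y \<in> cball p R" for x y
  proof (rule differentiable_bound[OF convex_cball])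
    show "((\<lambda>x. P x / Q x) has_derivative pairing (E z)) (at z within cball p R)" if "z \<in> cball p R" for z
      using dE[OF that] by (rule has_derivative_at_withinI)
    show "onorm (pairing (E z)) \<le> K" if z: "z \<in> cball p R" for z
    proof (rule onorm_le)
      show "norm (pairing (E z) v) \<le> K * norm v" for v
        using norm_pairing_le[of "E z" v] mult_right_mono[OF K[OF z] norm_ge_zero[of v]] by linarith
    qed
  qed (use that in auto)
  with dE show ?thesis by blast
qed

lemma rational_integral_curve:
  fixes A :: "complex^'n \<Rightarrow> complex^'n"
  assumes A: "\<And>i. (\<lambda>x. A x $ i) \<in> hom_poly j" and B: "B \<in> hom_poly k" and p: "p \<noteq> 0" "B p \<noteq> 0"
  obtains r \<gamma> where "r > 0" "\<gamma> 0 = p"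
    "\<And>t. t \<in> ball 0 r \<Longrightarrow> \<gamma> t \<noteq> 0 \<and> B (\<gamma> t) \<noteq> 0 \<and> has_velocity \<gamma> (inverse (B (\<gamma> t)) *s A (\<gamma> t)) t"
proof -
  have "continuous_on UNIV B" using holo_fun_continuous[OF hom_poly_holo[OF B, of UNIV]]
    by (simp add: continuous_at_imp_continuous_on)
  then have "open {x. x \<noteq> 0 \<and> B x \<noteq> 0}"
    by (intro open_Collect_conj open_Collect_neq continuous_on_const continuous_on_id)
  then obtain R where R: "R > 0" "cball p R \<subseteq> {x. x \<noteq> 0 \<and> B x \<noteq> 0}"
    using p open_contains_cball_eq by blast
  then have nz: "x \<noteq> 0" "B x \<noteq> 0" if "x \<in> cball p R" for x using R(2) that by blast+
  define v where "v x = inverse (B x) *s A x" for x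
  have vi: "v x $ i = A x $ i / B x" for x i by (simp add: v_def divide_inverse mult.commute)
  have "\<exists>K. \<forall>x\<in>cball p R. (\<exists>a. ((\<lambda>x. v x $ i) has_derivative pairing a) (at x)) \<and>
    (\<forall>y\<in>cball p R. norm (v x $ i - v y $ i) \<le> K * norm (x - y))" for i
    unfolding vi by (rule rational_Lipschitz[OF A B nz(2)])
  then obtain K where K: "\<And>i x. x \<in> cball p R \<Longrightarrow> \<exists>a. ((\<lambda>x. v x $ i) has_derivative pairing a) (at x)"
    "\<And>i x y. x \<in> cball p R \<Longrightarrow> y \<in> cball p R \<Longrightarrow> norm (v x $ i - v y $ i) \<le> K i * norm (x - y)" by metis
  define K' where "K' = (\<Sum>i\<in>UNIV. \<bar>K i\<bar>) + norm (v p)"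
  have Lip: "norm (v x $ i - v y $ i) \<le> K' * norm (x - y)" if "x \<in> cball p R" "y \<in> cball p R" for x y i
  proof -
    have "K i \<le> \<bar>K i\<bar>" by simp
    also have "\<dots> \<le> (\<Sum>i\<in>UNIV. \<bar>K i\<bar>)" by (rule member_le_sum) auto
    finally have "K i \<le> K'" by (simp add: K'_def add_increasing2)
    then show ?thesis using K(2)[OF that, of i] mult_right_mono[OF \<open>K i \<le> K'\<close> norm_ge_zero[of "x - y"]] by linarith
  qed
  have bd: "norm (v p) \<le> K'" by (simp add: K'_def sum_nonneg)
  show thesis
  proof (rule holomorphic_integral_curve[where v = v and K = K' and p = p and R = R, OF R(1) K(1) Lip bd])
    fix r \<gamma>
    assume r: "r > 0" "\<gamma> 0 = p"
      and \<gamma>: "\<And>t. t \<in> ball 0 r \<Longrightarrow> \<gamma> t \<in> cball p R \<and> has_velocity \<gamma> (v (\<gamma> t)) t"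
    show thesis
    proof (rule that[of r \<gamma>, OF r])
      fix t :: complex assume "t \<in> ball 0 r"
      from \<gamma>[OF this] nz[of "\<gamma> t"]
      show "\<gamma> t \<noteq> 0 \<and> B (\<gamma> t) \<noteq> 0 \<and> has_velocity \<gamma> (inverse (B (\<gamma> t)) *s A (\<gamma> t)) t"
        unfolding v_def by blast
    qed
  qed
qed

text \<open>
  Induction on the order shows that all derivatives at the origin vanish, for all functions at the same
  time: by the product rule, a derivative of one function is a combination of derivatives of lower order of
  the next.
\<close>

lemma zero_by_jets:
  fixes f :: "nat \<Rightarrow> complex \<Rightarrow> complex"
  assumes b: "b holomorphic_on ball 0 r"
    and f: "\<And>j t. t \<in> ball 0 r \<Longrightarrow> (f j has_field_derivative b t * f (Suc j) t) (at t)"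
    and 0: "\<And>j. f j 0 = 0" and t: "t \<in> ball 0 r"
  shows "f j t = 0"
proof -
  have r: "0 \<in> ball 0 r" using t by (simp add: le_less_trans[OF norm_ge_zero])
  have holo: "f j holomorphic_on ball 0 r" for j
    unfolding holomorphic_on_open[OF open_ball] using f by blast
  have "\<forall>j. (deriv ^^ n) (f j) 0 = 0" for n
  proof (induction n rule: less_induct)
    case (less n)
    show ?case
    proof (cases n)
      case 0
      then show ?thesis using assms(3) by simp
    next
      case (Suc m)
      have "(deriv ^^ n) (f j) 0 = 0" for j
      proof -
        have "(deriv ^^ n) (f j) 0 = (deriv ^^ m) (deriv (f j)) 0"
          unfolding Suc by (simp only: funpow_Suc_right o_apply)
        also have "\<dots> = (deriv ^^ m) (\<lambda>t. b t * f (Suc j) t) 0"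
        proof (rule higher_deriv_transform_within_open[OF _ _ open_ball r])
          show "deriv (f j) holomorphic_on ball 0 r" using holo by (simp add: holomorphic_deriv)
          show "(\<lambda>t. b t * f (Suc j) t) holomorphic_on ball 0 r" using b holo by (rule holomorphic_on_mult)
          show "deriv (f j) w = b w * f (Suc j) w" if "w \<in> ball 0 r" for w
            using f[OF that] by (rule DERIV_imp_deriv)
        qed
        also have "\<dots> = (\<Sum>i = 0..m. of_nat (m choose i) * (deriv ^^ i) b 0 * (deriv ^^ (m - i)) (f (Suc j)) 0)"
          by (rule higher_deriv_mult[OF b holo open_ball r])
        also have "\<dots> = 0" using less Suc by (intro sum.neutral) auto
        finally show ?thesis .
      qed
      then show ?thesis by blast
    qed
  qed
  then show ?thesis using holomorphic_fun_eq_0_on_ball[OF holo t] by blast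
qed

text \<open>
  Tangency in the algebraic sense: the derivation of the polynomial ring given by the field preserves the
  ideal of the cone.
\<close>

definition tangent_to_ideal :: "(complex^'n) set \<Rightarrow> (complex^'n \<Rightarrow> complex^'n) \<Rightarrow> bool" where
  "tangent_to_ideal M A \<longleftrightarrow>
     (\<forall>F k. F \<in> hom_poly k \<longrightarrow> (\<forall>x\<in>M. F x = 0) \<longrightarrow> (\<forall>x\<in>M. lie_derivative A F x = 0))"

context projective_cone
begin

text \<open>
  All iterated derivatives of an equation of the cone along the curve vanish at the starting point, so
  that the curve stays in the cone.
\<close>

lemma integral_curve_in_cone:
  assumes A: "\<And>i. (\<lambda>x. A x $ i) \<in> hom_poly (Suc k)" and B: "B \<in> hom_poly k"
    and tan: "tangent_to_ideal M A" and p: "p \<in> M" "B p \<noteq> 0"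
  obtains r \<gamma> where "r > 0" "\<gamma> 0 = p"
    "\<And>t. t \<in> ball 0 r \<Longrightarrow> \<gamma> t \<in> M \<and> B (\<gamma> t) \<noteq> 0 \<and> has_velocity \<gamma> (inverse (B (\<gamma> t)) *s A (\<gamma> t)) t"
proof -
  obtain r \<gamma> where r: "r > 0" and \<gamma>0: "\<gamma> 0 = p"
    and \<gamma>: "\<And>t. t \<in> ball 0 r \<Longrightarrow> \<gamma> t \<noteq> 0 \<and> B (\<gamma> t) \<noteq> 0 \<and> has_velocity \<gamma> (inverse (B (\<gamma> t)) *s A (\<gamma> t)) t"
    using rational_integral_curve[OF A B M_nonzero[OF p(1)] p(2)] by metis
  obtain S where S: "\<And>F. F \<in> S \<Longrightarrow> \<exists>k. F \<in> hom_poly k" "M = {x. x \<noteq> 0 \<and> (\<forall>F\<in>S. F x = 0)}"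
    using M_equations by blast
  have along: "((\<lambda>s. F (\<gamma> s)) has_field_derivative inverse (B (\<gamma> t)) * lie_derivative A F (\<gamma> t)) (at t)"
    if F: "F \<in> hom_poly m" and t: "t \<in> ball 0 r" for F m t
  proof -
    obtain a where a: "(F has_derivative pairing a) (at (\<gamma> t))" "\<And>A. lie_derivative A F (\<gamma> t) = pairing a (A (\<gamma> t))"
      using hom_poly_has_derivative[OF F] by metis
    have "has_velocity \<gamma> (inverse (B (\<gamma> t)) *s A (\<gamma> t)) t" using \<gamma>[OF t] by blast
    from has_field_derivative_along_curve[where \<gamma> = \<gamma>, OF a(1) this] show ?thesis by (simp add: a(2))
  qed
  have "F (\<gamma> t) = 0" if FS: "F \<in> S" and t: "t \<in> ball 0 r" for F t
  proof -
    obtain m where F: "F \<in> hom_poly m" using S(1) FS by blast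
    have F0: "\<forall>x\<in>M. F x = 0" using S(2) FS by blast
    define L where "L j = (lie_derivative A ^^ j) F" for j
    have L: "(\<exists>m. L j \<in> hom_poly m) \<and> (\<forall>x\<in>M. L j x = 0)" for j
    proof (induction j)
      case 0
      then show ?case using F F0 by (auto simp: L_def)
    next
      case (Suc j)
      have e: "L (Suc j) = lie_derivative A (L j)" by (simp add: L_def)
      from Suc obtain m where m: "L j \<in> hom_poly m" by blast
      have "L (Suc j) \<in> hom_poly (k + m)" unfolding e by (rule lie_hom_poly[OF m A])
      moreover have "\<forall>x\<in>M. L (Suc j) x = 0"
        unfolding e using tan Suc m unfolding tangent_to_ideal_def by blast
      ultimately show ?case by blast
    qed
    have "L 0 (\<gamma> t) = 0"
    proof (rule zero_by_jets[where b = "\<lambda>t. inverse (B (\<gamma> t))" and f = "\<lambda>j t. L j (\<gamma> t)", OF _ _ _ t])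
      have "(\<lambda>t. B (\<gamma> t)) holomorphic_on ball 0 r"
        unfolding holomorphic_on_open[OF open_ball] using along[OF B] by blast
      then show "(\<lambda>t. inverse (B (\<gamma> t))) holomorphic_on ball 0 r"
        using \<gamma> by (intro holomorphic_on_inverse) auto
      show "((\<lambda>t. L j (\<gamma> t)) has_field_derivative inverse (B (\<gamma> t)) * L (Suc j) (\<gamma> t)) (at t)"
        if "t \<in> ball 0 r" for j t
      proof -
        have e: "L (Suc j) = lie_derivative A (L j)" by (simp add: L_def)
        obtain m where m: "L j \<in> hom_poly m" using L by blast
        show ?thesis unfolding e by (rule along[OF m that])
      qed
      show "L j (\<gamma> 0) = 0" for j using L p \<gamma>0 by simp
    qed
    then show ?thesis by (simp add: L_def)
  qed
  then have "\<gamma> t \<in> M" if "t \<in> ball 0 r" for t using \<gamma>[OF that] that unfolding S(2) by blast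
  with that r \<gamma>0 \<gamma> show thesis by blast
qed

lemma tangent_space_lie:
  assumes "A x \<in> tangent_space M x" "F \<in> hom_poly k" "\<And>x. x \<in> M \<Longrightarrow> F x = 0"
  shows "lie_derivative A F x = 0"
proof -
  obtain \<gamma> r where \<gamma>: "r > 0" "\<gamma> ` ball 0 r \<subseteq> M" "\<gamma> 0 = x" "has_velocity \<gamma> (A x) 0"
    using assms(1) unfolding tangent_space_def by blast
  obtain a where a: "(F has_derivative pairing a) (at (\<gamma> 0))" "\<And>A. lie_derivative A F (\<gamma> 0) = pairing a (A (\<gamma> 0))"
    using hom_poly_has_derivative[OF assms(2)] by metis
  have "((\<lambda>s. F (\<gamma> s)) has_field_derivative pairing a (A x)) (at 0)"
    by (rule has_field_derivative_along_curve[OF a(1) \<gamma>(4)])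
  moreover have "((\<lambda>s. F (\<gamma> s)) has_field_derivative 0) (at 0)"
  proof (rule has_field_derivative_transform_within_open[OF DERIV_const open_ball])
    show "0 \<in> ball (0 :: complex) r" using \<gamma>(1) by simp
    show "0 = F (\<gamma> s)" if "s \<in> ball 0 r" for s using \<gamma>(2) assms(3) that by force
  qed
  ultimately show ?thesis using a(2) \<gamma>(3) DERIV_unique by metis
qed

lemma vfield_tangent_to_ideal:
  assumes "(A, B) \<in> vfield_pairs M"
  shows "tangent_to_ideal M A"
  unfolding tangent_to_ideal_def
proof (intro allI impI ballI)
  fix F j x assume F: "F \<in> hom_poly j" "\<forall>x\<in>M. F x = 0" and x: "x \<in> M"
  obtain k where A: "\<And>i. (\<lambda>x. A x $ i) \<in> hom_poly (Suc k)" "B \<in> hom_poly k"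
    and B: "\<exists>x\<in>M. B x \<noteq> 0" and tan: "\<And>x. x \<in> M \<Longrightarrow> B x \<noteq> 0 \<Longrightarrow> inverse (B x) *s A x \<in> tangent_space M x"
    using assms unfolding vfield_pairs_def by blast
  from B obtain p where p: "p \<in> M" "B p \<noteq> 0" by blast
  show "lie_derivative A F x = 0"
  proof (rule zero_divisor[OF hom_poly_holo[OF A(2)] hom_poly_holo[OF lie_hom_poly[OF F(1) A(1)]] _ p x])
    fix y assume y: "y \<in> M"
    show "B y * lie_derivative A F y = 0"
    proof (cases "B y = 0")
      case False
      have "lie_derivative (\<lambda>x. inverse (B x) *s A x) F y = 0"
        by (rule tangent_space_lie) (use tan[OF y False] F in auto)
      then show ?thesis using False by (simp add: lie_field_smult[OF F(1)])
    qed simp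
  qed
qed

end

section \<open>First integrals\<close>

text \<open>The numerator of the derivative of \<open>P / Q\<close> along \<open>A\<close>, the denominator being \<open>Q ^ 2\<close>\<close>

definition lie_num ::
    "(complex^'n \<Rightarrow> complex^'n) \<Rightarrow> (complex^'n \<Rightarrow> complex) \<Rightarrow> (complex^'n \<Rightarrow> complex) \<Rightarrow> complex^'n \<Rightarrow> complex" where
  "lie_num A P Q x = Q x * lie_derivative A P x - P x * lie_derivative A Q x"

lemma lie_num_hom_poly:
  assumes "\<And>i. (\<lambda>x. A x $ i) \<in> hom_poly (Suc k)" "P \<in> hom_poly e" "Q \<in> hom_poly e"
  shows "lie_num A P Q \<in> hom_poly (e + (k + e))"
  unfolding lie_num_def[abs_def]
  by (intro hom_poly_diff hom_poly_mult lie_hom_poly assms)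

text \<open>
  The quotient is constant near a point where the denominator does not vanish, and the resulting relation
  extends by analytic continuation across the zeros of the denominator.
\<close>

lemma holo_const_by_wronskian:
  assumes U: "open U" "connected U" and f: "f holomorphic_on U" and g: "g holomorphic_on U"
    and w: "\<And>t. t \<in> U \<Longrightarrow> g t * deriv f t = f t * deriv g t"
    and s: "s \<in> U" "g s \<noteq> 0" and t: "t \<in> U"
  shows "f t = f s / g s * g t"
proof -
  have "open (g -` (-{0}) \<inter> U)"
    using continuous_open_preimage[OF holomorphic_on_imp_continuous_on[OF g] U(1)
      open_Compl[OF closed_singleton[of 0]]]
    by (simp add: Int_commute)
  then obtain r where r: "r > 0" "ball s r \<subseteq> g -` (-{0}) \<inter> U" using s openE by blast
  then have gz: "g z \<noteq> 0" and zU: "z \<in> U" if "z \<in> ball s r" for z using that by auto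
  have c: "f z / g z = f s / g s" if z: "z \<in> ball s r" for z
  proof -
    have "\<exists>c. \<forall>z\<in>ball s r. f z / g z = c"
    proof (rule has_field_derivative_zero_constant[OF convex_ball])
      fix z assume z: "z \<in> ball s r"
      have "(f has_field_derivative deriv f z) (at z)" "(g has_field_derivative deriv g z) (at z)"
        using f g zU[OF z] U(1) holomorphic_derivI by blast+
      from DERIV_divide[OF this gz[OF z]] w[OF zU[OF z]]
      show "((\<lambda>z. f z / g z) has_field_derivative 0) (at z within ball s r)"
        by (auto simp: mult.commute intro: DERIV_subset)
    qed
    moreover have "s \<in> ball s r" using r by simp
    ultimately show ?thesis using z by metis
  qed
  show ?thesis
  proof (rule analytic_continuation_open[where f = f and g = "\<lambda>t. f s / g s * g t" and s = "ball s r" and s' = U])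
    show "f z = f s / g s * g z" if "z \<in> ball s r" for z
      using c[OF that] gz[OF that] by (simp add: field_simps)
    show "(\<lambda>t. f s / g s * g t) holomorphic_on U" using g by (intro holomorphic_intros)
  qed (use U r f t zU in auto)
qed

lemma holo_zero_divisor:
  assumes U: "open U" "connected U" and f: "f holomorphic_on U" and g: "g holomorphic_on U"
    and fg: "\<And>t. t \<in> U \<Longrightarrow> f t * g t = 0" and s: "s \<in> U" "f s \<noteq> 0" and t: "t \<in> U"
  shows "g t = 0"
proof (rule analytic_continuation_open[where f = g and g = "\<lambda>_. 0" and s = "f -` (-{0}) \<inter> U" and s' = U])
  show "open (f -` (-{0}) \<inter> U)"
    using continuous_open_preimage[OF holomorphic_on_imp_continuous_on[OF f] U(1)
      open_Compl[OF closed_singleton[of 0]]]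
    by (simp add: Int_commute)
  show "g z = 0" if "z \<in> f -` (-{0}) \<inter> U" for z using fg[of z] that by auto
qed (use U g s t in auto)

context projective_cone
begin

lemma hom_poly_zero_divisor:
  assumes "P \<in> hom_poly j" "Q \<in> hom_poly k" "\<And>x. x \<in> M \<Longrightarrow> P x * Q x = 0" "\<exists>x\<in>M. P x \<noteq> 0" "y \<in> M"
  shows "Q y = 0"
  using zero_divisor[OF hom_poly_holo[OF assms(1)] hom_poly_holo[OF assms(2)] assms(3)] assms(4,5) by blast

lemma ratfun_pairsE:
  assumes "(P, Q) \<in> ratfun_pairs M"
  obtains e where "P \<in> hom_poly e" "Q \<in> hom_poly e" "\<exists>x\<in>M. Q x \<noteq> 0"
  using assms unfolding ratfun_pairs_def by blast

lemma vfield_pairsE: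
  assumes "(A, B) \<in> vfield_pairs M"
  obtains k where "\<And>i. (\<lambda>x. A x $ i) \<in> hom_poly (Suc k)" "B \<in> hom_poly k" "\<exists>x\<in>M. B x \<noteq> 0"
  using assms unfolding vfield_pairs_def by blast

text \<open>
  First integrals are defined by equivalence classes of fractions, whereas the numerator of the derivative
  is computed from representatives.  For two fractions of the same function, the numerators are proportional
  to the squares of the denominators; and two fields that differ by a multiple of the radial field have the
  same effect on functions by Euler's relation.
\<close>

lemma lie_num_cong_function:
  assumes A: "\<And>i. (\<lambda>x. A x $ i) \<in> hom_poly (Suc k)" "tangent_to_ideal M A"
    and P: "P \<in> hom_poly e" "Q \<in> hom_poly e" and P': "P' \<in> hom_poly e'" "Q' \<in> hom_poly e'"
    and eq: "\<And>x. x \<in> M \<Longrightarrow> P x * Q' x = P' x * Q x" and x: "x \<in> M"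
  shows "Q x ^ 2 * lie_num A P' Q' x = Q' x ^ 2 * lie_num A P Q x"
proof -
  have h: "(\<lambda>x. P x * Q' x) \<in> hom_poly (e + e')" "(\<lambda>x. -1 * (P' x * Q x)) \<in> hom_poly (e + e')"
    using hom_poly_mult[OF P(1) P'(2)] hom_poly_scale[OF hom_poly_mult[OF P'(1) P(2)], of "-1"]
    by (simp_all add: add.commute)
  have "lie_derivative A (\<lambda>x. P x * Q' x + -1 * (P' x * Q x)) x = 0"
    by (rule A(2)[unfolded tangent_to_ideal_def, rule_format, OF hom_poly_add[OF h] _ x]) (simp add: eq)
  then have "P x * lie_derivative A Q' x + Q' x * lie_derivative A P x = P' x * lie_derivative A Q x + Q x * lie_derivative A P' x"
    unfolding lie_add[OF h] lie_scale[OF hom_poly_mult[OF P'(1) P(2)]]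
      lie_mult[OF P(1) P'(2)] lie_mult[OF P'(1) P(2)] by algebra
  then have e1: "Q x * lie_derivative A P' x = P x * lie_derivative A Q' x + Q' x * lie_derivative A P x - P' x * lie_derivative A Q x" by simp
  have e2: "P x * Q' x = P' x * Q x" using eq x .
  have "Q x ^ 2 * lie_num A P' Q' x = Q x * Q' x * (Q x * lie_derivative A P' x) - Q x * (P' x * Q x) * lie_derivative A Q' x"
    by (simp add: lie_num_def power2_eq_square algebra_simps)
  also have "\<dots> = Q x * Q' x * (Q' x * lie_derivative A P x) - Q' x * (P' x * Q x) * lie_derivative A Q x"
    unfolding e1 e2[symmetric] using e2 by (simp add: algebra_simps)
  also have "\<dots> = Q' x ^ 2 * lie_num A P Q x"
    unfolding e2[symmetric] by (simp add: lie_num_def power2_eq_square algebra_simps)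
  finally show ?thesis .
qed

lemma lie_num_cong_field:
  assumes P: "P \<in> hom_poly e" "Q \<in> hom_poly e"
    and eq: "B' x *s A x - B x *s A' x = c *s x"
  shows "B' x * lie_num A P Q x = B x * lie_num A' P Q x"
proof -
  have l: "B' x * lie_derivative A F x = B x * lie_derivative A' F x + c * (of_nat e * F x)" if F: "F \<in> hom_poly e" for F
  proof -
    obtain a where a: "(F has_derivative pairing a) (at x)" "\<And>A. lie_derivative A F x = pairing a (A x)"
      using hom_poly_has_derivative[OF F] by metis
    have "pairing a (B' x *s A x) = pairing a (B x *s A' x + c *s x)"
      using eq by (simp add: algebra_simps)
    then show ?thesis using a(2) euler_relation[OF F, of x] by simp
  qed
  have "B' x * lie_num A P Q x = Q x * (B' x * lie_derivative A P x) - P x * (B' x * lie_derivative A Q x)"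
    by (simp add: lie_num_def algebra_simps)
  also have "\<dots> = B x * lie_num A' P Q x"
    unfolding l[OF P(1)] l[OF P(2)] by (simp add: lie_num_def algebra_simps)
  finally show ?thesis .
qed

lemma lie_num_zero_cong:
  assumes A: "(A, B) \<in> vfield_pairs M" and A': "((A, B), (A', B')) \<in> vfield_rel M"
    and P: "(P, Q) \<in> ratfun_pairs M" and P': "((P, Q), (P', Q')) \<in> ratfun_rel M"
    and z: "\<And>x. x \<in> M \<Longrightarrow> lie_num A P Q x = 0" and x: "x \<in> M"
  shows "lie_num A' P' Q' x = 0"
proof -
  obtain k where k: "\<And>i. (\<lambda>x. A x $ i) \<in> hom_poly (Suc k)" "B \<in> hom_poly k" "\<exists>x\<in>M. B x \<noteq> 0"
    using vfield_pairsE[OF A] by blast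
  have Ap': "(A', B') \<in> vfield_pairs M" and rel: "\<And>x. x \<in> M \<Longrightarrow> \<exists>c. B' x *s A x - B x *s A' x = c *s x"
    using A' by (auto simp: vfield_rel_def)
  obtain k' where k': "\<And>i. (\<lambda>x. A' x $ i) \<in> hom_poly (Suc k')" "B' \<in> hom_poly k'" "\<exists>x\<in>M. B' x \<noteq> 0"
    using vfield_pairsE[OF Ap'] by blast
  obtain e where e: "P \<in> hom_poly e" "Q \<in> hom_poly e" "\<exists>x\<in>M. Q x \<noteq> 0"
    using ratfun_pairsE[OF P] by blast
  have Pp': "(P', Q') \<in> ratfun_pairs M" and eq: "\<And>x. x \<in> M \<Longrightarrow> P x * Q' x = P' x * Q x"
    using P' by (auto simp: ratfun_rel_def)
  obtain e' where e': "P' \<in> hom_poly e'" "Q' \<in> hom_poly e'"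
    using ratfun_pairsE[OF Pp'] by blast
  have 1: "lie_num A' P Q y = 0" if y: "y \<in> M" for y
  proof (rule hom_poly_zero_divisor[OF k(2) lie_num_hom_poly[OF k'(1) e(1,2)] _ k(3) y])
    fix u assume u: "u \<in> M"
    obtain c where "B' u *s A u - B u *s A' u = c *s u" using rel[OF u] by blast
    from lie_num_cong_field[where A = A and B = B and A' = A' and B' = B', OF e(1,2) this] z[OF u]
    show "B u * lie_num A' P Q u = 0" by simp
  qed
  have "\<exists>x\<in>M. Q x ^ 2 \<noteq> 0" using e(3) by simp
  then show ?thesis
  proof (rule hom_poly_zero_divisor[OF hom_poly_power[OF e(2)] lie_num_hom_poly[OF k'(1) e'] _ _ x, rotated])
    fix u assume u: "u \<in> M"
    show "Q u ^ 2 * lie_num A' P' Q' u = 0"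
      using lie_num_cong_function[OF k'(1) vfield_tangent_to_ideal[OF Ap'] e(1,2) e' eq u] 1[OF u] by simp
  qed
qed

text \<open>
  Along an integral curve \<open>\<gamma>\<close>, the Wronskian of \<open>P \<circ> \<gamma>\<close> and \<open>Q \<circ> \<gamma>\<close> vanishes, so that \<open>P / Q\<close> is constant;
  different fractions for the same function have the same constant value because the
  points where a denominator vanishes are isolated on the curve.
\<close>

lemma first_integral_if_lie_num_zero:
  assumes A: "(A, B) \<in> vfield_pairs M" and P: "(P, Q) \<in> ratfun_pairs M"
    and z: "\<And>x. x \<in> M \<Longrightarrow> lie_num A P Q x = 0"
    and curve: "integral_curve M (vfield_rel M `` {(A, B)}) U \<gamma>"
    and s: "s \<in> U" "takes_value (ratfun_rel M `` {(P, Q)}) (\<gamma> s) a"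
    and t: "t \<in> U" "takes_value (ratfun_rel M `` {(P, Q)}) (\<gamma> t) b"
  shows "a = b"
proof -
  have U: "open U" "connected U" and \<gamma>M: "\<And>t. t \<in> U \<Longrightarrow> \<gamma> t \<in> M"
    and vel: "\<And>t. t \<in> U \<Longrightarrow> \<exists>(A', B')\<in>vfield_rel M `` {(A, B)}. B' (\<gamma> t) \<noteq> 0 \<and>
        (\<exists>c. has_velocity \<gamma> (inverse (B' (\<gamma> t)) *s A' (\<gamma> t) + c *s \<gamma> t) t)"
    using curve unfolding integral_curve_def by auto
  have along: "((\<lambda>s. F (\<gamma> s)) has_field_derivative
      inverse (B' (\<gamma> t)) * lie_derivative A' F (\<gamma> t) + c * (of_nat e * F (\<gamma> t))) (at t)"
    if F: "F \<in> hom_poly e" and v: "has_velocity \<gamma> (inverse (B' (\<gamma> t)) *s A' (\<gamma> t) + c *s \<gamma> t) t"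
    for F e A' B' c t
  proof -
    obtain a where a: "(F has_derivative pairing a) (at (\<gamma> t))" "\<And>A. lie_derivative A F (\<gamma> t) = pairing a (A (\<gamma> t))"
      using hom_poly_has_derivative[OF F] by metis
    from has_field_derivative_along_curve[where \<gamma> = \<gamma>, OF a(1) v] euler_relation[OF F, of "\<gamma> t"]
    show ?thesis by (simp add: a(2))
  qed
  have holo: "(\<lambda>t. F (\<gamma> t)) holomorphic_on U" if F: "F \<in> hom_poly e" for F e
    unfolding holomorphic_on_open[OF U(1)]
  proof
    fix t assume "t \<in> U"
    then obtain A' B' c where "has_velocity \<gamma> (inverse (B' (\<gamma> t)) *s A' (\<gamma> t) + c *s \<gamma> t) t"
      using vel by blast
    from along[where A' = A' and B' = B' and c = c and t = t, OF F this] show "\<exists>f'. ((\<lambda>t. F (\<gamma> t)) has_field_derivative f') (at t)" by blast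
  qed
  have const: "P' (\<gamma> v) = P' (\<gamma> u) / Q' (\<gamma> u) * Q' (\<gamma> v)"
    if P': "((P, Q), (P', Q')) \<in> ratfun_rel M" and u: "u \<in> U" "Q' (\<gamma> u) \<noteq> 0" and v: "v \<in> U" for P' Q' u v
  proof -
    have "(P', Q') \<in> ratfun_pairs M" using P' by (simp add: ratfun_rel_def)
    then obtain e where e: "P' \<in> hom_poly e" "Q' \<in> hom_poly e" using ratfun_pairsE by blast
    show ?thesis
    proof (rule holo_const_by_wronskian[where f = "\<lambda>t. P' (\<gamma> t)" and g = "\<lambda>t. Q' (\<gamma> t)",
          OF U holo[OF e(1)] holo[OF e(2)] _ u v])
      fix t assume t: "t \<in> U"
      then obtain A' B' c where AB: "((A, B), (A', B')) \<in> vfield_rel M"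
        and w: "has_velocity \<gamma> (inverse (B' (\<gamma> t)) *s A' (\<gamma> t) + c *s \<gamma> t) t"
        using vel by blast
      have "Q' (\<gamma> t) * lie_derivative A' P' (\<gamma> t) = P' (\<gamma> t) * lie_derivative A' Q' (\<gamma> t)"
        using lie_num_zero_cong[OF A AB P P' z \<gamma>M[OF t]] by (simp add: lie_num_def)
      then show "Q' (\<gamma> t) * deriv (\<lambda>t. P' (\<gamma> t)) t = P' (\<gamma> t) * deriv (\<lambda>t. Q' (\<gamma> t)) t"
        unfolding DERIV_imp_deriv[OF along[where A' = A' and B' = B' and c = c and t = t, OF e(1) w]] DERIV_imp_deriv[OF along[where A' = A' and B' = B' and c = c and t = t, OF e(2) w]]
        by (simp add: algebra_simps)
    qed
  qed
  from s(2) obtain P1 Q1 where 1: "((P, Q), (P1, Q1)) \<in> ratfun_rel M" "Q1 (\<gamma> s) \<noteq> 0" "a = P1 (\<gamma> s) / Q1 (\<gamma> s)"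
    unfolding takes_value_def by blast
  from t(2) obtain P2 Q2 where 2: "((P, Q), (P2, Q2)) \<in> ratfun_rel M" "Q2 (\<gamma> t) \<noteq> 0" "b = P2 (\<gamma> t) / Q2 (\<gamma> t)"
    unfolding takes_value_def by blast
  have c1: "P1 (\<gamma> v) = a * Q1 (\<gamma> v)" if "v \<in> U" for v using const[OF 1(1) s(1) 1(2) that] 1(3) by simp
  have c2: "P2 (\<gamma> v) = b * Q2 (\<gamma> v)" if "v \<in> U" for v using const[OF 2(1) t(1) 2(2) that] 2(3) by simp
  have eq12: "P1 x * Q2 x - P2 x * Q1 x = 0" if x: "x \<in> M" for x
  proof -
    have "(P1, Q1) \<in> ratfun_pairs M" "(P2, Q2) \<in> ratfun_pairs M" using 1 2 by (auto simp: ratfun_rel_def)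
    then obtain e1 e2 where e: "P1 \<in> hom_poly e1" "Q1 \<in> hom_poly e1" "P2 \<in> hom_poly e2" "Q2 \<in> hom_poly e2"
      using ratfun_pairsE by metis
    obtain e0 where e0: "Q \<in> hom_poly e0" "\<exists>x\<in>M. Q x \<noteq> 0" using ratfun_pairsE[OF P] by blast
    have "(\<lambda>x. P1 x * Q2 x - P2 x * Q1 x) \<in> hom_poly (e1 + e2)"
      using hom_poly_diff[OF hom_poly_mult[OF e(1,4)]] hom_poly_mult[OF e(3,2)] by (simp add: add.commute)
    then show ?thesis
    proof (rule hom_poly_zero_divisor[OF e0(1) _ _ e0(2) x])
      fix y assume "y \<in> M"
      then have "P y * Q1 y = P1 y * Q y" "P y * Q2 y = P2 y * Q y"
        using 1(1) 2(1) by (auto simp: ratfun_rel_def)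
      then show "Q y * (P1 y * Q2 y - P2 y * Q1 y) = 0" by algebra
    qed
  qed
  show "a = b"
  proof (rule ccontr)
    assume ab: "a \<noteq> b"
    have pr: "Q1 (\<gamma> v) * Q2 (\<gamma> v) = 0" if v: "v \<in> U" for v
    proof -
      have "(a - b) * (Q1 (\<gamma> v) * Q2 (\<gamma> v)) = 0"
        using eq12[OF \<gamma>M[OF v]] by (simp add: c1[OF v] c2[OF v] algebra_simps)
      then show ?thesis using ab by simp
    qed
    have "(P1, Q1) \<in> ratfun_pairs M" "(P2, Q2) \<in> ratfun_pairs M" using 1 2 by (auto simp: ratfun_rel_def)
    then obtain e1 e2 where e: "Q1 \<in> hom_poly e1" "Q2 \<in> hom_poly e2" using ratfun_pairsE by metis
    have "Q2 (\<gamma> t) = 0"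
      by (rule holo_zero_divisor[OF U holo[OF e(1)] holo[OF e(2)] pr s(1) 1(2) t(1)])
    then show False using 2(2) by simp
  qed
qed

text \<open>
  There is an integral curve through each point where the field is regular, and constancy along it makes the
  derivative vanish at the point.  The remaining points follow because the function field has no zero
  divisors.
\<close>

lemma lie_num_zero_if_first_integral:
  assumes A: "(A, B) \<in> vfield_pairs M" and P: "(P, Q) \<in> ratfun_pairs M"
    and first: "ratfun_rel M `` {(P, Q)} \<in> first_integrals M (vfield_rel M `` {(A, B)})"
    and x: "x \<in> M"
  shows "lie_num A P Q x = 0"
proof -
  obtain k where k: "\<And>i. (\<lambda>x. A x $ i) \<in> hom_poly (Suc k)" "B \<in> hom_poly k" "\<exists>x\<in>M. B x \<noteq> 0"
    using vfield_pairsE[OF A] by blast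
  obtain e where e: "P \<in> hom_poly e" "Q \<in> hom_poly e" "\<exists>x\<in>M. Q x \<noteq> 0"
    using ratfun_pairsE[OF P] by blast
  have generic: "lie_num A P Q p = 0" if p: "p \<in> M" "B p \<noteq> 0" "Q p \<noteq> 0" for p
  proof -
    obtain r \<gamma> where r: "r > 0" "\<gamma> 0 = p" and \<gamma>: "\<And>t. t \<in> ball 0 r \<Longrightarrow>
        \<gamma> t \<in> M \<and> B (\<gamma> t) \<noteq> 0 \<and> has_velocity \<gamma> (inverse (B (\<gamma> t)) *s A (\<gamma> t)) t"
      using integral_curve_in_cone[OF k(1,2) vfield_tangent_to_ideal[OF A] p(1,2)] by blast
    have refl: "((A, B), (A, B)) \<in> vfield_rel M" using A by (auto simp: vfield_rel_def intro!: exI[of _ 0])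
    have "integral_curve M (vfield_rel M `` {(A, B)}) (ball 0 r) \<gamma>"
      unfolding integral_curve_def
    proof (intro conjI ballI)
      show "\<gamma> ` ball 0 r \<subseteq> M" using \<gamma> by blast
      fix t :: complex assume t: "t \<in> ball 0 r"
      have "has_velocity \<gamma> (inverse (B (\<gamma> t)) *s A (\<gamma> t) + 0 *s \<gamma> t) t" using \<gamma>[OF t] by simp
      then show "\<exists>(A, B)\<in>vfield_rel M `` {(A, B)}. B (\<gamma> t) \<noteq> 0 \<and>
          (\<exists>c. has_velocity \<gamma> (inverse (B (\<gamma> t)) *s A (\<gamma> t) + c *s \<gamma> t) t)"
        using refl \<gamma>[OF t] by blast
    qed auto
    then have const: "a = b"
      if "s \<in> ball 0 r" "t \<in> ball 0 r" "takes_value (ratfun_rel M `` {(P, Q)}) (\<gamma> s) a"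
        "takes_value (ratfun_rel M `` {(P, Q)}) (\<gamma> t) b" for s t a b
      using first that unfolding first_integrals_def by blast
    have val: "takes_value (ratfun_rel M `` {(P, Q)}) y (P y / Q y)" if "Q y \<noteq> 0" for y
      using P that by (auto simp: takes_value_def ratfun_rel_def)
    have d: "((\<lambda>s. F (\<gamma> s)) has_field_derivative inverse (B p) * lie_derivative A F p) (at 0)"
      if F: "F \<in> hom_poly m" for F m
    proof -
      obtain a where a: "(F has_derivative pairing a) (at (\<gamma> 0))" "\<And>A. lie_derivative A F (\<gamma> 0) = pairing a (A (\<gamma> 0))"
        using hom_poly_has_derivative[OF F] by metis
      have "has_velocity \<gamma> (inverse (B (\<gamma> 0)) *s A (\<gamma> 0)) 0" using \<gamma>[of 0] r by simp
      from has_field_derivative_along_curve[where \<gamma> = \<gamma>, OF a(1) this] show ?thesis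
        by (simp add: a(2) r(2)[symmetric])
    qed
    have "isCont (\<lambda>s. Q (\<gamma> s)) 0" using d[OF e(2)] by (rule DERIV_isCont)
    then have "((\<lambda>s. Q (\<gamma> s)) \<longlongrightarrow> Q p) (at 0)" using r(2) by (simp add: isCont_def)
    then have "\<forall>\<^sub>F s in at 0. Q (\<gamma> s) \<noteq> 0" using p(3) by (rule tendsto_imp_eventually_ne)
    moreover have "\<forall>\<^sub>F s in at (0 :: complex). s \<in> ball 0 r"
      using r(1) by (intro eventually_at_in_open') auto
    ultimately have "\<forall>\<^sub>F s in at 0. P (\<gamma> s) / Q (\<gamma> s) = P p / Q p"
    proof eventually_elim
      case (elim s)
      have "0 \<in> ball (0 :: complex) r" using r by simp
      from const[OF elim(2) this val[OF elim(1)] val[of "\<gamma> 0"]] p(3) r(2) show ?case by simp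
    qed
    moreover have "((\<lambda>s. P (\<gamma> s) / Q (\<gamma> s)) has_field_derivative
        (inverse (B p) * lie_derivative A P p * Q p - P p * (inverse (B p) * lie_derivative A Q p)) / (Q p * Q p)) (at 0)"
      using DERIV_divide[OF d[OF e(1)] d[OF e(2)]] p(3) r(2) by simp
    ultimately have "((\<lambda>s. P p / Q p) has_field_derivative
        (inverse (B p) * lie_derivative A P p * Q p - P p * (inverse (B p) * lie_derivative A Q p)) / (Q p * Q p)) (at 0)"
      using p r by (subst (asm) has_field_derivative_cong_eventually[where g = "\<lambda>s. P p / Q p"]) auto
    then have "(inverse (B p) * lie_derivative A P p * Q p - P p * (inverse (B p) * lie_derivative A Q p)) / (Q p * Q p) = 0"
      using DERIV_const DERIV_unique by blast
    then have "inverse (B p) * (lie_derivative A P p * Q p - P p * lie_derivative A Q p) = 0"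
      using p(3) by (simp add: algebra_simps)
    then show ?thesis using p(2) by (simp add: lie_num_def algebra_simps)
  qed
  have 1: "Q y * lie_num A P Q y = 0" if y: "y \<in> M" for y
  proof (rule hom_poly_zero_divisor[OF k(2) hom_poly_mult[OF e(2) lie_num_hom_poly[OF k(1) e(1,2)]] _ k(3) y])
    show "B u * (Q u * lie_num A P Q u) = 0" if "u \<in> M" for u using generic[OF that] by auto
  qed
  show ?thesis
    by (rule hom_poly_zero_divisor[OF e(2) lie_num_hom_poly[OF k(1) e(1,2)] 1 e(3) x])
qed

theorem first_integral_iff:
  assumes A: "(A, B) \<in> vfield_pairs M" and P: "(P, Q) \<in> ratfun_pairs M"
  shows "ratfun_rel M `` {(P, Q)} \<in> first_integrals M (vfield_rel M `` {(A, B)}) \<longleftrightarrow>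
     (\<forall>x\<in>M. lie_num A P Q x = 0)"
proof
  assume "\<forall>x\<in>M. lie_num A P Q x = 0"
  then have "a = b" if "integral_curve M (vfield_rel M `` {(A, B)}) U \<gamma>" "s \<in> U" "t \<in> U"
    "takes_value (ratfun_rel M `` {(P, Q)}) (\<gamma> s) a" "takes_value (ratfun_rel M `` {(P, Q)}) (\<gamma> t) b"
    for U \<gamma> s t a b
    using first_integral_if_lie_num_zero[OF A P _ that(1,2,4,3,5)] by blast
  moreover have "ratfun_rel M `` {(P, Q)} \<in> rational_functions M"
    unfolding rational_functions_def using P by (rule quotientI)
  ultimately show "ratfun_rel M `` {(P, Q)} \<in> first_integrals M (vfield_rel M `` {(A, B)})"
    unfolding first_integrals_def by blast
qed (use lie_num_zero_if_first_integral[OF A P] in blast)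

end

section \<open>Tangent spaces and coordinate vector fields\<close>

text \<open>
  By induction on the set of variables, a vanishing polynomial is regarded as one in a single variable, all
  of whose coefficients vanish.
\<close>

lemma monomials_independent:
  fixes c :: "('i \<Rightarrow> nat) \<Rightarrow> complex"
  assumes "finite J" "finite X"
    and "\<And>\<alpha> \<beta>. \<alpha> \<in> X \<Longrightarrow> \<beta> \<in> X \<Longrightarrow> \<forall>i\<in>J. \<alpha> i = \<beta> i \<Longrightarrow> \<alpha> = \<beta>"
    and "\<And>x. (\<Sum>\<alpha>\<in>X. c \<alpha> * (\<Prod>i\<in>J. x i ^ \<alpha> i)) = 0" and "\<alpha> \<in> X"
  shows "c \<alpha> = 0"
  using assms
proof (induction J arbitrary: X \<alpha> rule: finite_induct)
  case empty
  then have "X = {\<alpha>}" by auto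
  then show ?case using empty.prems(3) by simp
next
  case (insert j J)
  define Y where "Y n = {\<beta> \<in> X. \<beta> j = n}" for n
  define m where "m = Suc (\<Sum>\<beta>\<in>X. \<beta> j)"
  have m: "\<beta> j < m" if "\<beta> \<in> X" for \<beta>
    using member_le_sum[of \<beta> X "\<lambda>\<beta>. \<beta> j"] that insert.prems(1) by (simp add: m_def less_Suc_eq_le)
  define g where "g x n = (\<Sum>\<beta>\<in>Y n. c \<beta> * (\<Prod>i\<in>J. x i ^ \<beta> i))" for x :: "'i \<Rightarrow> complex" and n
  have "(\<Sum>n<m. g x n * t ^ n) = 0" for x t
  proof -
    have "(\<Sum>n<m. g x n * t ^ n) = (\<Sum>n<m. \<Sum>\<beta> | \<beta> \<in> X \<and> \<beta> j = n. c \<beta> * (\<Prod>i\<in>insert j J. (x(j := t)) i ^ \<beta> i))"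
      unfolding g_def Y_def sum_distrib_right
    proof (intro sum.cong refl)
      fix n \<beta> assume "\<beta> \<in> {\<beta> \<in> X. \<beta> j = n}"
      moreover have "(\<Prod>i\<in>J. (x(j := t)) i ^ \<beta> i) = (\<Prod>i\<in>J. x i ^ \<beta> i)"
        using insert.hyps by (intro prod.cong) auto
      ultimately show "c \<beta> * (\<Prod>i\<in>J. x i ^ \<beta> i) * t ^ n = c \<beta> * (\<Prod>i\<in>insert j J. (x(j := t)) i ^ \<beta> i)"
        using insert.hyps by simp
    qed
    also have "\<dots> = (\<Sum>\<beta>\<in>X. c \<beta> * (\<Prod>i\<in>insert j J. (x(j := t)) i ^ \<beta> i))"
      using insert.prems(1) m by (intro sum.group) auto
    also have "\<dots> = 0" by (rule insert.prems(3))
    finally show ?thesis .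
  qed
  then have "norm (g x (\<alpha> j)) * 1 ^ \<alpha> j \<le> 0" for x
    using m[OF insert.prems(4)] by (intro coefficient_bound_by_roots_of_unity[of "\<alpha> j" m 1 "g x" 0]) auto
  then have g0: "g x (\<alpha> j) = 0" for x by simp
  show ?case
  proof (rule insert.IH[of "Y (\<alpha> j)"])
    show "finite (Y (\<alpha> j))" using insert.prems(1) by (simp add: Y_def)
    show "\<beta> = \<gamma>" if "\<beta> \<in> Y (\<alpha> j)" "\<gamma> \<in> Y (\<alpha> j)" "\<forall>i\<in>J. \<beta> i = \<gamma> i" for \<beta> \<gamma>
      using that insert.prems(2)[of \<beta> \<gamma>] by (simp add: Y_def)
    show "\<alpha> \<in> Y (\<alpha> j)" using insert.prems(4) by (simp add: Y_def)
  qed (use g0 in \<open>simp add: g_def\<close>)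
qed

definition depends_on :: "'n set \<Rightarrow> (complex^'n \<Rightarrow> complex) \<Rightarrow> bool" where
  "depends_on J F \<longleftrightarrow> (\<forall>x y. (\<forall>i\<in>J. x $ i = y $ i) \<longrightarrow> F x = F y)"

lemma has_field_derivative_line:
  "(F has_derivative pairing a) (at (x + t *s v)) \<Longrightarrow>
    ((\<lambda>t. F (x + t *s v)) has_field_derivative pairing a v) (at t)"
  by (rule has_field_derivative_along_curve[OF _ has_velocity_line])

lemma gradient_depends_on:
  assumes G: "is_gradient k F G" and dep: "depends_on J F"
  shows "depends_on J (\<lambda>x. G x $ j)" and "j \<notin> J \<Longrightarrow> G x $ j = 0"
proof -
  have d: "((\<lambda>t. F (x + t *s axis j 1)) has_field_derivative G x $ j) (at 0)" for x
    using has_field_derivative_line[of F "G x" x 0 "axis j 1"] is_gradientD(1)[OF G] by simp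
  show "depends_on J (\<lambda>x. G x $ j)"
    unfolding depends_on_def
  proof (intro allI impI)
    fix x y :: "complex^'a" assume "\<forall>i\<in>J. x $ i = y $ i"
    then have "F (x + t *s axis j 1) = F (y + t *s axis j 1)" for t
      using dep unfolding depends_on_def by (metis vector_add_component)
    then have "((\<lambda>t. F (x + t *s axis j 1)) has_field_derivative G y $ j) (at 0)" using d[of y] by simp
    then show "G x $ j = G y $ j" using d[of x] DERIV_unique by blast
  qed
  show "G x $ j = 0" if "j \<notin> J"
  proof -
    have "F (x + t *s axis j 1) = F x" for t
    proof -
      have "\<forall>i\<in>J. (x + t *s axis j 1) $ i = x $ i" using that by (auto simp: axis_def)
      then show ?thesis using dep unfolding depends_on_def by blast
    qed
    then have "((\<lambda>t. F x) has_field_derivative G x $ j) (at 0)" using d[of x] by simp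
    then show ?thesis using DERIV_const DERIV_unique by blast
  qed
qed

lemma depends_on_if_gradient_zero:
  assumes G: "is_gradient k F G" and dep: "depends_on (insert j J) F" and z: "\<And>x. G x $ j = 0"
  shows "depends_on J F"
  unfolding depends_on_def
proof (intro allI impI)
  fix x y :: "complex^'a" assume xy: "\<forall>i\<in>J. x $ i = y $ i"
  have "((\<lambda>t. F (x + t *s axis j 1)) has_field_derivative 0) (at t)" for t
    using has_field_derivative_line[of F "G (x + t *s axis j 1)" x t "axis j 1"] is_gradientD(1)[OF G] z
    by simp
  then obtain c where c: "\<And>t. F (x + t *s axis j 1) = c"
    using has_field_derivative_zero_constant[of UNIV "\<lambda>t. F (x + t *s axis j 1)"] by auto
  have "F x = F (x + (y $ j - x $ j) *s axis j 1)" using c[of 0] c[of "y $ j - x $ j"] by simp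
  also have "\<dots> = F y"
  proof -
    have "\<forall>i\<in>insert j J. (x + (y $ j - x $ j) *s axis j 1) $ i = y $ i"
      using xy by (auto simp: axis_def)
    then show ?thesis using dep unfolding depends_on_def by blast
  qed
  finally show "F x = F y" .
qed

context projective_cone
begin

definition independent_coords :: "'n set \<Rightarrow> bool" where
  "independent_coords I \<longleftrightarrow>
     (\<forall>F k. F \<in> hom_poly k \<longrightarrow> depends_on I F \<longrightarrow> (\<forall>x\<in>M. F x = 0) \<longrightarrow> (\<forall>x. F x = 0))"

lemma independent_coords_card: "independent_coords I \<Longrightarrow> card I \<le> CARD('d option)"
proof (rule ccontr)
  assume I: "independent_coords I" and "\<not> card I \<le> CARD('d option)"
  then obtain J where J: "J \<subseteq> I" "card J = CARD('d option) + 1"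
    by (metis Suc_eq_plus1 not_less_eq_eq obtain_subset_with_card_n)
  have fJ: "finite J" by simp
  obtain N c where c: "\<exists>\<alpha>\<in>exponents J N. c \<alpha> \<noteq> 0"
    "\<And>x. x \<in> M \<Longrightarrow> (\<Sum>\<alpha>\<in>exponents J N. c \<alpha> * (\<Prod>i\<in>J. x $ i ^ \<alpha> i)) = 0"
    using forms_algebraically_dependent[where P = "\<lambda>i x. x $ i" and e = 1,
        OF fJ J(2) hom_poly_coord zero_less_one] by blast
  define F where "F x = (\<Sum>\<alpha>\<in>exponents J N. c \<alpha> * (\<Prod>i\<in>J. x $ i ^ \<alpha> i))" for x :: "complex^'n"
  have "F \<in> hom_poly N"
    unfolding F_def[abs_def]
  proof (intro hom_poly_sum hom_poly_scale)
    fix \<alpha> :: "'n \<Rightarrow> nat" assume a: "\<alpha> \<in> exponents J N"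
    have "(\<lambda>x :: complex^'n. \<Prod>i\<in>J. x $ i ^ \<alpha> i) \<in> hom_poly (\<Sum>i\<in>J. \<alpha> i * 1)"
      by (intro hom_poly_prod hom_poly_power hom_poly_coord)
    then show "(\<lambda>x :: complex^'n. \<Prod>i\<in>J. x $ i ^ \<alpha> i) \<in> hom_poly N" using a by (simp add: exponents_def)
  qed
  moreover have "depends_on I F"
    unfolding depends_on_def F_def
  proof (intro allI impI sum.cong refl arg_cong2[where f = "(*)"] prod.cong)
    fix x y :: "complex^'n" and \<alpha> i assume "\<forall>i\<in>I. x $ i = y $ i" "i \<in> J"
    then show "x $ i ^ \<alpha> i = y $ i ^ \<alpha> i" using J(1) by auto
  qed
  moreover have "\<forall>x\<in>M. F x = 0" using c(2) by (simp add: F_def)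
  ultimately have F0: "F x = 0" for x using I unfolding independent_coords_def by blast
  have "c \<alpha> = 0" if "\<alpha> \<in> exponents J N" for \<alpha>
  proof (rule monomials_independent[OF fJ finite_exponents_on[OF fJ] _ _ that])
    show "\<alpha> = \<beta>" if "\<alpha> \<in> exponents J N" "\<beta> \<in> exponents J N" "\<forall>i\<in>J. \<alpha> i = \<beta> i" for \<alpha> \<beta>
    proof
      show "\<alpha> i = \<beta> i" for i using that by (cases "i \<in> J") (auto simp: exponents_def)
    qed
    show "(\<Sum>\<alpha>\<in>exponents J N. c \<alpha> * (\<Prod>i\<in>J. x i ^ \<alpha> i)) = 0" for x
      using F0[of "\<chi> i. x i"] by (simp add: F_def)
  qed
  then show False using c(1) by blast
qed

text \<open>
  Every further coordinate satisfies an equation over a maximal set of independent ones.  One of least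
  degree has a partial derivative with respect to the further coordinate that does not vanish on
  the cone.
\<close>

definition coordinate_equations ::
    "'n set \<Rightarrow> ('n \<Rightarrow> complex^'n \<Rightarrow> complex) \<Rightarrow> ('n \<Rightarrow> nat) \<Rightarrow> ('n \<Rightarrow> complex^'n \<Rightarrow> complex^'n) \<Rightarrow> bool" where
  "coordinate_equations I F d G \<longleftrightarrow> card I \<le> CARD('d option) \<and>
     (\<forall>j. j \<notin> I \<longrightarrow> F j \<in> hom_poly (d j) \<and> (\<forall>x\<in>M. F j x = 0) \<and> is_gradient (d j) (F j) (G j) \<and>
        (\<exists>x\<in>M. G j x $ j \<noteq> 0) \<and> (\<forall>x k. k \<notin> insert j I \<longrightarrow> G j x $ k = 0))"

lemma coordinate_equations_exist: "\<exists>I F d G. coordinate_equations I F d G"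
proof -
  have "independent_coords {}"
    unfolding independent_coords_def depends_on_def using M_nonempty by (metis ball_empty all_not_in_conv)
  then have "\<exists>I. independent_coords I \<and> (\<forall>I'. independent_coords I' \<longrightarrow> card I' \<le> card I)"
    by (rule ex_has_greatest_nat) (auto intro: le_imp_less_Suc[OF independent_coords_card])
  then obtain I where I: "independent_coords I" "\<And>I'. independent_coords I' \<Longrightarrow> card I' \<le> card I" by blast
  have "\<exists>F d G. F \<in> hom_poly d \<and> (\<forall>x\<in>M. F x = 0) \<and> is_gradient d F G \<and>
        (\<exists>x\<in>M. G x $ j \<noteq> 0) \<and> (\<forall>x k. k \<notin> insert j I \<longrightarrow> G x $ k = 0)" if j: "j \<notin> I" for j
  proof -
    define Z where "Z k \<longleftrightarrow> (\<exists>F. F \<in> hom_poly k \<and> depends_on (insert j I) F \<and> (\<forall>x\<in>M. F x = 0) \<and> (\<exists>x. F x \<noteq> 0))" for k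
    have "\<not> independent_coords (insert j I)" using I(2)[of "insert j I"] j by auto
    then have ex: "\<exists>k. Z k" unfolding independent_coords_def Z_def by blast
    define k where "k = (LEAST k. Z k)"
    have "Z k" unfolding k_def using ex by (rule LeastI_ex)
    then obtain F where F: "F \<in> hom_poly k" "depends_on (insert j I) F" "\<forall>x\<in>M. F x = 0" "\<exists>x. F x \<noteq> 0"
      unfolding Z_def by blast
    obtain G where G: "is_gradient k F G" using hom_poly_gradient[OF F(1)] .
    have "\<exists>x\<in>M. G x $ j \<noteq> 0"
    proof (rule ccontr)
      assume n: "\<not> (\<exists>x\<in>M. G x $ j \<noteq> 0)"
      have "G x $ j = 0" for x
      proof (cases "k = 0")
        case True
        then show ?thesis using is_gradientD(3)[OF G] by simp
      next
        case False
        show ?thesis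
        proof (rule ccontr)
          assume "G x $ j \<noteq> 0"
          then have "Z (k - 1)"
            unfolding Z_def using n is_gradientD(2)[OF G, of j] gradient_depends_on(1)[OF G F(2), of j] by blast
          then have "k \<le> k - 1" unfolding k_def by (rule Least_le)
          then show False using False by simp
        qed
      qed
      then have "depends_on I F" by (rule depends_on_if_gradient_zero[OF G F(2)])
      then show False using I(1) F unfolding independent_coords_def by blast
    qed
    moreover have "\<forall>x k. k \<notin> insert j I \<longrightarrow> G x $ k = 0"
      using gradient_depends_on(2)[OF G F(2)] by blast
    ultimately show ?thesis using F G by blast
  qed
  then have "\<exists>F d G. \<forall>j. j \<notin> I \<longrightarrow> F j \<in> hom_poly (d j) \<and> (\<forall>x\<in>M. F j x = 0) \<and> is_gradient (d j) (F j) (G j) \<and>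
        (\<exists>x\<in>M. G j x $ j \<noteq> 0) \<and> (\<forall>x k. k \<notin> insert j I \<longrightarrow> G j x $ k = 0)" by metis
  then show ?thesis using independent_coords_card[OF I(1)] unfolding coordinate_equations_def by blast
qed

lemma prod_nonzero_somewhere:
  assumes "finite S" "\<And>j. j \<in> S \<Longrightarrow> P j \<in> hom_poly (e j) \<and> (\<exists>x\<in>M. P j x \<noteq> 0)"
  shows "\<exists>x\<in>M. (\<Prod>j\<in>S. P j x) \<noteq> 0"
  using assms
proof (induction S rule: finite_induct)
  case empty
  then show ?case using M_nonempty by auto
next
  case (insert j S)
  have h: "(\<lambda>x. \<Prod>j\<in>S. P j x) \<in> hom_poly (sum e S)" using insert.prems by (intro hom_poly_prod) auto
  have Pj: "P j \<in> hom_poly (e j)" "\<exists>x\<in>M. P j x \<noteq> 0" using insert.prems[of j] by auto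
  have ne: "\<exists>x\<in>M. (\<Prod>j\<in>S. P j x) \<noteq> 0" using insert by auto
  show ?case
  proof (rule ccontr)
    assume "\<not> ?thesis"
    then have z: "P j x * (\<Prod>j\<in>S. P j x) = 0" if "x \<in> M" for x using insert.hyps that by auto
    have "(\<Prod>j\<in>S. P j x) = 0" if "x \<in> M" for x
      by (rule hom_poly_zero_divisor[OF Pj(1) h z Pj(2) that])
    then show False using ne by blast
  qed
qed

text \<open>The chart maps complex lines to the curves in the cone that define the tangent space.\<close>

lemma chart_tangent:
  assumes p: "p \<in> M"
  obtains A :: "complex^'d option^'n" where "inj (\<lambda>w. A *v w)" "\<And>w. A *v w \<in> tangent_space M p"
proof -
  obtain \<Phi> :: "complex^'d option \<Rightarrow> complex^'n" where \<Phi>: "holo_immersion (polydisc 1) \<Phi>"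
      "\<Phi> ` polydisc 1 \<subseteq> M \<inter> UNIV" "\<Phi> 0 = p"
    using chart[OF p open_UNIV UNIV_I] by metis
  have "0 \<in> (polydisc 1 :: (complex^'d option) set)" by (simp add: polydisc_def)
  then obtain A where A: "(\<Phi> has_derivative (\<lambda>v. A *v v)) (at 0)" "inj (\<lambda>v. A *v v)"
    using \<Phi>(1) unfolding holo_immersion_def by blast
  have "A *v w \<in> tangent_space M p" for w
  proof -
    define r where "r = 1 / (1 + norm w)"
    have r: "r > 0" by (simp add: r_def add_pos_nonneg)
    have in_poly: "t *s w \<in> polydisc 1" if "t \<in> ball 0 r" for t
      unfolding polydisc_def
    proof (intro CollectI allI)
      fix i
      have "norm ((t *s w) $ i) \<le> norm t * norm w"
        by (simp add: norm_mult mult_left_mono Finite_Cartesian_Product.norm_nth_le)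
      also have "\<dots> \<le> r * norm w" using that by (intro mult_right_mono) auto
      also have "\<dots> \<le> 1" by (simp add: r_def divide_le_eq_1_pos add_pos_nonneg)
      finally show "norm ((t *s w) $ i) \<le> 1" .
    qed
    define \<gamma> where "\<gamma> t = \<Phi> (t *s w)" for t
    have line: "has_velocity (\<lambda>t. t *s w) w t" for t using has_velocity_line[of 0 w t] by simp
    have "\<exists>v. has_velocity \<gamma> v t" if t: "t \<in> ball 0 r" for t
    proof -
      obtain A' where "(\<Phi> has_derivative (\<lambda>v. A' *v v)) (at (t *s w))"
        using \<Phi>(1) in_poly[OF t] unfolding holo_immersion_def by blast
      from has_velocity_compose[where \<gamma> = "\<lambda>t. t *s w", OF this line] show ?thesis
        unfolding \<gamma>_def[abs_def] by blast
    qed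
    then have "(\<lambda>t. \<gamma> t $ i) holomorphic_on ball 0 r" for i
      unfolding holomorphic_on_open[OF open_ball] has_velocity_def by blast
    moreover have "\<gamma> ` ball 0 r \<subseteq> M" using in_poly \<Phi>(2) by (auto simp: \<gamma>_def)
    moreover have "\<gamma> 0 = p" using \<Phi>(3) by (simp add: \<gamma>_def)
    moreover have "has_velocity \<gamma> (A *v w) 0"
      unfolding \<gamma>_def[abs_def] using A(1) by (intro has_velocity_compose line) simp
    ultimately show ?thesis using r unfolding tangent_space_def by blast
  qed
  with A(2) that show thesis by blast
qed

text \<open>
  The differentials of the equations cut out a space that projects injectively to the independent
  coordinates, so it is not larger than the image of the derivative of a chart, which it contains.
\<close>

lemma tangent_space_from_equations:
  assumes eqs: "coordinate_equations I F d G" and p: "p \<in> M" "\<And>j. j \<notin> I \<Longrightarrow> G j p $ j \<noteq> 0"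
  shows "card I = CARD('d option)"
    and "(\<And>j. j \<notin> I \<Longrightarrow> pairing (G j p) v = 0) \<Longrightarrow> v \<in> tangent_space M p"
proof -
  note e = eqs[unfolded coordinate_equations_def]
  have inj0: "v = 0" if N: "\<And>j. j \<notin> I \<Longrightarrow> pairing (G j p) v = 0" and z: "\<And>i. i \<in> I \<Longrightarrow> v $ i = 0" for v
  proof -
    have "v $ j = 0" if j: "j \<notin> I" for j
    proof -
      have "pairing (G j p) v = (\<Sum>i\<in>UNIV. if i = j then G j p $ j * v $ j else 0)"
        unfolding pairing_def using e j z by (intro sum.cong) auto
      then have "G j p $ j * v $ j = 0" using N[OF j] by simp
      then show ?thesis using p(2)[OF j] by simp
    qed
    with z show ?thesis by (metis vec_eq_iff zero_index)
  qed
  obtain A :: "complex^'d option^'n" where A: "inj (\<lambda>w. A *v w)" "\<And>w. A *v w \<in> tangent_space M p"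
    using chart_tangent[OF p(1)] by blast
  have AN: "pairing (G j p) (A *v w) = 0" if j: "j \<notin> I" for j w
  proof -
    have Fj: "F j \<in> hom_poly (d j)" "\<And>x. x \<in> M \<Longrightarrow> F j x = 0" and G: "is_gradient (d j) (F j) (G j)"
      using e j by auto
    have "lie_derivative (\<lambda>_. A *v w) (F j) p = 0" by (rule tangent_space_lie[OF A(2) Fj])
    then show ?thesis using lie_eq[OF is_gradientD(1)[OF G]] by simp
  qed
  define L where "L = (\<chi> i k. if i \<in> I then A $ i $ k else 0)"
  have L: "(L *v w) $ i = (if i \<in> I then (A *v w) $ i else 0)" for w i
    by (simp add: L_def matrix_vector_mult_def)
  have injL: "inj (\<lambda>w. L *v w)"
  proof (rule injI)
    fix w w' assume eq: "L *v w = L *v w'"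
    have "A *v (w - w') = 0"
    proof (rule inj0)
      show "(A *v (w - w')) $ i = 0" if "i \<in> I" for i
        using arg_cong[OF eq, of "\<lambda>v. v $ i"] that L by (simp add: matrix_vector_mult_diff_distrib)
    qed (rule AN)
    then have "A *v w = A *v w'" by (simp add: matrix_vector_mult_diff_distrib)
    then show "w = w'" using A(1) by (simp add: injD)
  qed
  define S where "S = {x :: complex^'n. \<forall>i. i \<notin> I \<longrightarrow> x $ i = 0}"
  have sub: "range (\<lambda>w. L *v w) \<subseteq> S" by (auto simp: S_def L)
  have linL: "Vector_Spaces.linear (*s) (*s) ((*v) L)" by simp
  have "vec.dim ((*v) L ` UNIV) = vec.dim (UNIV :: (complex^'d option) set)"
    using injL by (intro vec.dim_image_eq linL) (auto intro: inj_on_subset)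
  then have dimL: "vec.dim (range ((*v) L)) = CARD('d option)"
    by (simp add: vec.dim_UNIV card_cart_basis)
  have dimS: "vec.dim S = card I" unfolding S_def by (rule dim_substandard_cart)
  have "CARD('d option) \<le> card I"
    using vec.dim_subset[OF sub] dimL dimS by simp
  then show c: "card I = CARD('d option)" using e by simp
  have "vec.subspace S" by (auto simp: S_def vec.subspace_def)
  moreover have "vec.subspace (range ((*v) L))"
    using vec.linear_subspace_image[OF linL vec.subspace_UNIV] .
  ultimately have rg: "range ((*v) L) = S"
    using sub dimL dimS c by (intro vec.subspace_dim_equal) auto
  show "v \<in> tangent_space M p" if N: "\<And>j. j \<notin> I \<Longrightarrow> pairing (G j p) v = 0"
  proof -
    have "(\<chi> i. if i \<in> I then v $ i else 0) \<in> S" by (simp add: S_def)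
    then obtain w where w: "(\<chi> i. if i \<in> I then v $ i else 0) = L *v w" using rg by blast
    have "v - A *v w = 0"
    proof (rule inj0)
      show "pairing (G j p) (v - A *v w) = 0" if "j \<notin> I" for j
        using N[OF that] AN[OF that] pairing_smult[of "G j p" "-1" "A *v w"]
          pairing_add[of "G j p" v "-1 *s (A *v w)"] by simp
      show "(v - A *v w) $ i = 0" if "i \<in> I" for i
        using arg_cong[OF w, of "\<lambda>v. v $ i"] that L by simp
    qed
    then show ?thesis using A(2)[of w] by simp
  qed
qed

end

section \<open>The function field\<close>

text \<open>
  The fractions of these functions form a type of class \<^class>\<open>field\<close> that contains the function fields of
  all manifolds of the given dimension: a chart pulls rational functions back to it.  The value outside
  the polydisc is fixed in order that equal functions are equal elements of the type.
\<close>

typedef (overloaded) ('m::finite) hol =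
  "{f :: complex^'m \<Rightarrow> complex. holo_fun open_polydisc f \<and> (\<forall>z. z \<notin> open_polydisc \<longrightarrow> f z = 0)}"
proof
  show "(\<lambda>_. 0) \<in> {f :: complex^'m \<Rightarrow> complex.
      holo_fun open_polydisc f \<and> (\<forall>z. z \<notin> open_polydisc \<longrightarrow> f z = 0)}"
    using hom_poly_holo[OF hom_poly_0[of 0]] by auto
qed

definition hol_of :: "(complex^'m \<Rightarrow> complex) \<Rightarrow> 'm::finite hol" where
  "hol_of f = Abs_hol (\<lambda>z. if z \<in> open_polydisc then f z else 0)"

lemma holo_fun_cong:
  assumes "open U" "\<And>x. x \<in> U \<Longrightarrow> f x = g x" "holo_fun U f"
  shows "holo_fun U g"
  unfolding holo_fun_def
proof
  fix x assume x: "x \<in> U"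
  then obtain a where "(f has_derivative pairing a) (at x)" using assms(3) by (auto simp: holo_fun_def)
  from has_derivative_transform_within_open[OF this assms(1) x] assms(2)
  show "\<exists>a. (g has_derivative pairing a) (at x)" by blast
qed

lemma Rep_hol_of:
  "holo_fun open_polydisc f \<Longrightarrow> Rep_hol (hol_of f) = (\<lambda>z. if z \<in> open_polydisc then f z else 0)"
  unfolding hol_of_def
  by (rule Abs_hol_inverse) (auto intro: holo_fun_cong[OF open_polydisc(1)])

lemma Rep_hol_holo: "holo_fun open_polydisc (Rep_hol f)"
  using Rep_hol[of f] by simp

lemma hol_of_Rep: "hol_of (Rep_hol f) = f"
proof -
  have "(\<lambda>z. if z \<in> open_polydisc then Rep_hol f z else 0) = Rep_hol f"
    using Rep_hol[of f] by auto
  then show ?thesis by (simp add: hol_of_def Rep_hol_inverse)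
qed

lemma holo_fun_add: "holo_fun U f \<Longrightarrow> holo_fun U g \<Longrightarrow> holo_fun U (\<lambda>x. f x + g x)"
  using holo_fun_sum[of UNIV U "\<lambda>b. if b then f else g"] by (auto simp: UNIV_bool add.commute)

lemma holo_fun_times: "holo_fun U f \<Longrightarrow> holo_fun U g \<Longrightarrow> holo_fun U (\<lambda>x. f x * g x)"
  unfolding holo_fun_def by (blast intro: holo_fun_mult)

lemma holo_fun_const: "holo_fun U (\<lambda>_. c)"
  by (rule hom_poly_holo[OF hom_poly_const])

lemma hol_of_eq_iff:
  "holo_fun open_polydisc f \<Longrightarrow> holo_fun open_polydisc g \<Longrightarrow>
    hol_of f = hol_of g \<longleftrightarrow> (\<forall>z\<in>open_polydisc. f z = g z)"
  by (subst Rep_hol_inject[symmetric]) (auto simp: Rep_hol_of fun_eq_iff)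

instantiation hol :: (finite) comm_ring_1
begin

definition "0 = hol_of (\<lambda>_. 0)"
definition "1 = hol_of (\<lambda>_. 1)"
definition "f + g = hol_of (\<lambda>z. Rep_hol f z + Rep_hol g z)"
definition "f * g = hol_of (\<lambda>z. Rep_hol f z * Rep_hol g z)"
definition "- f = hol_of (\<lambda>z. (-1) * Rep_hol f z)"
definition "f - g = hol_of (\<lambda>z. Rep_hol f z + (-1) * Rep_hol g z)"

lemmas hol_defs = zero_hol_def one_hol_def plus_hol_def times_hol_def uminus_hol_def minus_hol_def
lemmas hol_holo = holo_fun_add holo_fun_times holo_fun_const Rep_hol_holo

lemma Rep_hol_outside: "z \<notin> open_polydisc \<Longrightarrow> Rep_hol f z = 0"
  using Rep_hol[of f] by simp

lemma Rep_hol_ops: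
  "Rep_hol (0 :: 'a hol) z = 0" "Rep_hol (1 :: 'a hol) z = (if z \<in> open_polydisc then 1 else 0)"
  "Rep_hol (f + g) z = Rep_hol f z + Rep_hol g z" "Rep_hol (f * g) z = Rep_hol f z * Rep_hol g z"
  "Rep_hol (- f) z = - Rep_hol f z" "Rep_hol (f - g) z = Rep_hol f z - Rep_hol g z"
  unfolding hol_defs
  by (subst Rep_hol_of; (intro hol_holo)?; simp add: Rep_hol_outside)+

lemma hol_eqI: "(\<And>z. Rep_hol f z = Rep_hol g z) \<Longrightarrow> f = g"
  using Rep_hol_inject by blast

instance
proof
  fix a b c :: "'a hol"
  show "a + b + c = a + (b + c)" "a + b = b + a" "0 + a = a" "- a + a = 0" "a - b = a + - b"
    "a * b * c = a * (b * c)" "a * b = b * a" "(a + b) * c = a * c + b * c"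
    by (rule hol_eqI, simp add: Rep_hol_ops algebra_simps)+
  show "1 * a = a" by (rule hol_eqI) (simp add: Rep_hol_ops Rep_hol_outside)
  show "0 \<noteq> (1 :: 'a hol)"
    using open_polydisc(5) by (metis Rep_hol_ops(1,2) zero_neq_one)
qed

end

lemma hol_of_plus:
  "holo_fun open_polydisc f \<Longrightarrow> holo_fun open_polydisc g \<Longrightarrow> hol_of (\<lambda>z. f z + g z) = hol_of f + hol_of g"
  and hol_of_times:
  "holo_fun open_polydisc f \<Longrightarrow> holo_fun open_polydisc g \<Longrightarrow> hol_of (\<lambda>z. f z * g z) = hol_of f * hol_of g"
  by (rule hol_eqI; simp add: Rep_hol_ops Rep_hol_of hol_holo)+

lemma hol_of_zero: "hol_of (\<lambda>_. 0) = 0" and hol_of_one: "hol_of (\<lambda>_. 1) = 1"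
  by (simp_all add: hol_defs)

instance hol :: (finite) idom
proof
  fix f g :: "'a hol"
  assume fg: "f \<noteq> 0" "g \<noteq> 0"
  show "f * g \<noteq> 0"
  proof
    assume "f * g = 0"
    then have z: "Rep_hol f z * Rep_hol g z = 0" if "z \<in> open_polydisc" for z
      using that by (simp add: hol_defs hol_of_eq_iff hol_holo)
    have "hol_of (Rep_hol f) \<noteq> hol_of (\<lambda>_. 0)" using fg by (simp add: hol_of_Rep hol_of_zero)
    then obtain w where w: "w \<in> open_polydisc" "Rep_hol f w \<noteq> 0"
      by (auto simp: hol_of_eq_iff hol_holo)
    have "continuous_on open_polydisc (Rep_hol f)"
      using holo_fun_continuous[OF Rep_hol_holo[of f]] by (simp add: continuous_at_imp_continuous_on)
    then have N: "open (open_polydisc \<inter> Rep_hol f -` (-{0}))"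
      using open_polydisc(1) by (intro continuous_open_preimage) auto
    have "Rep_hol g v = 0" if "v \<in> open_polydisc" for v
      by (rule holo_fun_zero_on_convex[OF Rep_hol_holo open_polydisc(1,2) w(1) that N])
        (use w z in auto)
    then have "hol_of (Rep_hol g) = hol_of (\<lambda>_. 0)" by (simp add: hol_of_eq_iff hol_holo)
    then show False using fg by (simp add: hol_of_Rep hol_of_zero)
  qed
qed

instance hol :: (finite) ring_char_0
proof
  have of_nat: "of_nat n = (hol_of (\<lambda>_. of_nat n) :: 'a hol)" for n
    by (induction n) (simp_all add: hol_of_zero hol_of_plus[OF holo_fun_const holo_fun_const] hol_of_one)
  show "inj (of_nat :: nat \<Rightarrow> 'a hol)"
    using open_polydisc(5) by (auto simp: inj_def of_nat hol_of_eq_iff holo_fun_const)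
qed

instance fract :: ("{idom, ring_char_0}") field_char_0
  by standard (auto simp: inj_def of_nat_fract eq_fract)

context projective_cone
begin

text \<open>
  By the identity theorem, restriction to the image of a single chart is injective, so that any chart embeds
  the function field.
\<close>

definition base_chart :: "complex^'d option \<Rightarrow> complex^'n" where
  "base_chart = (SOME \<Phi>. holo_immersion (polydisc 1) \<Phi> \<and> \<Phi> ` polydisc 1 \<subseteq> M \<and>
     openin (top_of_set M) (\<Phi> ` open_polydisc))"

lemma base_chart: "holo_immersion (polydisc 1) base_chart" "base_chart ` polydisc 1 \<subseteq> M"
  "openin (top_of_set M) (base_chart ` open_polydisc)"
proof -
  obtain p where p: "p \<in> M" using M_nonempty by blast
  obtain \<Phi> :: "complex^'d option \<Rightarrow> complex^'n" where "holo_immersion (polydisc 1) \<Phi>"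
    "\<Phi> ` polydisc 1 \<subseteq> M \<inter> UNIV" "\<Phi> 0 = p" "openin (top_of_set M) (\<Phi> ` open_polydisc)"
    using chart[OF p open_UNIV UNIV_I] .
  then have "\<exists>\<Phi> :: complex^'d option \<Rightarrow> complex^'n. holo_immersion (polydisc 1) \<Phi> \<and> \<Phi> ` polydisc 1 \<subseteq> M \<and>
     openin (top_of_set M) (\<Phi> ` open_polydisc)" by auto
  from someI_ex[OF this]
  show "holo_immersion (polydisc 1) base_chart" "base_chart ` polydisc 1 \<subseteq> M"
    "openin (top_of_set M) (base_chart ` open_polydisc)" unfolding base_chart_def by blast+
qed

definition pull :: "(complex^'n \<Rightarrow> complex) \<Rightarrow> 'd option hol" where
  "pull P = hol_of (\<lambda>z. P (base_chart z))"

lemma pull_holo: "holo_fun UNIV P \<Longrightarrow> holo_fun open_polydisc (\<lambda>z. P (base_chart z))"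
  using immersion_holo[OF base_chart(1)] open_polydisc(4) by (auto simp: holo_fun_def)

lemma pull_plus: "holo_fun UNIV P \<Longrightarrow> holo_fun UNIV Q \<Longrightarrow> pull (\<lambda>x. P x + Q x) = pull P + pull Q"
  and pull_times: "holo_fun UNIV P \<Longrightarrow> holo_fun UNIV Q \<Longrightarrow> pull (\<lambda>x. P x * Q x) = pull P * pull Q"
  unfolding pull_def by (simp_all add: hol_of_plus hol_of_times pull_holo)

lemma pull_const: "pull (\<lambda>_. c) = hol_of (\<lambda>_. c)"
  by (simp add: pull_def)

lemma pull_eq_0_iff:
  assumes P: "holo_fun UNIV P"
  shows "pull P = 0 \<longleftrightarrow> (\<forall>x\<in>M. P x = 0)"
proof -
  have e: "pull P = 0 \<longleftrightarrow> (\<forall>z\<in>open_polydisc. P (base_chart z) = 0)"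
    unfolding pull_def hol_of_zero[symmetric] by (rule hol_of_eq_iff[OF pull_holo[OF P] holo_fun_const])
  show ?thesis
  proof
    assume "pull P = 0"
    then have 0: "P x = 0" if "x \<in> base_chart ` open_polydisc" for x using that e by auto
    have "base_chart ` open_polydisc \<noteq> {}" using open_polydisc(5) by blast
    then show "\<forall>x\<in>M. P x = 0" using identity_theorem[OF P base_chart(3) _ 0] by blast
  next
    assume "\<forall>x\<in>M. P x = 0"
    then show "pull P = 0" using e base_chart(2) open_polydisc(4) by blast
  qed
qed

lemma pull_eq_iff:
  assumes P: "P \<in> hom_poly k" and Q: "Q \<in> hom_poly k"
  shows "pull P = pull Q \<longleftrightarrow> (\<forall>x\<in>M. P x = Q x)"
proof -
  have Q1: "(\<lambda>x. -1 * Q x) \<in> hom_poly k" using Q by (rule hom_poly_scale)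
  have "pull (\<lambda>x. P x + -1 * Q x) = pull P + pull (\<lambda>_. -1) * pull Q"
    using hom_poly_holo[OF P] hom_poly_holo[OF Q1] hom_poly_holo[OF Q]
    by (simp only: pull_plus pull_times[OF holo_fun_const])
  moreover have "pull (\<lambda>_. -1) = -1"
  proof -
    have "pull (\<lambda>_. 1 + -1) = pull (\<lambda>_. 1) + pull (\<lambda>_. -1)"
      by (rule pull_plus[OF holo_fun_const holo_fun_const])
    then show ?thesis by (simp add: pull_const hol_of_one hol_of_zero eq_neg_iff_add_eq_0 add.commute)
  qed
  ultimately have "pull P = pull Q \<longleftrightarrow> pull (\<lambda>x. P x + -1 * Q x) = 0" by simp
  also have "\<dots> \<longleftrightarrow> (\<forall>x\<in>M. P x = Q x)"
    using pull_eq_0_iff[OF hom_poly_holo[OF hom_poly_add[OF P Q1]]] by simp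
  finally show ?thesis .
qed

definition rat :: "(complex^'n \<Rightarrow> complex) \<Rightarrow> (complex^'n \<Rightarrow> complex) \<Rightarrow> 'd option hol fract" where
  "rat P Q = Fract (pull P) (pull Q)"

definition function_field :: "'d option hol fract set" where
  "function_field = {rat P Q |P Q. (P, Q) \<in> ratfun_pairs M}"

lemma ratfun_pairsI: "P \<in> hom_poly e \<Longrightarrow> Q \<in> hom_poly e \<Longrightarrow> \<exists>x\<in>M. Q x \<noteq> 0 \<Longrightarrow> (P, Q) \<in> ratfun_pairs M"
  unfolding ratfun_pairs_def by blast

lemma rat_in_field: "(P, Q) \<in> ratfun_pairs M \<Longrightarrow> rat P Q \<in> function_field"
  unfolding function_field_def by blast

lemma pull_denominator: "Q \<in> hom_poly e \<Longrightarrow> \<exists>x\<in>M. Q x \<noteq> 0 \<Longrightarrow> pull Q \<noteq> 0"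
  using pull_eq_0_iff hom_poly_holo by blast

lemma rat_eq_iff:
  assumes "(P, Q) \<in> ratfun_pairs M" "(P', Q') \<in> ratfun_pairs M"
  shows "rat P Q = rat P' Q' \<longleftrightarrow> (\<forall>x\<in>M. P x * Q' x = P' x * Q x)"
proof -
  obtain e e' where e: "P \<in> hom_poly e" "Q \<in> hom_poly e" "\<exists>x\<in>M. Q x \<noteq> 0"
    and e': "P' \<in> hom_poly e'" "Q' \<in> hom_poly e'" "\<exists>x\<in>M. Q' x \<noteq> 0"
    using assms ratfun_pairsE by metis
  have "rat P Q = rat P' Q' \<longleftrightarrow> pull (\<lambda>x. P x * Q' x) = pull (\<lambda>x. P' x * Q x)"
    unfolding rat_def using pull_denominator[OF e(2,3)] pull_denominator[OF e'(2,3)] e e'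
    by (simp add: eq_fract pull_times hom_poly_holo)
  also have "\<dots> \<longleftrightarrow> (\<forall>x\<in>M. P x * Q' x = P' x * Q x)"
    using hom_poly_mult[OF e(1) e'(2)] hom_poly_mult[OF e'(1) e(2)]
    by (intro pull_eq_iff[of _ "e + e'"]) (simp_all add: add.commute)
  finally show ?thesis .
qed

lemma mult_nonzero_somewhere:
  assumes "P \<in> hom_poly j" "Q \<in> hom_poly k" "\<exists>x\<in>M. P x \<noteq> 0" "\<exists>x\<in>M. Q x \<noteq> 0"
  shows "\<exists>x\<in>M. P x * Q x \<noteq> 0"
  using hom_poly_zero_divisor[OF assms(1,2)] assms(3,4) by blast

lemma rat_plus:
  assumes "(P, Q) \<in> ratfun_pairs M" "(P', Q') \<in> ratfun_pairs M"
  shows "rat P Q + rat P' Q' = rat (\<lambda>x. P x * Q' x + P' x * Q x) (\<lambda>x. Q x * Q' x)"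
    and "((\<lambda>x. P x * Q' x + P' x * Q x), (\<lambda>x. Q x * Q' x)) \<in> ratfun_pairs M"
proof -
  obtain e e' where e: "P \<in> hom_poly e" "Q \<in> hom_poly e" "\<exists>x\<in>M. Q x \<noteq> 0"
    and e': "P' \<in> hom_poly e'" "Q' \<in> hom_poly e'" "\<exists>x\<in>M. Q' x \<noteq> 0"
    using assms ratfun_pairsE by metis
  have h: "(\<lambda>x. P x * Q' x) \<in> hom_poly (e + e')" "(\<lambda>x. P' x * Q x) \<in> hom_poly (e + e')"
    "(\<lambda>x. Q x * Q' x) \<in> hom_poly (e + e')"
    using hom_poly_mult[OF e(1) e'(2)] hom_poly_mult[OF e'(1) e(2)] hom_poly_mult[OF e(2) e'(2)]
    by (simp_all add: add.commute)
  show "rat P Q + rat P' Q' = rat (\<lambda>x. P x * Q' x + P' x * Q x) (\<lambda>x. Q x * Q' x)"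
    unfolding rat_def using pull_denominator[OF e(2,3)] pull_denominator[OF e'(2,3)] e e' h
    by (simp add: pull_times pull_plus hom_poly_holo)
  show "((\<lambda>x. P x * Q' x + P' x * Q x), (\<lambda>x. Q x * Q' x)) \<in> ratfun_pairs M"
    using h hom_poly_add mult_nonzero_somewhere[OF e(2) e'(2) e(3) e'(3)] by (intro ratfun_pairsI) auto
qed

lemma rat_times:
  assumes "(P, Q) \<in> ratfun_pairs M" "(P', Q') \<in> ratfun_pairs M"
  shows "rat P Q * rat P' Q' = rat (\<lambda>x. P x * P' x) (\<lambda>x. Q x * Q' x)"
    and "((\<lambda>x. P x * P' x), (\<lambda>x. Q x * Q' x)) \<in> ratfun_pairs M"
proof -
  obtain e e' where e: "P \<in> hom_poly e" "Q \<in> hom_poly e" "\<exists>x\<in>M. Q x \<noteq> 0"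
    and e': "P' \<in> hom_poly e'" "Q' \<in> hom_poly e'" "\<exists>x\<in>M. Q' x \<noteq> 0"
    using assms ratfun_pairsE by metis
  show "rat P Q * rat P' Q' = rat (\<lambda>x. P x * P' x) (\<lambda>x. Q x * Q' x)"
    unfolding rat_def using e e' by (simp add: pull_times hom_poly_holo)
  show "((\<lambda>x. P x * P' x), (\<lambda>x. Q x * Q' x)) \<in> ratfun_pairs M"
    using hom_poly_mult e e' mult_nonzero_somewhere[OF e(2) e'(2) e(3) e'(3)] by (intro ratfun_pairsI) auto
qed

lemma const_pair: "((\<lambda>_. c), (\<lambda>_. 1)) \<in> ratfun_pairs M"
  using M_nonempty by (intro ratfun_pairsI[OF hom_poly_const hom_poly_const]) auto

definition const :: "complex \<Rightarrow> 'd option hol fract" where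
  "const c = rat (\<lambda>_. c) (\<lambda>_. 1)"

lemma const_in_field: "const c \<in> function_field"
  unfolding const_def by (rule rat_in_field[OF const_pair])

lemma const_add: "const (a + b) = const a + const b"
  and const_mult: "const (a * b) = const a * const b"
  and const_0: "const 0 = 0" and const_1: "const 1 = 1"
  unfolding const_def rat_plus(1)[OF const_pair const_pair] rat_times(1)[OF const_pair const_pair]
  by (simp_all add: rat_def pull_const hol_of_zero hol_of_one Zero_fract_def One_fract_def)

lemma const_eq_0_iff: "const c = 0 \<longleftrightarrow> c = 0"
  unfolding const_0[symmetric] unfolding const_def rat_eq_iff[OF const_pair const_pair]
  using M_nonempty by auto

lemma const_sum: "const (sum f I) = (\<Sum>i\<in>I. const (f i))"
  by (induction I rule: infinite_finite_induct) (simp_all add: const_0 const_add)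

lemma const_of_nat: "const (of_nat n) = of_nat n"
  by (induction n) (simp_all add: const_0 const_add const_1)

lemma function_field_subfield: "is_subfield function_field"
  unfolding is_subfield_def
proof (intro conjI ballI)
  show "0 \<in> function_field" "1 \<in> function_field"
    using const_in_field[of 0] const_in_field[of 1] by (simp_all add: const_0 const_1)
  fix a b assume "a \<in> function_field" "b \<in> function_field"
  then obtain P Q P' Q' where ab: "a = rat P Q" "(P, Q) \<in> ratfun_pairs M"
    "b = rat P' Q'" "(P', Q') \<in> ratfun_pairs M" unfolding function_field_def by blast
  show "a + b \<in> function_field" unfolding ab rat_plus(1)[OF ab(2,4)] by (rule rat_in_field[OF rat_plus(2)[OF ab(2,4)]])
  show "a * b \<in> function_field" unfolding ab rat_times(1)[OF ab(2,4)] by (rule rat_in_field[OF rat_times(2)[OF ab(2,4)]])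
next
  fix a assume "a \<in> function_field"
  then obtain P Q where a: "a = rat P Q" "(P, Q) \<in> ratfun_pairs M" unfolding function_field_def by blast
  have "const (-1) = -1" using const_add[of 1 "-1"] by (simp add: const_0 const_1 eq_neg_iff_add_eq_0 add.commute)
  then have "- a = const (-1) * a" by simp
  also have "\<dots> \<in> function_field"
    unfolding a const_def rat_times(1)[OF const_pair a(2)]
    by (rule rat_in_field[OF rat_times(2)[OF const_pair a(2)]])
  finally show "- a \<in> function_field" .
  obtain e where e: "P \<in> hom_poly e" "Q \<in> hom_poly e" "\<exists>x\<in>M. Q x \<noteq> 0" using ratfun_pairsE[OF a(2)] by blast
  show "inverse a \<in> function_field"
  proof (cases "\<exists>x\<in>M. P x \<noteq> 0")
    case True
    have "inverse a = rat Q P" by (simp add: a rat_def)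
    then show ?thesis using rat_in_field[OF ratfun_pairsI[OF e(2,1) True]] by simp
  next
    case False
    then have "pull P = 0" using pull_eq_0_iff[OF hom_poly_holo[OF e(1)]] by blast
    then have "a = 0" by (simp add: a rat_def fract_collapse)
    then show ?thesis using const_in_field[of 0] by (simp add: const_0)
  qed
qed

text \<open>
  The pairs that give derivations of the function field; they need to be tangent to the cone only in the
  algebraic sense, which makes them closed under linear combinations over the function field.
\<close>

definition field_pairs :: "((complex^'n \<Rightarrow> complex^'n) \<times> (complex^'n \<Rightarrow> complex)) set" where
  "field_pairs = {(A, B). (\<exists>k. (\<forall>i. (\<lambda>x. A x $ i) \<in> hom_poly (Suc k)) \<and> B \<in> hom_poly k) \<and>
     (\<exists>x\<in>M. B x \<noteq> 0) \<and> tangent_to_ideal M A}"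

lemma field_pairsD:
  assumes "(A, B) \<in> field_pairs"
  shows "\<exists>k. (\<forall>i. (\<lambda>x. A x $ i) \<in> hom_poly (Suc k)) \<and> B \<in> hom_poly k"
    and "\<exists>x\<in>M. B x \<noteq> 0" and "tangent_to_ideal M A"
  using assms by (auto simp: field_pairs_def)

text \<open>
  The quotient rule, applied to an arbitrary fraction for the function.  The value \<open>0\<close> outside the function
  field makes equal derivations equal as total functions.
\<close>

definition der :: "(complex^'n \<Rightarrow> complex^'n) \<Rightarrow> (complex^'n \<Rightarrow> complex) \<Rightarrow> 'd option hol fract \<Rightarrow> 'd option hol fract" where
  "der A B a = (if a \<in> function_field then
     (let (P, Q) = (SOME (P, Q). (P, Q) \<in> ratfun_pairs M \<and> a = rat P Q)
      in rat (lie_num A P Q) (\<lambda>x. B x * Q x ^ 2)) else 0)"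

lemma lie_num_pair:
  assumes AB: "(A, B) \<in> field_pairs" and PQ: "(P, Q) \<in> ratfun_pairs M"
  shows "(lie_num A P Q, \<lambda>x. B x * Q x ^ 2) \<in> ratfun_pairs M"
proof -
  obtain k where "\<forall>i. (\<lambda>x. A x $ i) \<in> hom_poly (Suc k)" "B \<in> hom_poly k"
    using field_pairsD(1)[OF AB] by blast
  then have k: "\<And>i. (\<lambda>x. A x $ i) \<in> hom_poly (Suc k)" "B \<in> hom_poly k" "\<exists>x\<in>M. B x \<noteq> 0"
    "tangent_to_ideal M A"
    using field_pairsD(2,3)[OF AB] by auto
  obtain e where e: "P \<in> hom_poly e" "Q \<in> hom_poly e" "\<exists>x\<in>M. Q x \<noteq> 0" using ratfun_pairsE[OF PQ] by blast
  have "\<exists>x\<in>M. Q x ^ 2 \<noteq> 0" using e(3) by simp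
  note nz = mult_nonzero_somewhere[OF k(2) hom_poly_power[OF e(2)] k(3) this]
  have d: "k + 2 * e = e + (k + e)" by simp
  show ?thesis
    by (rule ratfun_pairsI[OF lie_num_hom_poly[OF k(1) e(1,2)]
          hom_poly_mult[OF k(2) hom_poly_power[OF e(2), of 2], unfolded d] nz])
qed

lemma der_rat:
  assumes AB: "(A, B) \<in> field_pairs" and PQ: "(P, Q) \<in> ratfun_pairs M"
  shows "der A B (rat P Q) = rat (lie_num A P Q) (\<lambda>x. B x * Q x ^ 2)"
proof -
  define s where "s = (SOME (P', Q'). (P', Q') \<in> ratfun_pairs M \<and> rat P Q = rat P' Q')"
  obtain P' Q' where s: "s = (P', Q')" by fastforce
  have "case s of (P', Q') \<Rightarrow> (P', Q') \<in> ratfun_pairs M \<and> rat P Q = rat P' Q'"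
    unfolding s_def by (rule someI[of _ "(P, Q)"]) (use PQ in simp)
  then have PQ': "(P', Q') \<in> ratfun_pairs M" and eq: "rat P Q = rat P' Q'" by (simp_all add: s)
  have d: "der A B (rat P Q) = rat (lie_num A P' Q') (\<lambda>x. B x * Q' x ^ 2)"
    unfolding der_def s_def[symmetric] using rat_in_field[OF PQ] by (simp add: s)
  obtain k where "\<forall>i. (\<lambda>x. A x $ i) \<in> hom_poly (Suc k)" "B \<in> hom_poly k"
    using field_pairsD(1)[OF AB] by blast
  then have k: "\<And>i. (\<lambda>x. A x $ i) \<in> hom_poly (Suc k)" "B \<in> hom_poly k" "\<exists>x\<in>M. B x \<noteq> 0"
    "tangent_to_ideal M A"
    using field_pairsD(2,3)[OF AB] by auto
  obtain e e' where e: "P \<in> hom_poly e" "Q \<in> hom_poly e" and e': "P' \<in> hom_poly e'" "Q' \<in> hom_poly e'"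
    using ratfun_pairsE[OF PQ] ratfun_pairsE[OF PQ'] by metis
  have "Q x ^ 2 * lie_num A P' Q' x = Q' x ^ 2 * lie_num A P Q x" if "x \<in> M" for x
    using eq rat_eq_iff[OF PQ PQ'] by (intro lie_num_cong_function[OF k(1,4) e e' _ that]) blast
  then show ?thesis
    unfolding d rat_eq_iff[OF lie_num_pair[OF AB PQ'] lie_num_pair[OF AB PQ]]
    by (simp add: mult_ac)
qed

lemma der_eq_0_iff:
  assumes AB: "(A, B) \<in> field_pairs" and PQ: "(P, Q) \<in> ratfun_pairs M"
  shows "der A B (rat P Q) = 0 \<longleftrightarrow> (\<forall>x\<in>M. lie_num A P Q x = 0)"
  unfolding der_rat[OF assms] const_0[symmetric] unfolding const_def
  unfolding rat_eq_iff[OF lie_num_pair[OF assms] const_pair] by simp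

lemma lie_num_add:
  assumes "P \<in> hom_poly e" "Q \<in> hom_poly e" "P' \<in> hom_poly e'" "Q' \<in> hom_poly e'"
  shows "lie_num A (\<lambda>x. P x * Q' x + P' x * Q x) (\<lambda>x. Q x * Q' x) x =
     Q' x ^ 2 * lie_num A P Q x + Q x ^ 2 * lie_num A P' Q' x"
proof -
  have h: "(\<lambda>x. P x * Q' x) \<in> hom_poly (e + e')" "(\<lambda>x. P' x * Q x) \<in> hom_poly (e + e')"
    using hom_poly_mult[OF assms(1,4)] hom_poly_mult[OF assms(3,2)] by (simp_all add: add.commute)
  show ?thesis
    unfolding lie_num_def lie_add[OF h] lie_mult[OF assms(1,4)] lie_mult[OF assms(3,2)]
      lie_mult[OF assms(2,4)] by (simp add: algebra_simps power2_eq_square)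
qed

lemma lie_num_mult:
  assumes "P \<in> hom_poly e" "Q \<in> hom_poly e" "P' \<in> hom_poly e'" "Q' \<in> hom_poly e'"
  shows "lie_num A (\<lambda>x. P x * P' x) (\<lambda>x. Q x * Q' x) x =
     Q' x * P' x * lie_num A P Q x + Q x * P x * lie_num A P' Q' x"
  unfolding lie_num_def lie_mult[OF assms(1,3)] lie_mult[OF assms(2,4)] by (simp add: algebra_simps)

lemma der_derivation:
  assumes AB: "(A, B) \<in> field_pairs"
  shows "derivation_on function_field (der A B)" "der A B (const c) = 0"
proof -
  show "der A B (const c) = 0"
  proof -
    have "lie_derivative A (\<lambda>_. c) x = 0" for c :: complex and x
      using lie_eq[of "\<lambda>_. c" 0 x A] by (simp add: pairing_0_left[abs_def])
    then show ?thesis unfolding const_def der_eq_0_iff[OF AB const_pair] by (simp add: lie_num_def)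
  qed
  show "derivation_on function_field (der A B)"
    unfolding derivation_on_def
  proof (intro conjI ballI)
    fix a assume "a \<in> function_field"
    then obtain P Q where a: "a = rat P Q" "(P, Q) \<in> ratfun_pairs M" unfolding function_field_def by blast
    show "der A B a \<in> function_field"
      unfolding a(1) der_rat[OF AB a(2)] by (rule rat_in_field[OF lie_num_pair[OF AB a(2)]])
    fix b assume "b \<in> function_field"
    then obtain P' Q' where b: "b = rat P' Q'" "(P', Q') \<in> ratfun_pairs M" unfolding function_field_def by blast
    obtain e e' where e: "P \<in> hom_poly e" "Q \<in> hom_poly e" and e': "P' \<in> hom_poly e'" "Q' \<in> hom_poly e'"
      using ratfun_pairsE[OF a(2)] ratfun_pairsE[OF b(2)] by metis
    note pa = lie_num_pair[OF AB a(2)] and pb = lie_num_pair[OF AB b(2)]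
    show "der A B (a + b) = der A B a + der A B b"
      unfolding a(1) b(1) rat_plus(1)[OF a(2) b(2)] der_rat[OF AB rat_plus(2)[OF a(2) b(2)]]
        der_rat[OF AB a(2)] der_rat[OF AB b(2)] rat_plus(1)[OF pa pb]
      unfolding rat_eq_iff[OF lie_num_pair[OF AB rat_plus(2)[OF a(2) b(2)]] rat_plus(2)[OF pa pb]]
        lie_num_add[OF e e'] by (simp add: algebra_simps power2_eq_square)
    note ta = rat_times[OF pa b(2)] and tb = rat_times[OF a(2) pb]
    show "der A B (a * b) = der A B a * b + a * der A B b"
      unfolding a(1) b(1) rat_times(1)[OF a(2) b(2)] der_rat[OF AB rat_times(2)[OF a(2) b(2)]]
        der_rat[OF AB a(2)] der_rat[OF AB b(2)] ta(1) tb(1) rat_plus(1)[OF ta(2) tb(2)]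
      unfolding rat_eq_iff[OF lie_num_pair[OF AB rat_times(2)[OF a(2) b(2)]] rat_plus(2)[OF ta(2) tb(2)]]
        lie_num_mult[OF e e'] by (simp add: algebra_simps power2_eq_square)
  qed
qed

lemma der_combination:
  assumes AB: "(A, B) \<in> field_pairs" and AB': "(A', B') \<in> field_pairs"
    and a: "a \<in> function_field" and b: "b \<in> function_field"
  shows "\<exists>A'' B''. (A'', B'') \<in> field_pairs \<and> (\<lambda>x. a * der A B x + b * der A' B' x) = der A'' B''"
proof -
  obtain P Q where PQ: "a = rat P Q" "(P, Q) \<in> ratfun_pairs M" using a unfolding function_field_def by blast
  obtain P' Q' where PQ': "b = rat P' Q'" "(P', Q') \<in> ratfun_pairs M" using b unfolding function_field_def by blast
  obtain e e' where e: "P \<in> hom_poly e" "Q \<in> hom_poly e" "\<exists>x\<in>M. Q x \<noteq> 0"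
    and e': "P' \<in> hom_poly e'" "Q' \<in> hom_poly e'" "\<exists>x\<in>M. Q' x \<noteq> 0"
    using ratfun_pairsE[OF PQ(2)] ratfun_pairsE[OF PQ'(2)] by metis
  obtain k where "\<forall>i. (\<lambda>x. A x $ i) \<in> hom_poly (Suc k)" "B \<in> hom_poly k"
    using field_pairsD(1)[OF AB] by blast
  then have k: "\<And>i. (\<lambda>x. A x $ i) \<in> hom_poly (Suc k)" "B \<in> hom_poly k" "\<exists>x\<in>M. B x \<noteq> 0"
    "tangent_to_ideal M A"
    using field_pairsD(2,3)[OF AB] by auto
  obtain k' where "\<forall>i. (\<lambda>x. A' x $ i) \<in> hom_poly (Suc k')" "B' \<in> hom_poly k'"
    using field_pairsD(1)[OF AB'] by blast
  then have k': "\<And>i. (\<lambda>x. A' x $ i) \<in> hom_poly (Suc k')" "B' \<in> hom_poly k'" "\<exists>x\<in>M. B' x \<noteq> 0"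
    "tangent_to_ideal M A'"
    using field_pairsD(2,3)[OF AB'] by auto
  define f where "f x = P x * (Q' x * B' x)" for x
  define g where "g x = P' x * (Q x * B x)" for x
  define A'' where "A'' x = f x *s A x + g x *s A' x" for x
  define B'' where "B'' x = (Q x * Q' x) * (B x * B' x)" for x
  have lieA: "lie_derivative A'' F x = f x * lie_derivative A F x + g x * lie_derivative A' F x" if F: "F \<in> hom_poly m" for F m x
    unfolding A''_def[abs_def]
    by (simp add: lie_field_add[OF F, of "\<lambda>x. f x *s A x" "\<lambda>x. g x *s A' x"] lie_field_smult[OF F])
  have deg: "(\<lambda>x. f x * A x $ i) \<in> hom_poly (Suc (e + e' + (k + k')))"
    "(\<lambda>x. g x * A' x $ i) \<in> hom_poly (Suc (e + e' + (k + k')))" for i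
  proof -
    have "(\<lambda>x. f x * A x $ i) \<in> hom_poly (e + (e' + k') + Suc k)" unfolding f_def
      by (intro hom_poly_mult e e' k k')
    then show "(\<lambda>x. f x * A x $ i) \<in> hom_poly (Suc (e + e' + (k + k')))" by (simp add: ac_simps)
    have "(\<lambda>x. g x * A' x $ i) \<in> hom_poly (e' + (e + k) + Suc k')" unfolding g_def
      by (intro hom_poly_mult e e' k k')
    then show "(\<lambda>x. g x * A' x $ i) \<in> hom_poly (Suc (e + e' + (k + k')))" by (simp add: ac_simps)
  qed
  have "(\<lambda>x. A'' x $ i) \<in> hom_poly (Suc (e + e' + (k + k')))" for i
    using hom_poly_add[OF deg[of i]] by (simp add: A''_def)
  moreover have "B'' \<in> hom_poly (e + e' + (k + k'))" unfolding B''_def[abs_def]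
    by (intro hom_poly_mult e e' k k')
  moreover have "\<exists>x\<in>M. B'' x \<noteq> 0" unfolding B''_def
    by (rule mult_nonzero_somewhere[OF hom_poly_mult[OF e(2) e'(2)] hom_poly_mult[OF k(2) k'(2)]
          mult_nonzero_somewhere[OF e(2) e'(2) e(3) e'(3)] mult_nonzero_somewhere[OF k(2) k'(2) k(3) k'(3)]])
  moreover have "tangent_to_ideal M A''"
    unfolding tangent_to_ideal_def
  proof (intro allI impI ballI)
    fix F m x assume F: "F \<in> hom_poly m" "\<forall>x\<in>M. F x = 0" and x: "x \<in> M"
    have "lie_derivative A F x = 0" "lie_derivative A' F x = 0" using k(4) k'(4) F x unfolding tangent_to_ideal_def by blast+
    then show "lie_derivative A'' F x = 0" by (simp add: lieA[OF F(1)])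
  qed
  ultimately have AB'': "(A'', B'') \<in> field_pairs" unfolding field_pairs_def by blast
  have "a * der A B y + b * der A' B' y = der A'' B'' y" for y
  proof (cases "y \<in> function_field")
    case False
    then show ?thesis by (simp add: der_def)
  next
    case True
    then obtain R S where RS: "y = rat R S" "(R, S) \<in> ratfun_pairs M" unfolding function_field_def by blast
    obtain m where m: "R \<in> hom_poly m" "S \<in> hom_poly m" using ratfun_pairsE[OF RS(2)] by blast
    have l: "lie_num A'' R S x = f x * lie_num A R S x + g x * lie_num A' R S x" for x
      unfolding lie_num_def lieA[OF m(1)] lieA[OF m(2)] by (simp add: algebra_simps)
    note p1 = lie_num_pair[OF AB RS(2)] and p2 = lie_num_pair[OF AB' RS(2)]
    note t1 = rat_times[OF PQ(2) p1] and t2 = rat_times[OF PQ'(2) p2]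
    show ?thesis
      unfolding PQ(1) PQ'(1) RS(1) der_rat[OF AB RS(2)] der_rat[OF AB' RS(2)] der_rat[OF AB'' RS(2)]
        t1(1) t2(1) rat_plus(1)[OF t1(2) t2(2)]
      unfolding rat_eq_iff[OF rat_plus(2)[OF t1(2) t2(2)] lie_num_pair[OF AB'' RS(2)]] l
      by (simp add: f_def g_def B''_def algebra_simps power2_eq_square)
  qed
  then show ?thesis using AB'' by blast
qed

end

section \<open>Weights independent over the integers\<close>

text \<open>
  Only countably many numbers are roots of nonzero polynomials with integer coefficients.
\<close>

lemma exists_transcendental:
  "\<exists>t :: complex. \<forall>(a :: nat \<Rightarrow> int) d. (\<Sum>i<d. of_int (a i) * t ^ i) = 0 \<longrightarrow> (\<forall>i<d. a i = 0)"
proof -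
  define R where "R xs = {t :: complex. (\<Sum>i<length xs. of_int (xs ! i) * t ^ i) = 0}" for xs :: "int list"
  have fin: "finite (R xs)" if "\<exists>x\<in>set xs. x \<noteq> 0" for xs
  proof -
    from that obtain j where j: "j < length xs" "xs ! j \<noteq> 0" by (metis in_set_conv_nth)
    then obtain n where n: "length xs = Suc n" by (cases xs) auto
    have "finite {t. (\<Sum>i\<le>n. complex_of_int (xs ! i) * t ^ i) = 0}"
      unfolding polyfun_finite_roots using j n by (intro exI[of _ j]) auto
    then show ?thesis by (simp add: R_def n lessThan_Suc_atMost)
  qed
  define Z where "Z = (\<Union>xs\<in>{xs. \<exists>x\<in>set xs. x \<noteq> 0}. R xs)"
  have "countable Z" unfolding Z_def
    using fin by (intro countable_UN) (auto intro: countable_finite)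
  then have "Z \<noteq> UNIV" using uncountable_UNIV_complex by auto
  then obtain t where t: "t \<notin> Z" by blast
  have "\<forall>i<d. a i = 0" if s: "(\<Sum>i<d. of_int (a i) * t ^ i) = 0" for a :: "nat \<Rightarrow> int" and d
  proof (rule ccontr)
    assume "\<not> ?thesis"
    then obtain i where i: "i < d" "a i \<noteq> 0" by blast
    define xs where "xs = map a [0..<d]"
    have "a i \<in> set xs" using i(1) by (simp add: xs_def)
    then have "\<exists>x\<in>set xs. x \<noteq> 0" using i(2) by blast
    moreover have "t \<in> R xs" using s by (simp add: R_def xs_def)
    ultimately have "t \<in> Z" unfolding Z_def by blast
    with t show False by simp
  qed
  then show ?thesis by (intro exI[of _ t]) blast
qed

context projective_cone
begin

text \<open>
  Powers of a transcendental number are linearly independent over the integers.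
\<close>

lemma exists_weights:
  "\<exists>\<tau> :: nat \<Rightarrow> 'd option hol fract. (\<forall>i. \<tau> i \<in> range const) \<and>
    (\<forall>\<alpha> \<beta> :: nat \<Rightarrow> nat. (\<Sum>i<d. of_nat (\<alpha> i) * \<tau> i) = (\<Sum>i<d. of_nat (\<beta> i) * \<tau> i) \<longrightarrow> (\<forall>i<d. \<alpha> i = \<beta> i))"
proof -
  obtain t :: complex where t: "\<And>(a :: nat \<Rightarrow> int) d. (\<Sum>i<d. of_int (a i) * t ^ i) = 0 \<Longrightarrow> \<forall>i<d. a i = 0"
    using exists_transcendental by blast
  have "\<forall>i<d. \<alpha> i = \<beta> i"
    if eq: "(\<Sum>i<d. of_nat (\<alpha> i) * const (t ^ i)) = (\<Sum>i<d. of_nat (\<beta> i) * const (t ^ i))" for \<alpha> \<beta> :: "nat \<Rightarrow> nat"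
  proof -
    have e: "(\<Sum>i<d. of_nat (\<gamma> i) * const (t ^ i)) = const (\<Sum>i<d. of_nat (\<gamma> i) * t ^ i)" for \<gamma> :: "nat \<Rightarrow> nat"
      by (simp add: const_sum const_mult const_of_nat)
    have "const ((\<Sum>i<d. of_nat (\<alpha> i) * t ^ i) - (\<Sum>i<d. of_nat (\<beta> i) * t ^ i))
        + const (\<Sum>i<d. of_nat (\<beta> i) * t ^ i) = const (\<Sum>i<d. of_nat (\<alpha> i) * t ^ i)"
      by (simp flip: const_add)
    then have "const ((\<Sum>i<d. of_nat (\<alpha> i) * t ^ i) - (\<Sum>i<d. of_nat (\<beta> i) * t ^ i)) = 0"
      using eq unfolding e by simp
    then have "(\<Sum>i<d. of_nat (\<alpha> i) * t ^ i) - (\<Sum>i<d. of_nat (\<beta> i) * t ^ i) = 0"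
      by (simp only: const_eq_0_iff)
    then have "(\<Sum>i<d. of_int (int (\<alpha> i) - int (\<beta> i)) * t ^ i) = 0"
      by (simp add: sum_subtractf left_diff_distrib)
    from t[OF this] show ?thesis by simp
  qed
  then show ?thesis by (intro exI[of _ "\<lambda>i. const (t ^ i)"]) auto
qed

section \<open>Algebraic dependence and coordinates in the function field\<close>

lemma Fract_prod: "pull Q \<noteq> 0 \<Longrightarrow> Fract (pull P) (pull Q) * Fract (pull Q) 1 = Fract (pull P) 1"
  by (simp add: eq_fract mult.commute)

lemma pull_prod:
  assumes "\<And>i. i \<in> I \<Longrightarrow> holo_fun UNIV (P i)"
  shows "holo_fun UNIV (\<lambda>x. \<Prod>i\<in>I. P i x) \<and> pull (\<lambda>x. \<Prod>i\<in>I. P i x) = (\<Prod>i\<in>I. pull (P i))"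
  using assms
proof (induction I rule: infinite_finite_induct)
  case (insert i I)
  then show ?case by (simp add: holo_fun_times pull_times)
qed (simp_all add: holo_fun_const pull_const hol_of_one)

lemma pull_power:
  assumes "holo_fun UNIV P"
  shows "holo_fun UNIV (\<lambda>x. P x ^ n) \<and> pull (\<lambda>x. P x ^ n) = pull P ^ n"
  by (induction n) (simp_all add: assms holo_fun_const holo_fun_times pull_times pull_const hol_of_one)

lemma pull_sum:
  assumes "\<And>i. i \<in> I \<Longrightarrow> holo_fun UNIV (P i)"
  shows "holo_fun UNIV (\<lambda>x. \<Sum>i\<in>I. P i x) \<and> pull (\<lambda>x. \<Sum>i\<in>I. P i x) = (\<Sum>i\<in>I. pull (P i))"
  using assms
proof (induction I rule: infinite_finite_induct)
  case (insert i I)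
  then show ?case by (simp add: holo_fun_add pull_plus)
qed (simp_all add: holo_fun_const pull_const hol_of_zero)

lemma Fract_sum: "(\<Sum>i\<in>I. Fract (f i) 1) = Fract (\<Sum>i\<in>I. f i) (1 :: 'a::idom)"
  by (induction I rule: infinite_finite_induct) (simp_all add: Zero_fract_def)

lemma Fract_prod1: "(\<Prod>i\<in>I. Fract (f i) 1) = Fract (\<Prod>i\<in>I. f i) (1 :: 'a::idom)"
  by (induction I rule: infinite_finite_induct) (simp_all add: One_fract_def)

lemma Fract_power1: "Fract f 1 ^ n = Fract (f ^ n) (1 :: 'a::idom)"
  by (induction n) (simp_all add: One_fract_def)

lemma some_coordinate: obtains i where "\<exists>x\<in>M. x $ i \<noteq> 0"
proof -
  obtain p where p: "p \<in> M" using M_nonempty by blast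
  then have "p \<noteq> 0" by (rule M_nonzero)
  then obtain i where "p $ i \<noteq> 0" by (auto simp: vec_eq_iff)
  then show thesis using p that by blast
qed

text \<open>
  Written with a common denominator, functions become forms of the same degree; the denominator is
  one more form, whose exponent is determined by the others because the relation is homogeneous.
\<close>

lemma functions_algebraically_dependent:
  fixes f :: "nat \<Rightarrow> 'd option hol fract"
  assumes f: "\<forall>i\<le>CARD('d). f i \<in> function_field"
  shows "\<exists>A c. finite A \<and> (\<exists>\<alpha>\<in>A. c \<alpha> \<noteq> 0) \<and> (\<forall>\<alpha>\<in>A. c \<alpha> \<in> range const) \<and>
    (\<forall>\<alpha>\<in>A. \<forall>\<beta>\<in>A. (\<forall>i\<le>CARD('d). \<alpha> i = \<beta> i) \<longrightarrow> \<alpha> = \<beta>) \<and>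
    (\<Sum>\<alpha>\<in>A. c \<alpha> * (\<Prod>i\<le>CARD('d). f i ^ \<alpha> i)) = 0"
proof -
  define d where "d = CARD('d)"
  have "\<forall>i\<in>{..d}. \<exists>P Q e. f i = rat P Q \<and> P \<in> hom_poly e \<and> Q \<in> hom_poly e \<and> (\<exists>x\<in>M. Q x \<noteq> 0)"
    using f unfolding function_field_def ratfun_pairs_def d_def by blast
  then obtain P Q e where PQ: "\<And>i. i \<in> {..d} \<Longrightarrow> f i = rat (P i) (Q i) \<and> P i \<in> hom_poly (e i) \<and>
      Q i \<in> hom_poly (e i) \<and> (\<exists>x\<in>M. Q i x \<noteq> 0)" by metis
  obtain j0 where j0: "\<exists>x\<in>M. x $ j0 \<noteq> 0" using some_coordinate .
  \<comment> \<open>The factor \<open>x $ j0\<close> only serves to make the degree positive.\<close>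
  define R where "R x = x $ j0 * (\<Prod>i\<le>d. Q i x)" for x
  define N where "N i x = x $ j0 * (P i x * (\<Prod>l\<in>{..d} - {i}. Q l x))" for i x
  define E where "E = 1 + sum e {..d}"
  have R: "R \<in> hom_poly E" unfolding R_def[abs_def] E_def
    using PQ by (intro hom_poly_mult hom_poly_coord hom_poly_prod) blast
  have N: "N i \<in> hom_poly E" if "i \<in> {..d}" for i
  proof -
    have "N i \<in> hom_poly (1 + (e i + sum e ({..d} - {i})))" unfolding N_def[abs_def]
      using PQ that by (intro hom_poly_mult hom_poly_coord hom_poly_prod) auto
    then show ?thesis using that by (simp add: E_def sum.remove[of "{..d}" i e])
  qed
  have Rne: "\<exists>x\<in>M. R x \<noteq> 0" unfolding R_def
  proof (rule mult_nonzero_somewhere[OF hom_poly_coord hom_poly_prod j0])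
    show "\<exists>x\<in>M. (\<Prod>i\<le>d. Q i x) \<noteq> 0" by (rule prod_nonzero_somewhere) (use PQ in auto)
  qed (use PQ in blast)
  have fN: "f i = rat (N i) R" if i: "i \<in> {..d}" for i
  proof -
    have "rat (P i) (Q i) = rat (N i) R"
    proof (subst rat_eq_iff)
      show "(P i, Q i) \<in> ratfun_pairs M" using PQ[OF i] ratfun_pairsI by blast
      show "(N i, R) \<in> ratfun_pairs M" using N[OF i] R Rne ratfun_pairsI by blast
      show "\<forall>x\<in>M. P i x * R x = N i x * Q i x"
        using i by (simp add: R_def N_def prod.remove[of "{..d}" i])
    qed
    then show ?thesis using PQ[OF i] by simp
  qed
  define P' where "P' i = (if i \<le> d then N i else R)" for i
  have P': "P' i \<in> hom_poly E" for i using N R by (simp add: P'_def)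
  have "E > 0" by (simp add: E_def)
  have "card {..Suc d} = CARD('d option) + 1" by (simp add: d_def)
  from forms_algebraically_dependent[where P = P', OF finite_atMost this P' \<open>E > 0\<close>]
  obtain m c where c: "\<exists>\<alpha>\<in>exponents {..Suc d} m. c \<alpha> \<noteq> 0"
    "\<And>x. x \<in> M \<Longrightarrow> (\<Sum>\<alpha>\<in>exponents {..Suc d} m. c \<alpha> * (\<Prod>i\<le>Suc d. P' i x ^ \<alpha> i)) = 0" by blast
  define X where "X = exponents {..Suc d} m"
  define \<xi> where "\<xi> i = Fract (pull (P' i)) 1" for i
  define \<rho> where "\<rho> = Fract (pull R) 1"
  have h: "holo_fun UNIV (P' i)" for i by (rule hom_poly_holo[OF P'])
  have pR: "pull R \<noteq> 0" by (rule pull_denominator[OF R Rne])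
  have \<rho>0: "\<rho> \<noteq> 0" using pR by (simp add: \<rho>_def Zero_fract_def eq_fract)
  have \<xi>f: "\<xi> i = f i * \<rho>" if "i \<le> d" for i
    using Fract_prod[OF pR, of "N i"] fN[of i] that by (simp add: \<xi>_def \<rho>_def rat_def P'_def)
  have \<xi>d: "\<xi> (Suc d) = \<rho>" by (simp add: \<xi>_def \<rho>_def P'_def)
  have constF: "const a = Fract (hol_of (\<lambda>_. a)) 1" for a
    by (simp add: const_def rat_def pull_const hol_of_one)
  have hp: "holo_fun UNIV (\<lambda>x. \<Prod>i\<le>Suc d. P' i x ^ \<alpha> i)" for \<alpha>
    using pull_prod[of "{..Suc d}" "\<lambda>i x. P' i x ^ \<alpha> i"] pull_power[OF h] by blast
  have "0 = Fract (pull (\<lambda>x. \<Sum>\<alpha>\<in>X. c \<alpha> * (\<Prod>i\<le>Suc d. P' i x ^ \<alpha> i))) 1"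
  proof -
    have "holo_fun UNIV (\<lambda>x. \<Sum>\<alpha>\<in>X. c \<alpha> * (\<Prod>i\<le>Suc d. P' i x ^ \<alpha> i))"
      by (intro holo_fun_sum holo_fun_times holo_fun_const hp)
    then have "pull (\<lambda>x. \<Sum>\<alpha>\<in>X. c \<alpha> * (\<Prod>i\<le>Suc d. P' i x ^ \<alpha> i)) = 0"
      using pull_eq_0_iff c(2) by (simp add: X_def)
    then show ?thesis by (simp add: Zero_fract_def)
  qed
  also have "pull (\<lambda>x. \<Sum>\<alpha>\<in>X. c \<alpha> * (\<Prod>i\<le>Suc d. P' i x ^ \<alpha> i)) =
      (\<Sum>\<alpha>\<in>X. hol_of (\<lambda>_. c \<alpha>) * (\<Prod>i\<le>Suc d. pull (P' i) ^ \<alpha> i))"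
  proof -
    have "pull (\<lambda>x. c \<alpha> * (\<Prod>i\<le>Suc d. P' i x ^ \<alpha> i)) = hol_of (\<lambda>_. c \<alpha>) * (\<Prod>i\<le>Suc d. pull (P' i) ^ \<alpha> i)" for \<alpha>
      using pull_times[OF holo_fun_const hp, of "c \<alpha>" \<alpha>] pull_power[OF h]
        pull_prod[of "{..Suc d}" "\<lambda>i x. P' i x ^ \<alpha> i"] by (simp add: pull_const)
    then show ?thesis
      using pull_sum[of X "\<lambda>\<alpha> x. c \<alpha> * (\<Prod>i\<le>Suc d. P' i x ^ \<alpha> i)"] holo_fun_times[OF holo_fun_const hp] by simp
  qed
  also have "Fract \<dots> 1 = (\<Sum>\<alpha>\<in>X. const (c \<alpha>) * (\<Prod>i\<le>Suc d. \<xi> i ^ \<alpha> i))"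
    by (simp add: Fract_sum[symmetric] Fract_prod1 Fract_power1 \<xi>_def constF del: prod.atMost_Suc)
  also have "\<dots> = (\<Sum>\<alpha>\<in>X. const (c \<alpha>) * (\<Prod>i\<le>d. f i ^ \<alpha> i) * \<rho> ^ m)"
  proof (intro sum.cong refl)
    fix \<alpha> assume a: "\<alpha> \<in> X"
    have "(\<Prod>i\<le>Suc d. \<xi> i ^ \<alpha> i) = (\<Prod>i\<le>d. f i ^ \<alpha> i * \<rho> ^ \<alpha> i) * \<rho> ^ \<alpha> (Suc d)"
      using \<xi>f \<xi>d by (simp add: power_mult_distrib)
    also have "\<dots> = (\<Prod>i\<le>d. f i ^ \<alpha> i) * \<rho> ^ (sum \<alpha> {..d} + \<alpha> (Suc d))"
      by (simp add: prod.distrib power_sum power_add)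
    also have "sum \<alpha> {..d} + \<alpha> (Suc d) = m" using a by (simp add: X_def exponents_def)
    finally show "const (c \<alpha>) * (\<Prod>i\<le>Suc d. \<xi> i ^ \<alpha> i) = const (c \<alpha>) * (\<Prod>i\<le>d. f i ^ \<alpha> i) * \<rho> ^ m" by simp
  qed
  finally have "(\<Sum>\<alpha>\<in>X. const (c \<alpha>) * (\<Prod>i\<le>d. f i ^ \<alpha> i)) * \<rho> ^ m = 0" by (simp add: sum_distrib_right)
  then have "(\<Sum>\<alpha>\<in>X. const (c \<alpha>) * (\<Prod>i\<le>d. f i ^ \<alpha> i)) = 0" using \<rho>0 by simp
  moreover have "finite X" unfolding X_def by (rule finite_exponents_on) simp
  moreover have "\<exists>\<alpha>\<in>X. const (c \<alpha>) \<noteq> 0" using c(1) by (simp add: X_def const_eq_0_iff)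
  moreover have "\<forall>\<alpha>\<in>X. \<forall>\<beta>\<in>X. (\<forall>i\<le>d. \<alpha> i = \<beta> i) \<longrightarrow> \<alpha> = \<beta>"
  proof (intro ballI impI ext)
    fix \<alpha> \<beta> i assume ab: "\<alpha> \<in> X" "\<beta> \<in> X" "\<forall>i\<le>d. \<alpha> i = \<beta> i"
    then have "sum \<alpha> {..d} = sum \<beta> {..d}" by (intro sum.cong) auto
    then have "\<alpha> (Suc d) = \<beta> (Suc d)" using ab(1,2) by (simp add: X_def exponents_def)
    moreover have "i \<le> d \<or> i = Suc d \<or> i > Suc d" by linarith
    moreover have "\<alpha> i = 0 \<and> \<beta> i = 0" if "i > Suc d"
      using ab(1,2) that by (auto simp: X_def exponents_def)
    ultimately show "\<alpha> i = \<beta> i" using ab(3) by (elim disjE) simp_all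
  qed
  ultimately show ?thesis unfolding d_def by (intro exI[of _ X] exI[of _ "\<lambda>\<alpha>. const (c \<alpha>)"]) blast
qed

lemma lie_coordinate: "lie_derivative A (\<lambda>x. x $ i) x = A x $ i"
proof -
  have "((\<lambda>x. x $ i) has_derivative (\<lambda>h. h $ i)) (at x)"
    by (rule bounded_linear_imp_has_derivative) (rule bounded_linear_vec_nth)
  then show ?thesis unfolding lie_derivative_def using frechet_derivative_at by metis
qed

text \<open>
  Coordinate vector fields: the independent coordinates are varied one at a time, and the others follow
  by their equations.
\<close>

definition coordinate_fields ::
    "'n set \<Rightarrow> (complex^'n \<Rightarrow> complex) \<Rightarrow> nat \<Rightarrow> ('n \<Rightarrow> complex^'n \<Rightarrow> complex^'n) \<Rightarrow> bool" where
  "coordinate_fields I B b A \<longleftrightarrow> card I = CARD('d option) \<and> B \<in> hom_poly b \<and> (\<exists>x\<in>M. B x \<noteq> 0) \<and>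
     (\<forall>i j. (\<lambda>x. A i x $ j) \<in> hom_poly b) \<and>
     (\<forall>i\<in>I. \<forall>j\<in>I. \<forall>x. A i x $ j = (if i = j then B x else 0)) \<and>
     (\<forall>i\<in>I. \<forall>x\<in>M. B x \<noteq> 0 \<longrightarrow> A i x \<in> tangent_space M x) \<and>
     (\<forall>X. \<forall>x\<in>M. tangent_to_ideal M X \<longrightarrow> B x \<noteq> 0 \<longrightarrow> X x \<in> tangent_space M x)"

lemma coordinate_fieldsD:
  assumes "coordinate_fields I B b A"
  shows "card I = CARD('d option)" "B \<in> hom_poly b" "\<exists>x\<in>M. B x \<noteq> 0"
    "(\<lambda>x. A i x $ j) \<in> hom_poly b"
    "i \<in> I \<Longrightarrow> j \<in> I \<Longrightarrow> A i x $ j = (if i = j then B x else 0)"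
    "i \<in> I \<Longrightarrow> x \<in> M \<Longrightarrow> B x \<noteq> 0 \<Longrightarrow> A i x \<in> tangent_space M x"
    "tangent_to_ideal M X \<Longrightarrow> x \<in> M \<Longrightarrow> B x \<noteq> 0 \<Longrightarrow> X x \<in> tangent_space M x"
  using assms by (simp_all add: coordinate_fields_def)

lemma coordinate_fields_exist: "\<exists>I B b A. coordinate_fields I B b A"
proof -
  obtain I F d G where eqs: "coordinate_equations I F d G" using coordinate_equations_exist by blast
  note e = eqs[unfolded coordinate_equations_def]
  have Gh: "(\<lambda>x. G j x $ k) \<in> hom_poly (d j - 1)" if "j \<notin> I" for j k
    using e that is_gradientD(2) by blast
  define B where "B x = (\<Prod>j\<in>-I. G j x $ j)" for x
  define C where "C j x = (\<Prod>l\<in>-I-{j}. G l x $ l)" for j x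
  define b where "b = (\<Sum>j\<in>-I. d j - 1)"
  define A where "A i x = (\<chi> l. if l \<in> I then (if l = i then B x else 0) else - 1 * (G l x $ i * C l x))" for i x
  have Bh: "B \<in> hom_poly b" unfolding B_def[abs_def] b_def by (intro hom_poly_prod Gh) simp
  have Bne: "\<exists>x\<in>M. B x \<noteq> 0" unfolding B_def
  proof (rule prod_nonzero_somewhere)
    show "(\<lambda>x. G j x $ j) \<in> hom_poly (d j - 1) \<and> (\<exists>x\<in>M. G j x $ j \<noteq> 0)" if "j \<in> -I" for j
      using Gh e that by blast
  qed simp
  have BC: "B x = G j x $ j * C j x" if "j \<notin> I" for j x
    unfolding B_def C_def using that by (intro prod.remove) auto
  have Ah: "(\<lambda>x. A i x $ l) \<in> hom_poly b" for i l
  proof (cases "l \<in> I")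
    case True
    then show ?thesis using Bh hom_poly_0[of b] by (cases "l = i") (simp_all add: A_def)
  next
    case False
    have "(\<lambda>x. G l x $ i * C l x) \<in> hom_poly ((d l - 1) + (\<Sum>j\<in>-I-{l}. d j - 1))"
      unfolding C_def using False by (intro hom_poly_mult hom_poly_prod Gh) auto
    moreover have "(d l - 1) + (\<Sum>j\<in>-I-{l}. d j - 1) = b"
      unfolding b_def using False by (intro sum.remove[symmetric]) auto
    ultimately have "(\<lambda>x. - 1 * (G l x $ i * C l x)) \<in> hom_poly b" by (metis (no_types) hom_poly_scale)
    then show ?thesis using False by (simp add: A_def)
  qed
  have nz: "G j x $ j \<noteq> 0" if "B x \<noteq> 0" "j \<notin> I" for j x
    using that BC[of j x] by auto
  have pair0: "pairing (G j x) (A i x) = 0" if i: "i \<in> I" and j: "j \<notin> I" for i j x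
  proof -
    have "pairing (G j x) (A i x) = (\<Sum>k\<in>{i, j}. G j x $ k * A i x $ k)"
      unfolding pairing_def
    proof (rule sum.mono_neutral_right)
      show "\<forall>k\<in>UNIV - {i, j}. G j x $ k * A i x $ k = 0"
      proof
        fix k assume k: "k \<in> UNIV - {i, j}"
        show "G j x $ k * A i x $ k = 0"
        proof (cases "k \<in> I")
          case True
          then show ?thesis using k by (simp add: A_def)
        next
          case False
          then have "G j x $ k = 0" using k e j by auto
          then show ?thesis by simp
        qed
      qed
    qed auto
    also have "\<dots> = G j x $ i * A i x $ i + G j x $ j * A i x $ j" using i j by (subst sum.insert) auto
    also have "\<dots> = 0" using i j BC[OF j, of x] by (simp add: A_def)
    finally show ?thesis .
  qed
  have "coordinate_fields I B b A"
    unfolding coordinate_fields_def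
  proof (intro conjI allI ballI impI)
    obtain p where "p \<in> M" "B p \<noteq> 0" using Bne by blast
    then show "card I = CARD('d option)" using tangent_space_from_equations(1)[OF eqs] nz by blast
    show "B \<in> hom_poly b" by (rule Bh)
    show "\<exists>x\<in>M. B x \<noteq> 0" by (rule Bne)
    show "(\<lambda>x. A i x $ j) \<in> hom_poly b" for i j by (rule Ah)
    show "A i x $ j = (if i = j then B x else 0)" if "i \<in> I" "j \<in> I" for i j x using that by (simp add: A_def)
    show "A i x \<in> tangent_space M x" if "i \<in> I" "x \<in> M" "B x \<noteq> 0" for i x
      by (rule tangent_space_from_equations(2)[OF eqs that(2) nz[OF that(3)]]) (use pair0 that in auto)
    show "X x \<in> tangent_space M x" if "tangent_to_ideal M X" "x \<in> M" "B x \<noteq> 0" for X x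
    proof (rule tangent_space_from_equations(2)[OF eqs that(2) nz[OF that(3)]])
      fix j assume j: "j \<notin> I"
      have "lie_derivative X (F j) x = 0" using that e j unfolding tangent_to_ideal_def by blast
      moreover have "is_gradient (d j) (F j) (G j)" using e j by blast
      ultimately show "pairing (G j x) (X x) = 0" using lie_eq[OF is_gradientD(1)] by metis
    qed
  qed
  then show ?thesis by blast
qed

lemma dual_derivations:
  "\<exists>z D. (\<forall>i<CARD('d). z i \<in> function_field \<and> (\<exists>A B. (A, B) \<in> field_pairs \<and> D i = der A B)) \<and>
     (\<forall>i<CARD('d). \<forall>j<CARD('d). D i (z j) = (if i = j then 1 else 0))"
proof -
  obtain I B b A where "coordinate_fields I B b A" using coordinate_fields_exist by blast
  note I = coordinate_fieldsD(1)[OF this] and Bh = coordinate_fieldsD(2)[OF this]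
    and Bne = coordinate_fieldsD(3)[OF this] and Ah = coordinate_fieldsD(4)[OF this]
    and Aij = coordinate_fieldsD(5)[OF this] and At = coordinate_fieldsD(6)[OF this]
  have "I \<noteq> {}" using I by auto
  then obtain i0 where i0: "i0 \<in> I" by blast
  have i0ne: "\<exists>x\<in>M. x $ i0 \<noteq> 0"
  proof (rule ccontr)
    assume "\<not> ?thesis"
    then have z: "x $ i0 = 0" if "x \<in> M" for x using that by blast
    obtain p where p: "p \<in> M" "B p \<noteq> 0" using Bne by blast
    have "lie_derivative (A i0) (\<lambda>x. x $ i0) p = 0"
      by (rule tangent_space_lie[where A = "A i0" and F = "\<lambda>x. x $ i0" and x = p,
            OF At[OF i0 p] hom_poly_coord z])
    then show False using Aij[OF i0 i0] p by (simp add: lie_coordinate)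
  qed
  define A' where "A' i x = x $ i0 *s A i x" for i x
  have A'h: "(\<lambda>x. A' i x $ j) \<in> hom_poly (Suc b)" for i j
    using hom_poly_mult[OF hom_poly_coord[of i0] Ah[of i j]] by (simp add: A'_def)
  have fp: "(A' i, B) \<in> field_pairs" if i: "i \<in> I" for i
  proof -
    have "tangent_to_ideal M (A' i)"
      unfolding tangent_to_ideal_def
    proof (intro allI impI ballI)
      fix F k x assume F: "F \<in> hom_poly k" "\<forall>x\<in>M. F x = 0" and x: "x \<in> M"
      show "lie_derivative (A' i) F x = 0"
      proof (rule hom_poly_zero_divisor[OF Bh lie_hom_poly[OF F(1) A'h] _ Bne x])
        fix y assume y: "y \<in> M"
        show "B y * lie_derivative (A' i) F y = 0"
        proof (cases "B y = 0")
          case False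
          have "lie_derivative (A i) F y = 0" 
            by (rule tangent_space_lie[where A = "A i" and x = y, OF At[OF i y False] F(1)]) (use F(2) in blast)
          then show ?thesis unfolding A'_def[abs_def] by (simp add: lie_field_smult[OF F(1)])
        qed simp
      qed
    qed
    then show ?thesis using A'h Bh Bne unfolding field_pairs_def by blast
  qed
  have "card (I - {i0}) = CARD('d)" using I i0 by simp
  then obtain h where h: "bij_betw h {0..<CARD('d)} (I - {i0})"
    using ex_bij_betw_nat_finite[of "I - {i0}"] by auto
  have hI: "h i \<in> I" "h i \<noteq> i0" if "i < CARD('d)" for i
    using bij_betwE[OF h] that by auto
  have hinj: "h i = h j \<longleftrightarrow> i = j" if "i < CARD('d)" "j < CARD('d)" for i j
    using bij_betw_imp_inj_on[OF h] that by (auto simp: inj_on_def)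
  define z where "z j = rat (\<lambda>x. x $ h j) (\<lambda>x. x $ i0)" for j
  define D where "D i = der (A' (h i)) B" for i
  have zp: "((\<lambda>x. x $ j), (\<lambda>x. x $ i0)) \<in> ratfun_pairs M" for j
    by (rule ratfun_pairsI[OF hom_poly_coord hom_poly_coord i0ne])
  have ln: "lie_num (A' (h i)) (\<lambda>x. x $ h j) (\<lambda>x. x $ i0) x = (if i = j then B x * (x $ i0) ^ 2 else 0)"
    if "i < CARD('d)" "j < CARD('d)" for i j x
    using Aij[OF hI(1)[OF that(1)] hI(1)[OF that(2)]] Aij[OF hI(1)[OF that(1)] i0] hI(2)[OF that(1)] hinj[OF that]
    by (simp add: lie_num_def lie_coordinate A'_def power2_eq_square)
  have "D i (z j) = (if i = j then 1 else 0)" if ij: "i < CARD('d)" "j < CARD('d)" for i j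
  proof (cases "i = j")
    case False
    then show ?thesis using ln[OF ij] der_eq_0_iff[OF fp[OF hI(1)[OF ij(1)]] zp] by (simp add: D_def z_def)
  next
    case True
    have p: "(lie_num (A' (h i)) (\<lambda>x. x $ h j) (\<lambda>x. x $ i0), \<lambda>x. B x * (x $ i0) ^ 2) \<in> ratfun_pairs M"
      by (rule lie_num_pair[OF fp[OF hI(1)[OF ij(1)]] zp])
    have "D i (z j) = rat (lie_num (A' (h i)) (\<lambda>x. x $ h j) (\<lambda>x. x $ i0)) (\<lambda>x. B x * (x $ i0) ^ 2)"
      unfolding D_def z_def by (rule der_rat[OF fp[OF hI(1)[OF ij(1)]] zp])
    also have "\<dots> = const 1"
      unfolding const_def rat_eq_iff[OF p const_pair] using ln[OF ij] True by simp
    finally show ?thesis using True by (simp add: const_1)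
  qed
  moreover have "z i \<in> function_field \<and> (\<exists>A B. (A, B) \<in> field_pairs \<and> D i = der A B)" if "i < CARD('d)" for i
    using rat_in_field[OF zp] fp[OF hI(1)[OF that]] unfolding z_def D_def by blast
  ultimately show ?thesis by blast
qed

text \<open>
  A field that is tangent to the cone in the algebraic sense is tangent in the analytic sense where the
  equations of the coordinates are regular; multiplying numerator and denominator by a form moves the
  other points into the polar set.
\<close>

lemma vfield_from_field_pair:
  assumes AB: "(A, B) \<in> field_pairs"
  shows "\<exists>A' B'. (A', B') \<in> vfield_pairs M \<and> (\<forall>P Q. (P, Q) \<in> ratfun_pairs M \<longrightarrow>
     ((\<forall>x\<in>M. lie_num A' P Q x = 0) \<longleftrightarrow> (\<forall>x\<in>M. lie_num A P Q x = 0)))"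
proof -
  obtain I H b A0 where "coordinate_fields I H b A0" using coordinate_fields_exist by blast
  note Hh = coordinate_fieldsD(2)[OF this] and Hne = coordinate_fieldsD(3)[OF this]
    and Ht = coordinate_fieldsD(7)[OF this]
  obtain k where "\<forall>i. (\<lambda>x. A x $ i) \<in> hom_poly (Suc k)" and Bk: "B \<in> hom_poly k"
    using field_pairsD(1)[OF AB] by blast
  then have Ak: "\<And>i. (\<lambda>x. A x $ i) \<in> hom_poly (Suc k)" by blast
  note Bne = field_pairsD(2)[OF AB] and tan = field_pairsD(3)[OF AB]
  define A' where "A' x = H x *s A x" for x
  define B' where "B' x = H x * B x" for x
  have "(\<lambda>x. A' x $ i) \<in> hom_poly (Suc (b + k))" for i
    using hom_poly_mult[OF Hh Ak[of i]] by (simp add: A'_def)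
  moreover have "B' \<in> hom_poly (b + k)" unfolding B'_def[abs_def] by (rule hom_poly_mult[OF Hh Bk])
  moreover have "\<exists>x\<in>M. B' x \<noteq> 0" unfolding B'_def by (rule mult_nonzero_somewhere[OF Hh Bk Hne Bne])
  moreover have "inverse (B' x) *s A' x \<in> tangent_space M x" if x: "x \<in> M" "B' x \<noteq> 0" for x
  proof -
    have nz: "H x \<noteq> 0" "B x \<noteq> 0" using x by (auto simp: B'_def)
    have "tangent_to_ideal M (\<lambda>y. inverse (B x) *s A y)"
      unfolding tangent_to_ideal_def
    proof (intro allI impI ballI)
      fix F m y assume F: "F \<in> hom_poly m" "\<forall>x\<in>M. F x = 0" and y: "y \<in> M"
      have "lie_derivative A F y = 0" using tan F y unfolding tangent_to_ideal_def by blast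
      then show "lie_derivative (\<lambda>y. inverse (B x) *s A y) F y = 0"
        using lie_field_smult[where f = "\<lambda>_. inverse (B x)", OF F(1)] by simp
    qed
    from Ht[OF this x(1) nz(1)] have "inverse (B x) *s A x \<in> tangent_space M x" .
    moreover have "inverse (B' x) *s A' x = inverse (B x) *s A x"
      using nz by (simp add: A'_def B'_def vec_eq_iff field_simps)
    ultimately show ?thesis by simp
  qed
  ultimately have "(A', B') \<in> vfield_pairs M" unfolding vfield_pairs_def by blast
  moreover have "(\<forall>x\<in>M. lie_num A' P Q x = 0) \<longleftrightarrow> (\<forall>x\<in>M. lie_num A P Q x = 0)"
    if PQ: "(P, Q) \<in> ratfun_pairs M" for P Q
  proof -
    obtain e where e: "P \<in> hom_poly e" "Q \<in> hom_poly e" using ratfun_pairsE[OF PQ] by blast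
    have l: "lie_num A' P Q x = H x * lie_num A P Q x" for x
      unfolding A'_def[abs_def] lie_num_def lie_field_smult[OF e(1)] lie_field_smult[OF e(2)]
      by (simp add: algebra_simps)
    have "lie_num A P Q x = 0" if "\<forall>x\<in>M. lie_num A' P Q x = 0" "x \<in> M" for x
      by (rule hom_poly_zero_divisor[OF Hh lie_num_hom_poly[OF Ak e] _ Hne that(2)]) (use that(1) l in auto)
    then show ?thesis using l by auto
  qed
  ultimately show ?thesis by blast
qed

text \<open>
  In the function field, first integrals become constants of derivations, and a common constant of a set of
  derivations is a constant of a single one.
\<close>

theorem single_field_with_common_first_integrals:
  assumes W: "W \<subseteq> rational_vector_fields M"
  shows "\<exists>X\<in>rational_vector_fields M.
    first_integrals M X = {h \<in> rational_functions M. \<forall>Y\<in>W. h \<in> first_integrals M Y}"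
proof -
  have vf: "(A, B) \<in> field_pairs" if AB: "(A, B) \<in> vfield_pairs M" for A B
    using vfield_tangent_to_ideal[OF AB] AB unfolding field_pairs_def vfield_pairs_def by blast
  define V where "V = {der A B |A B. (A, B) \<in> field_pairs}"
  define W' where "W' = {der A B |A B. (A, B) \<in> vfield_pairs M \<and> vfield_rel M `` {(A, B)} \<in> W}"
  obtain z D where zD: "\<forall>i<CARD('d). z i \<in> function_field \<and> (\<exists>A B. (A, B) \<in> field_pairs \<and> D i = der A B)"
    "\<forall>i<CARD('d). \<forall>j<CARD('d). D i (z j) = (if i = j then 1 else 0)"
    using dual_derivations by blast
  obtain \<tau> :: "nat \<Rightarrow> 'd option hol fract" where \<tau>: "\<forall>i. \<tau> i \<in> range const"
    "\<forall>\<alpha> \<beta> :: nat \<Rightarrow> nat. (\<Sum>i<CARD('d). of_nat (\<alpha> i) * \<tau> i) = (\<Sum>i<CARD('d). of_nat (\<beta> i) * \<tau> i) \<longrightarrow>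
      (\<forall>i<CARD('d). \<alpha> i = \<beta> i)"
    using exists_weights by blast
  have "\<exists>X\<in>V. {a \<in> function_field. X a = 0} = {a \<in> function_field. \<forall>Y\<in>W'. Y a = 0}"
  proof (rule single_derivation_with_common_constants[where C = "range const" and d = "CARD('d)"
        and z = z and D = D and \<tau> = \<tau>])
    show "is_subfield function_field" by (rule function_field_subfield)
    show "range const \<subseteq> function_field" using const_in_field by blast
    show "derivation_on function_field Y \<and> (\<forall>c\<in>range const. Y c = 0)" if "Y \<in> V" for Y
      using that der_derivation unfolding V_def by blast
    show "(\<lambda>x. a * Y x + b * Z x) \<in> V"
      if YZ: "Y \<in> V" "Z \<in> V" and ab: "a \<in> function_field" "b \<in> function_field" for Y Z a b
    proof -
      obtain A B A' B' where "Y = der A B" "(A, B) \<in> field_pairs" "Z = der A' B'" "(A', B') \<in> field_pairs"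
        using YZ unfolding V_def by blast
      then show ?thesis using der_combination[of A B A' B' a b] ab unfolding V_def by auto
    qed
    show "V \<noteq> {}" using zD(1) zero_less_card_finite[where 'a = 'd] unfolding V_def by blast
    show "z i \<in> function_field \<and> D i \<in> V" if "i < CARD('d)" for i using zD(1) that unfolding V_def by blast
    show "D i (z j) = (if i = j then 1 else 0)" if "i < CARD('d)" "j < CARD('d)" for i j using zD(2) that by blast
    show "\<tau> i \<in> range const" for i using \<tau>(1) by blast
    show "\<forall>i<CARD('d). \<alpha> i = \<beta> i"
      if "(\<Sum>i<CARD('d). of_nat (\<alpha> i) * \<tau> i) = (\<Sum>i<CARD('d). of_nat (\<beta> i) * \<tau> i)" for \<alpha> \<beta> :: "nat \<Rightarrow> nat"
      using \<tau>(2) that by blast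
    show "W' \<subseteq> V" using vf unfolding W'_def V_def by blast
  qed (rule functions_algebraically_dependent)
  then obtain A B where AB: "(A, B) \<in> field_pairs"
    and X: "{a \<in> function_field. der A B a = 0} = {a \<in> function_field. \<forall>Y\<in>W'. Y a = 0}"
    unfolding V_def by blast
  obtain A' B' where AB': "(A', B') \<in> vfield_pairs M" "\<forall>P Q. (P, Q) \<in> ratfun_pairs M \<longrightarrow>
     ((\<forall>x\<in>M. lie_num A' P Q x = 0) \<longleftrightarrow> (\<forall>x\<in>M. lie_num A P Q x = 0))"
    using vfield_from_field_pair[OF AB] by blast
  have iff: "ratfun_rel M `` {(P, Q)} \<in> first_integrals M (vfield_rel M `` {(A', B')}) \<longleftrightarrow>
     (\<forall>Y\<in>W. ratfun_rel M `` {(P, Q)} \<in> first_integrals M Y)" if PQ: "(P, Q) \<in> ratfun_pairs M" for P Q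
  proof -
    have "ratfun_rel M `` {(P, Q)} \<in> first_integrals M (vfield_rel M `` {(A', B')}) \<longleftrightarrow> der A B (rat P Q) = 0"
      using first_integral_iff[OF AB'(1) PQ] AB'(2) PQ der_eq_0_iff[OF AB PQ] by blast
    also have "\<dots> \<longleftrightarrow> (\<forall>Y\<in>W'. Y (rat P Q) = 0)"
      using X rat_in_field[OF PQ] by blast
    also have "\<dots> \<longleftrightarrow> (\<forall>A B. (A, B) \<in> vfield_pairs M \<longrightarrow> vfield_rel M `` {(A, B)} \<in> W \<longrightarrow> der A B (rat P Q) = 0)"
      unfolding W'_def by blast
    also have "\<dots> \<longleftrightarrow> (\<forall>A B. (A, B) \<in> vfield_pairs M \<longrightarrow> vfield_rel M `` {(A, B)} \<in> W \<longrightarrow>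
        ratfun_rel M `` {(P, Q)} \<in> first_integrals M (vfield_rel M `` {(A, B)}))"
      using der_eq_0_iff[OF vf PQ] first_integral_iff[OF _ PQ] by blast
    also have "\<dots> \<longleftrightarrow> (\<forall>Y\<in>W. ratfun_rel M `` {(P, Q)} \<in> first_integrals M Y)"
      using W unfolding rational_vector_fields_def quotient_def by fastforce
    finally show ?thesis .
  qed
  show ?thesis
  proof (intro bexI[of _ "vfield_rel M `` {(A', B')}"] set_eqI)
    show "vfield_rel M `` {(A', B')} \<in> rational_vector_fields M"
      unfolding rational_vector_fields_def using AB'(1) by (rule quotientI)
    fix h
    show "h \<in> first_integrals M (vfield_rel M `` {(A', B')}) \<longleftrightarrow>
      h \<in> {h \<in> rational_functions M. \<forall>Y\<in>W. h \<in> first_integrals M Y}"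
    proof (cases "h \<in> rational_functions M")
      case False
      then show ?thesis by (simp add: first_integrals_def)
    next
      case True
      then obtain P Q where "(P, Q) \<in> ratfun_pairs M" "h = ratfun_rel M `` {(P, Q)}"
        unfolding rational_functions_def quotient_def by fastforce
      then show ?thesis using iff True by simp
    qed
  qed
qed

end

theorem theorem2:
  fixes M :: "(complex^'n) set"
    and D :: "((complex^'n) set \<times> (complex^'n \<Rightarrow> complex^'n)) set"
  assumes "projective_manifold TYPE(3) M"
    and "codim_one_distribution TYPE(3) M D"
  shows "\<exists>X \<in> rational_vector_fields M. first_integrals M X = distribution_first_integrals M D"
proof -
  interpret projective_cone M "TYPE(3)" by unfold_locales (rule assms(1))
  obtain X where X: "X \<in> rational_vector_fields M" "first_integrals M X =
      {h \<in> rational_functions M. \<forall>Y\<in>{Y \<in> rational_vector_fields M. tangent_to M Y D}. h \<in> first_integrals M Y}"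
    using single_field_with_common_first_integrals[of "{Y \<in> rational_vector_fields M. tangent_to M Y D}"] by blast
  then have "first_integrals M X = distribution_first_integrals M D"
    by (auto simp: distribution_first_integrals_def)
  with X(1) show ?thesis by blast
qed

end
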